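(* Consider an IMEX-MRI-GARK method with coefficients $c^{\{S\}}$, $\Gamma^{\{k\}}$, $\Omega^{\{k\}}$ ($k=0,\dots,k_{\max}$), base IMEX-ARK matrices $A^{\{I,I\}},A^{\{E,E\}}$ with weights $b^{\{I\}},b^{\{E\}}$, and fast Runge–Kutta method $(A^{\{F,F\}},b^{\{F\}},c^{\{F\}})$ of order at least four, as described in the context. Define $$\zeta_k=b^{\{F\}T}A^{\{F,F\}}c^{\{F\}\times k},\quad \beta_k=(b^{\{F\}}\times c^{\{F\}})^TA^{\{F,F\}}c^{\{F\}\times k},\quad \xi_k=b^{\{F\}T}A^{\{F,F\}}A^{\{F,F\}}c^{\{F\}\times k},$$ $$\mathcal{A}^{\{I,\zeta\}}=LA^{\{I,I\}}+\sum_{k=0}^{k_{\max}}\zeta_k\Gamma^{\{k\}},\qquad \mathcal{A}^{\{E,\zeta\}}=LA^{\{E,E\}}+\sum_{k=0}^{k_{\max}}\zeta_k\Omega^{\{k\}},$$ $$\mathcal{A}^{\{I,\beta\}}=\tfrac12LA^{\{I,I\}}+\sum_{k=0}^{k_{\max}}\beta_k\Gamma^{\{k\}},\qquad \mathcal{A}^{\{E,\beta\}}=\tfrac12LA^{\{E,E\}}+\sum_{k=0}^{k_{\max}}\beta_k\Omega^{\{k\}},$$ $$\mathcal{A}^{\{I,\xi\}}=\tfrac12LA^{\{I,I\}}+\sum_{k=0}^{k_{\max}}\xi_k\Gamma^{\{k\}},\qquad \mathcal{A}^{\{E,\xi\}}=\tfrac12LA^{\{E,E\}}+\sum_{k=0}^{k_{\max}}\xi_k\Omega^{\{k\}}.$$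 Suppose the method is internally consistent, its base IMEX-ARK method has order at least three, and $\Delta c^{\{S\}T}\mathcal{A}^{\{I,\zeta\}}c^{\{S\}}=\Delta c^{\{S\}T}\mathcal{A}^{\{E,\zeta\}}c^{\{S\}}=\frac16$. Then the IMEX-MRI-GARK method has order four if and only if the base IMEX-ARK method has order at least four and the following coupling conditions hold for all $\sigma,\nu\in\{I,E\}$: $$\big(\Delta c^{\{S\}}\times Lc^{\{S\}}\big)^T\mathcal{A}^{\{\sigma,\zeta\}}c^{\{S\}}+\big(\Delta c^{\{S\}\times2}\big)^T\mathcal{A}^{\{\sigma,\beta\}}c^{\{S\}}=\frac18,$$ $$\Delta c^{\{S\}T}\mathcal{A}^{\{\sigma,\zeta\}}c^{\{S\}\times2}=\frac1{12},$$ $$\big(\Delta c^{\{S\}}\times(Db^{\{\sigma\}})\big)^T\mathcal{A}^{\{\nu,\zeta\}}c^{\{S\}}=\frac1{24},$$ $$\big(\Delta c^{\{S\}\times2}\big)^T\mathcal{A}^{\{\sigma,\xi\}}c^{\{S\}}+\Delta c^{\{S\}T}L\,\Delta C^{\{S\}}\mathcal{A}^{\{\sigma,\zeta\}}c^{\{S\}}=\frac1{24},$$ $$\Delta c^{\{S\}T}\mathcal{A}^{\{\sigma,\zeta\}}A^{\{\nu,\nu\}}c^{\{S\}}=\frac1{24}.$$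
   Context: Problem: $y'=f^{\{I\}}(t,y)+f^{\{E\}}(t,y)+f^{\{F\}}(t,y)$, $y(t_0)=y_0$ (slow implicit, slow explicit and fast parts). IMEX-MRI-GARK method. Data: $c^{\{S\}}\in\mathbb{R}^{s^{\{S\}}}$ with $c^{\{S\}}_1=0$; $\Delta c^{\{S\}}\in\mathbb{R}^{s^{\{S\}}}$ with $\Delta c^{\{S\}}_1=0$ and $\Delta c^{\{S\}}_i=c^{\{S\}}_i-c^{\{S\}}_{i-1}\ge 0$ for $i=2,\dots,s^{\{S\}}$; for $k=0,\dots,k_{\max}$, lower triangular $\Gamma^{\{k\}}=(\gamma^{\{k\}}_{i,j})$ and strictly lower triangular $\Omega^{\{k\}}=(\omega^{\{k\}}_{i,j})$ in $\mathbb{R}^{s^{\{S\}}\times s^{\{S\}}}$, each with zero first row. Put $\gamma_{i,j}(\tau)=\sum_{k=0}^{k_{\max}}\gamma_{i,j}^{\{k\}}\tau^k$, $\omega_{i,j}(\tau)=\sum_{k=0}^{k_{\max}}\omega_{i,j}^{\{k\}}\tau^k$. One step of size $H$ from $t_n$: $Y_1^{\{S\}}=y_n$; for $i=2,\dots,s^{\{S\}}$ let $v(0)=Y^{\{S\}}_{i-1}$, $T_{i-1}=t_n+c^{\{S\}}_{i-1}H$, solve on $\theta\in[0,H]$ $$v'(\theta)=\Delta c_i^{\{S\}}f^{\{F\}}\big(T_{i-1}+\Delta c_i^{\{S\}}\theta,v(\theta)\big)+\sum_{j=1}^{i}\gamma_{i,j}(\theta/H)f^{\{I\}}_j+\sum_{j=1}^{i-1}\omega_{i,j}(\theta/H)f^{\{E\}}_j,$$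 and set $Y_i^{\{S\}}=v(H)$, where $f^{\{\sigma\}}_j=f^{\{\sigma\}}(t_n+c^{\{S\}}_jH,Y^{\{S\}}_j)$ for $\sigma\in\{I,E\}$; finally $y_{n+1}=Y^{\{S\}}_{s^{\{S\}}}$. Base IMEX-ARK method. Let $\overline\Gamma=\sum_{k}\frac{1}{k+1}\Gamma^{\{k\}}$, $\overline\Omega=\sum_k\frac1{k+1}\Omega^{\{k\}}$, and $E\in\mathbb{R}^{s^{\{S\}}\times s^{\{S\}}}$ with $E_{i,j}=1$ for $i\ge j$ and $0$ otherwise. The base method is the additive Runge–Kutta method $Y_i=y_n+H\sum_j a^{\{I,I\}}_{i,j}f^{\{I\}}(t_n+c^{\{S\}}_jH,Y_j)+H\sum_j a^{\{E,E\}}_{i,j}f^{\{E\}}(t_n+c^{\{S\}}_jH,Y_j)$, $y_{n+1}=Y_{s^{\{S\}}}$, for $y'=f^{\{I\}}+f^{\{E\}}$, with $A^{\{I,I\}}=E\overline\Gamma$, $A^{\{E,E\}}=E\overline\Omega$. It is stiffly accurate: its weights $b^{\{I\}},b^{\{E\}}$ (column vectors) are the transposed last rows of $A^{\{I,I\}},A^{\{E,E\}}$. It is assumed internally consistent: $A^{\{I,I\}}\mathbb{1}^{\{S\}}=A^{\{E,E\}}\mathbb{1}^{\{S\}}=c^{\{S\}}$. Fast method. Each fast initial-value problem is solved with a single step (of size $H$ in $\theta$) of a fixed $s^{\{F\}}$-stage Runge–Kutta method $(A^{\{F,F\}},b^{\{F\}},c^{\{F\}})$ with $A^{\{F,F\}}\mathbb{1}^{\{F\}}=c^{\{F\}}$,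 whose order is at least that considered for the IMEX-MRI-GARK method (here four), and with $b^{\{F\}T}c^{\{F\}\times k}=\frac1{k+1}$ for $k=0,\dots,k_{\max}$. Explicitly, for $i=2,\dots,s^{\{S\}}$ and $p=1,\dots,s^{\{F\}}$, with $f^{\{F,i\}}_l=f^{\{F\}}(T_{i-1}+c^{\{F\}}_l\Delta c^{\{S\}}_iH,Y^{\{F,i\}}_l)$, $$Y^{\{F,i\}}_p=Y^{\{S\}}_{i-1}+H\sum_{l}a^{\{F,F\}}_{p,l}\Big(\Delta c^{\{S\}}_if^{\{F,i\}}_l+\sum_{j\le i}\gamma_{i,j}(c^{\{F\}}_l)f^{\{I\}}_j+\sum_{j<i}\omega_{i,j}(c^{\{F\}}_l)f^{\{E\}}_j\Big),$$ and $Y^{\{S\}}_i$ is given by the same formula with $a^{\{F,F\}}_{p,l}$ replaced by $b^{\{F\}}_l$. This fully discrete scheme is a three-partition ($I,E,F$) generalized-structure additive Runge–Kutta (GARK) method. Internally consistent means $\Gamma^{\{0\}}\mathbb{1}^{\{S\}}=\Omega^{\{0\}}\mathbb{1}^{\{S\}}=\Delta c^{\{S\}}$ and $\Gamma^{\{k\}}\mathbb{1}^{\{S\}}=\Omega^{\{k\}}\mathbb{1}^{\{S\}}=0$ for all $k\ge1$. Order. A one-step method for an additively split problem has order $p$ (meaning at least $p$) if its local error after one step of size $H$ is $O(H^{p+1})$ for all sufficiently smooth right-hand-side components; equivalently, all (additive Runge–Kutta / GARK) order conditions up to order $p$ hold. The order of the IMEX-MRI-GARK method is that of the fully discrete scheme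 above. Notation. $\mathbb{1}^{\{S\}},\mathbb{1}^{\{F\}}$ are vectors of ones in $\mathbb{R}^{s^{\{S\}}},\mathbb{R}^{s^{\{F\}}}$; $a\times b$ is the element-wise product of vectors and $c^{\times k}$ the element-wise power ($c^{\times0}$ is the vector of ones). The matrices $L,D,\Delta C^{\{S\}}\in\mathbb{R}^{s^{\{S\}}\times s^{\{S\}}}$ are: $L_{i,j}=\delta_{i,j+1}$; $D_{i,j}=1$ for $j\ge i$ and $0$ otherwise; $(\Delta C^{\{S\}})_{i,j}=\Delta c^{\{S\}}_j$ for $i\ge j$ and $0$ otherwise. *)

theory Defs
  imports "HOL-Analysis.Analysis" "HOL-Library.Landau_Symbols"
begin

(* The number of stages and the dimension d of the differential equation are quantified inside
   the notions below, so vectors and matrices are functions on nat with explicit bounds.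
   Stages are numbered 1..s; the components of a state are numbered 0..d-1 and the
   values of a state at other arguments carry no information. *)

type_synonym vec = "nat \<Rightarrow> real"
type_synonym matr = "nat \<Rightarrow> nat \<Rightarrow> real"

section \<open>Vectors and matrices of size s\<close>

definition dot :: "nat \<Rightarrow> vec \<Rightarrow> vec \<Rightarrow> real" where
  "dot s x y = (\<Sum>i=1..s. x i * y i)"

definition mat_vec :: "nat \<Rightarrow> matr \<Rightarrow> vec \<Rightarrow> vec" where
  "mat_vec s A x = (\<lambda>i. \<Sum>j=1..s. A i j * x j)"

definition mat_mul :: "nat \<Rightarrow> matr \<Rightarrow> matr \<Rightarrow> matr" where
  "mat_mul s A B = (\<lambda>i j. \<Sum>k=1..s. A i k * B k j)"

definition ones :: vec where
  "ones = (\<lambda>i. 1)"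

definition had :: "vec \<Rightarrow> vec \<Rightarrow> vec" where
  "had x y = (\<lambda>i. x i * y i)"

definition had_pow :: "vec \<Rightarrow> nat \<Rightarrow> vec" where
  "had_pow x k = (\<lambda>i. x i ^ k)"

section \<open>Additively split initial value problems and order of one-step methods\<close>

(* Right-hand side of a split problem y' = sum of f p t y over the partitions p. *)
type_synonym 'p split_rhs = "'p \<Rightarrow> real \<Rightarrow> vec \<Rightarrow> vec"

(* C_class d r g: all partial derivatives of g with respect to t and x_0,...,x_(d-1) up to
   order r exist and are continuous. *)
primrec C_class :: "nat \<Rightarrow> nat \<Rightarrow> (real \<Rightarrow> vec \<Rightarrow> real) \<Rightarrow> bool" where
  "C_class d 0 g \<longleftrightarrow> continuous_on UNIV (\<lambda>(t, x). g t x)"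
| "C_class d (Suc r) g \<longleftrightarrow>
     continuous_on UNIV (\<lambda>(t, x). g t x) \<and>
     (\<exists>gt gx.
        (\<forall>t x. ((\<lambda>u. g u x) has_real_derivative gt t x) (at t)) \<and>
        (\<forall>k<d. \<forall>t x. ((\<lambda>u. g t (x(k := u))) has_real_derivative gx k t x) (at (x k))) \<and>
        C_class d r gt \<and> (\<forall>k<d. C_class d r (gx k)))"

(* A C^r function from R x R^d to R^d. For functions of the first d coordinates only, continuity
   in the product topology on vec is ordinary continuity on R^d. *)
definition smooth_field :: "nat \<Rightarrow> nat \<Rightarrow> (real \<Rightarrow> vec \<Rightarrow> vec) \<Rightarrow> bool" where
  "smooth_field d r f \<longleftrightarrow>
     (\<forall>k<d. (\<forall>t x x'. (\<forall>l<d. x l = x' l) \<longrightarrow> f t x k = f t x' k) \<and>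
            C_class d r (\<lambda>t x. f t x k))"

definition exact_solution ::
  "nat \<Rightarrow> ('p::finite) split_rhs \<Rightarrow> real \<Rightarrow> vec \<Rightarrow> real \<Rightarrow> (real \<Rightarrow> vec) \<Rightarrow> bool" where
  "exact_solution d f t0 y0 h y \<longleftrightarrow>
     (\<forall>k<d. y t0 k = y0 k \<and>
        (\<forall>t\<in>{t0..t0 + h}. ((\<lambda>u. y u k) has_real_derivative (\<Sum>p\<in>UNIV. f p t (y t) k))
                            (at t within {t0..t0 + h})))"

(* step d f t H y0 Y y1: the stage values Y and the result y1 satisfy the equations that define
   one step of size H from (t, y0), for the d-dimensional problem with right-hand side f. *)
type_synonym ('p, 'q) step_rel =
  "nat \<Rightarrow> 'p split_rhs \<Rightarrow> real \<Rightarrow> real \<Rightarrow> vec \<Rightarrow> ('q \<Rightarrow> vec) \<Rightarrow> vec \<Rightarrow> bool"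

(* Order at least p, for a method with stage set Q: for all sufficiently smooth problems of every
   dimension, the local error after one step is O(H^(p+1)) as H tends to 0 from above.
   The stage equations of an implicit method may have further solutions that stay away from y0;
   the limit condition selects the solutions that tend to y0. These exist and are
   unique for small H when f is smooth. *)
definition has_order :: "'q set \<Rightarrow> (('p::finite), 'q) step_rel \<Rightarrow> nat \<Rightarrow> bool" where
  "has_order Q step p \<longleftrightarrow>
     (\<exists>r. \<forall>d f t0 y0 h y Y y1.
        (\<forall>\<sigma>. smooth_field d r (f \<sigma>)) \<longrightarrow>
        0 < h \<longrightarrow> exact_solution d f t0 y0 h y \<longrightarrow>
        (\<forall>\<^sub>F H in at_right 0. step d f t0 H y0 (Y H) (y1 H)) \<longrightarrow>
        (\<forall>q\<in>Q. \<forall>k<d. ((\<lambda>H. Y H q k) \<longlongrightarrow> y0 k) (at_right 0)) \<longrightarrow>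
        (\<forall>k<d. (\<lambda>H. y1 H k - y (t0 + H) k) \<in> O[at_right 0](\<lambda>H. H ^ (p + 1))))"

section \<open>Runge-Kutta methods\<close>

definition rk_step :: "nat \<Rightarrow> matr \<Rightarrow> vec \<Rightarrow> vec \<Rightarrow> (unit, nat) step_rel" where
  "rk_step s A b c d f t H y0 Y y1 \<longleftrightarrow>
     (\<forall>k<d.
        (\<forall>i\<in>{1..s}. Y i k = y0 k + H * (\<Sum>j=1..s. A i j * f () (t + c j * H) (Y j) k)) \<and>
        y1 k = y0 k + H * (\<Sum>j=1..s. b j * f () (t + c j * H) (Y j) k))"

definition rk_has_order :: "nat \<Rightarrow> matr \<Rightarrow> vec \<Rightarrow> vec \<Rightarrow> nat \<Rightarrow> bool" where
  "rk_has_order s A b c p \<longleftrightarrow> has_order {1..s} (rk_step s A b c) p"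

(* The slow partitions: implicit and explicit. *)
datatype slow = Impl | Expl

instance slow :: finite
proof
  have "(UNIV :: slow set) \<subseteq> {Impl, Expl}" using slow.exhaust by auto
  then show "finite (UNIV :: slow set)" by (rule finite_subset) simp
qed

(* A stiffly accurate additive Runge-Kutta method: the result is the last stage. *)
definition imex_ark_step :: "nat \<Rightarrow> (slow \<Rightarrow> matr) \<Rightarrow> vec \<Rightarrow> (slow, nat) step_rel" where
  "imex_ark_step s A c d f t H y0 Y y1 \<longleftrightarrow>
     (\<forall>k<d.
        (\<forall>i\<in>{1..s}. Y i k = y0 k
            + H * (\<Sum>j=1..s. A Impl i j * f Impl (t + c j * H) (Y j) k)
            + H * (\<Sum>j=1..s. A Expl i j * f Expl (t + c j * H) (Y j) k)) \<and>
        y1 k = Y s k)"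

section \<open>IMEX-MRI-GARK methods\<close>

(* The coefficients are G :: slow => nat => nat => nat => real: G Impl k is Gamma^k, and
   G Expl k is Omega^k, for k = 0..kmax. *)
type_synonym slow_coeffs = "slow \<Rightarrow> nat \<Rightarrow> matr"

definition slow_coeffs_of :: "(nat \<Rightarrow> matr) \<Rightarrow> (nat \<Rightarrow> matr) \<Rightarrow> slow_coeffs" where
  "slow_coeffs_of \<Gamma> \<Omega> \<sigma> = (case \<sigma> of Impl \<Rightarrow> \<Gamma> | Expl \<Rightarrow> \<Omega>)"

definition increments :: "vec \<Rightarrow> vec" where
  "increments c i = (if i \<le> 1 then 0 else c i - c (i - 1))"

definition mri_gark_data :: "nat \<Rightarrow> nat \<Rightarrow> vec \<Rightarrow> slow_coeffs \<Rightarrow> bool" where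
  "mri_gark_data s kmax c G \<longleftrightarrow>
     1 \<le> s \<and> c 1 = 0 \<and> (\<forall>i\<in>{2..s}. 0 \<le> increments c i) \<and>
     (\<forall>k\<le>kmax.
        (\<forall>i\<in>{1..s}. \<forall>j\<in>{1..s}. i < j \<longrightarrow> G Impl k i j = 0) \<and>
        (\<forall>i\<in>{1..s}. \<forall>j\<in>{1..s}. i \<le> j \<longrightarrow> G Expl k i j = 0) \<and>
        (\<forall>\<sigma>. \<forall>j\<in>{1..s}. G \<sigma> k 1 j = 0))"

definition mri_internally_consistent :: "nat \<Rightarrow> nat \<Rightarrow> vec \<Rightarrow> slow_coeffs \<Rightarrow> bool" where
  "mri_internally_consistent s kmax c G \<longleftrightarrow>
     (\<forall>\<sigma>. \<forall>i\<in>{1..s}.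
        mat_vec s (G \<sigma> 0) ones i = increments c i \<and>
        (\<forall>k\<in>{1..kmax}. mat_vec s (G \<sigma> k) ones i = 0))"

(* gamma_(i,j)(tau) and omega_(i,j)(tau) *)
definition coeff_poly :: "nat \<Rightarrow> (nat \<Rightarrow> matr) \<Rightarrow> nat \<Rightarrow> nat \<Rightarrow> real \<Rightarrow> real" where
  "coeff_poly kmax W i j \<tau> = (\<Sum>k=0..kmax. W k i j * \<tau> ^ k)"

definition E_mat :: matr where
  "E_mat i j = (if j \<le> i then 1 else 0)"

definition L_mat :: matr where
  "L_mat i j = (if i = j + 1 then 1 else 0)"

definition D_mat :: matr where
  "D_mat i j = (if i \<le> j then 1 else 0)"

definition DeltaC_mat :: "vec \<Rightarrow> matr" where
  "DeltaC_mat c i j = (if j \<le> i then increments c j else 0)"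

definition mean_coeff :: "nat \<Rightarrow> (nat \<Rightarrow> matr) \<Rightarrow> matr" where
  "mean_coeff kmax W i j = (\<Sum>k=0..kmax. 1 / (real k + 1) * W k i j)"

definition base_A :: "nat \<Rightarrow> nat \<Rightarrow> slow_coeffs \<Rightarrow> slow \<Rightarrow> matr" where
  "base_A s kmax G \<sigma> = mat_mul s E_mat (mean_coeff kmax (G \<sigma>))"

definition base_b :: "nat \<Rightarrow> nat \<Rightarrow> slow_coeffs \<Rightarrow> slow \<Rightarrow> vec" where
  "base_b s kmax G \<sigma> = base_A s kmax G \<sigma> s"

definition base_internally_consistent :: "nat \<Rightarrow> nat \<Rightarrow> vec \<Rightarrow> slow_coeffs \<Rightarrow> bool" where
  "base_internally_consistent s kmax c G \<longleftrightarrow>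
     (\<forall>\<sigma>. \<forall>i\<in>{1..s}. mat_vec s (base_A s kmax G \<sigma>) ones i = c i)"

definition base_has_order :: "nat \<Rightarrow> nat \<Rightarrow> vec \<Rightarrow> slow_coeffs \<Rightarrow> nat \<Rightarrow> bool" where
  "base_has_order s kmax c G p \<longleftrightarrow> has_order {1..s} (imex_ark_step s (base_A s kmax G) c) p"

datatype part = Slow slow | Fast

instance part :: finite
proof
  have "x \<in> insert Fast (range Slow)" for x by (cases x) auto
  then have "(UNIV :: part set) \<subseteq> insert Fast (range Slow)" by blast
  then show "finite (UNIV :: part set)" by (rule finite_subset) simp
qed

(* SlowStage i is Y^S_i; FastStage i p is Y^(F,i)_p, the p-th stage of the fast method applied on
   the way from Y^S_(i-1) to Y^S_i. *)
datatype stage = SlowStage nat | FastStage nat nat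

definition mri_stages :: "nat \<Rightarrow> nat \<Rightarrow> stage set" where
  "mri_stages s sF = SlowStage ` {1..s} \<union> {FastStage i p | i p. i \<in> {2..s} \<and> p \<in> {1..sF}}"

definition mri_step ::
  "nat \<Rightarrow> nat \<Rightarrow> vec \<Rightarrow> slow_coeffs \<Rightarrow> nat \<Rightarrow> matr \<Rightarrow> vec \<Rightarrow> vec \<Rightarrow> (part, stage) step_rel" where
  "mri_step s kmax c G sF AF bF cF d f t H y0 Y y1 \<longleftrightarrow>
     (let fS = (\<lambda>\<sigma> j. f (Slow \<sigma>) (t + c j * H) (Y (SlowStage j)));
          fF = (\<lambda>i l. f Fast (t + c (i - 1) * H + cF l * increments c i * H) (Y (FastStage i l)));
          rhs = (\<lambda>i l k. increments c i * fF i l k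
                  + (\<Sum>j=1..i. coeff_poly kmax (G Impl) i j (cF l) * fS Impl j k)
                  + (\<Sum>j=1..i - 1. coeff_poly kmax (G Expl) i j (cF l) * fS Expl j k))
      in \<forall>k<d.
           Y (SlowStage 1) k = y0 k \<and>
           (\<forall>i\<in>{2..s}.
              (\<forall>p\<in>{1..sF}. Y (FastStage i p) k
                  = Y (SlowStage (i - 1)) k + H * (\<Sum>l=1..sF. AF p l * rhs i l k)) \<and>
              Y (SlowStage i) k
                  = Y (SlowStage (i - 1)) k + H * (\<Sum>l=1..sF. bF l * rhs i l k)) \<and>
           y1 k = Y (SlowStage s) k)"

definition mri_has_order ::
  "nat \<Rightarrow> nat \<Rightarrow> vec \<Rightarrow> slow_coeffs \<Rightarrow> nat \<Rightarrow> matr \<Rightarrow> vec \<Rightarrow> vec \<Rightarrow> nat \<Rightarrow> bool" where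
  "mri_has_order s kmax c G sF AF bF cF p \<longleftrightarrow>
     has_order (mri_stages s sF) (mri_step s kmax c G sF AF bF cF) p"

section \<open>Quantities in the coupling conditions\<close>

definition zeta :: "nat \<Rightarrow> matr \<Rightarrow> vec \<Rightarrow> vec \<Rightarrow> nat \<Rightarrow> real" where
  "zeta sF AF bF cF k = dot sF bF (mat_vec sF AF (had_pow cF k))"

definition beta :: "nat \<Rightarrow> matr \<Rightarrow> vec \<Rightarrow> vec \<Rightarrow> nat \<Rightarrow> real" where
  "beta sF AF bF cF k = dot sF (had bF cF) (mat_vec sF AF (had_pow cF k))"

definition xi :: "nat \<Rightarrow> matr \<Rightarrow> vec \<Rightarrow> vec \<Rightarrow> nat \<Rightarrow> real" where
  "xi sF AF bF cF k = dot sF bF (mat_vec sF AF (mat_vec sF AF (had_pow cF k)))"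

(* w L A^(sigma,sigma) + sum over k of z_k Gamma^k (or Omega^k) *)
definition coupling_mat ::
  "nat \<Rightarrow> nat \<Rightarrow> slow_coeffs \<Rightarrow> real \<Rightarrow> (nat \<Rightarrow> real) \<Rightarrow> slow \<Rightarrow> matr" where
  "coupling_mat s kmax G w z \<sigma> i j =
     w * mat_mul s L_mat (base_A s kmax G \<sigma>) i j + (\<Sum>k=0..kmax. z k * G \<sigma> k i j)"

end

theory Submission
  imports Defs
begin

text \<open>The fully discrete scheme, the base method and the fast method are all additive Runge--Kutta
  methods whose partitions share one set of stages, and internal consistency gives every stage a
  single node. For such methods, order four is equivalent to eight families of order conditions.

  Sufficiency: let \<open>P\<close> be a polynomial that satisfies the differential equation up to \<open>O(\<tau>\<^sup>4)\<close>.
  By internal consistency the stage errors \<open>Y\<^sub>q - P(c\<^sub>qH)\<close> are \<open>O(H\<^sup>2)\<close>, so in the final quadrature the right-hand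
  sides may be replaced by their linearizations along \<open>P\<close> at the cost of \<open>O(H\<^sup>5)\<close>. What remains are
  one-variable Taylor expansions along \<open>P\<close>, whose coefficients of \<open>H, \<dots>, H\<^sup>4\<close> vanish by the order conditions.
  Necessity: a cascade of three quadratures isolates each condition.

  For the fully discrete scheme, applying the fast partition telescopes over the slow stages. The
  conditions in which a slow partition is followed by the fast one reduce to those of the base method,
  and those in which the fast partition is followed by a slow one give the coupling conditions.\<close>

section \<open>Smooth curves and fields\<close>

text \<open>The Taylor coefficients of the fields and of their Jacobians along the approximate
  solution are never computed. They are only known to exist, and the order conditions annihilate the
  numbers that multiply them; this takes the place of elementary differentials. Order four is the
  range in which one linearization suffices: with stage errors of size H^2, a quadratic term
  contributes only H * H^4. Two features of the definition of order shape the rest. The stages are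
  merely some solution that tends to y0, so even their first-order accuracy must be earned by
  repeated use of the stage equations. The smoothness class is existentially quantified, so the test
  problems for necessity must be smooth of every class; polynomial fields with polynomial solutions
  serve. The coupling matrices arise as averages of slow actions over the fast stages inside one
  slow interval. The weights bF, bF x cF and the transpose of AF applied to bF produce zeta, beta
  and xi, and the sums 1, 1/2, 1/2 of these weights are the factors in front of the L A
  terms.\<close>

primrec smooth_curve :: "nat \<Rightarrow> (real \<Rightarrow> real) \<Rightarrow> bool" where
  "smooth_curve 0 u \<longleftrightarrow> continuous_on UNIV u"
| "smooth_curve (Suc n) u \<longleftrightarrow> (\<exists>u'. (\<forall>\<tau>. (u has_real_derivative u' \<tau>) (at \<tau>)) \<and> smooth_curve n u')"

lemma smooth_curve_continuous: "smooth_curve n u \<Longrightarrow> continuous_on UNIV u"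
  by (cases n) (auto intro: continuous_at_imp_continuous_on dest: DERIV_isCont)

lemma smooth_curve_Suc: "smooth_curve (Suc n) u \<Longrightarrow> smooth_curve n u"
proof (induction n arbitrary: u)
  case 0
  then show ?case by (metis smooth_curve_continuous smooth_curve.simps(1))
next
  case (Suc n)
  then show ?case by (metis smooth_curve.simps(2))
qed

lemma smooth_curve_const: "smooth_curve n (\<lambda>\<tau>. a)"
proof (induction n arbitrary: a)
  case (Suc n)
  have "((\<lambda>\<tau>. a) has_real_derivative 0) (at \<tau>)" for \<tau> by simp
  with Suc[of 0] show ?case by (auto intro!: exI[of _ "\<lambda>_. 0"])
qed simp

lemma smooth_curve_add:
  "smooth_curve n u \<Longrightarrow> smooth_curve n v \<Longrightarrow> smooth_curve n (\<lambda>\<tau>. u \<tau> + v \<tau>)"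
proof (induction n arbitrary: u v)
  case 0
  then show ?case by (auto intro: continuous_intros)
next
  case (Suc n)
  then obtain u' v' where d: "\<And>\<tau>. (u has_real_derivative u' \<tau>) (at \<tau>)" "smooth_curve n u'"
    "\<And>\<tau>. (v has_real_derivative v' \<tau>) (at \<tau>)" "smooth_curve n v'" by auto
  show ?case unfolding smooth_curve.simps
    by (intro exI[of _ "\<lambda>\<tau>. u' \<tau> + v' \<tau>"] conjI allI DERIV_add d Suc.IH)
qed

lemma smooth_curve_mult:
  "smooth_curve n u \<Longrightarrow> smooth_curve n v \<Longrightarrow> smooth_curve n (\<lambda>\<tau>. u \<tau> * v \<tau>)"
proof (induction n arbitrary: u v)
  case 0
  then show ?case by (auto intro: continuous_intros)
next
  case (Suc n)
  then obtain u' v' where d: "\<And>\<tau>. (u has_real_derivative u' \<tau>) (at \<tau>)" "smooth_curve n u'"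
    "\<And>\<tau>. (v has_real_derivative v' \<tau>) (at \<tau>)" "smooth_curve n v'" by auto
  have "smooth_curve n u" "smooth_curve n v" using Suc.prems smooth_curve_Suc by auto
  with d Suc.IH have "smooth_curve n (\<lambda>\<tau>. u' \<tau> * v \<tau> + v' \<tau> * u \<tau>)"
    by (intro smooth_curve_add) auto
  then show ?case unfolding smooth_curve.simps
    by (intro exI[of _ "\<lambda>\<tau>. u' \<tau> * v \<tau> + v' \<tau> * u \<tau>"] conjI allI DERIV_mult d)
qed

lemma smooth_curve_sum:
  "(\<And>i. i \<in> I \<Longrightarrow> smooth_curve n (u i)) \<Longrightarrow> smooth_curve n (\<lambda>\<tau>. \<Sum>i\<in>I. u i \<tau>)"
  by (induction I rule: infinite_finite_induct) (auto intro: smooth_curve_const smooth_curve_add)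

lemma smooth_curve_affine: "smooth_curve n (\<lambda>\<tau>. a + b * \<tau>)"
proof (cases n)
  case (Suc m)
  have "((\<lambda>\<tau>. a + b * \<tau>) has_real_derivative b) (at \<tau>)" for \<tau>
    by (auto intro!: derivative_eq_intros)
  then show ?thesis using Suc smooth_curve_const by (auto intro!: exI[of _ "\<lambda>\<tau>. b"])
qed (auto intro!: continuous_intros)

lemma smooth_curve_power: "smooth_curve n (\<lambda>\<tau>. \<tau> ^ m)"
proof (induction m)
  case 0
  then show ?case by (simp add: smooth_curve_const)
next
  case (Suc m)
  then show ?case using smooth_curve_mult[OF smooth_curve_affine[of n 0 1]] by simp
qed

text \<open>Convergence in \<open>vec\<close> is convergence of every coordinate, including those
  beyond the dimension. This is why the curves and families below are frozen or truncated from index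
  \<open>d\<close> on.\<close>

lemma continuous_field_tendsto:
  fixes g :: "real \<Rightarrow> vec \<Rightarrow> real"
  assumes "continuous_on UNIV (\<lambda>(t, x). g t x)"
    and "(T \<longlongrightarrow> t) F" "\<And>k. ((\<lambda>\<tau>. X \<tau> k) \<longlongrightarrow> x k) F"
  shows "((\<lambda>\<tau>. g (T \<tau>) (X \<tau>)) \<longlongrightarrow> g t x) F"
proof -
  have "(X \<longlongrightarrow> x) F"
    using assms(3) limitin_componentwise[of "\<lambda>_. euclidean" UNIV X x F]
    by (simp add: euclidean_product_topology)
  then have "((\<lambda>\<tau>. (T \<tau>, X \<tau>)) \<longlongrightarrow> (t, x)) F" using assms(2) by (intro tendsto_Pair)
  moreover have "isCont (\<lambda>(t, x). g t x) (t, x)"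
    using assms(1) by (simp add: continuous_on_eq_continuous_at)
  ultimately show ?thesis using isCont_tendsto_compose by fastforce
qed


text \<open>The chain rule needs only continuous partial derivatives: the coordinates are moved one at a
  time, and the mean value theorem is applied to each move.\<close>

lemma chain_rule_partials:
  fixes g :: "real \<Rightarrow> vec \<Rightarrow> real"
  assumes gt: "\<And>t x. ((\<lambda>u. g u x) has_real_derivative gt t x) (at t)"
    and gx: "\<And>k t x. k < d \<Longrightarrow> ((\<lambda>u. g t (x(k := u))) has_real_derivative gx k t x) (at (x k))"
    and cx: "\<And>k. k < d \<Longrightarrow> continuous_on UNIV (\<lambda>(t, x). gx k t x)"
    and T: "(T has_real_derivative T') (at \<tau>0)"
    and X: "\<And>k. k < d \<Longrightarrow> ((\<lambda>\<tau>. X \<tau> k) has_real_derivative X' k) (at \<tau>0)"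
    and X0: "\<And>k \<tau>. d \<le> k \<Longrightarrow> X \<tau> k = X \<tau>0 k"
  shows "((\<lambda>\<tau>. g (T \<tau>) (X \<tau>)) has_real_derivative
    gt (T \<tau>0) (X \<tau>0) * T' + (\<Sum>k<d. gx k (T \<tau>0) (X \<tau>0) * X' k)) (at \<tau>0)"
proof -
  define Z where "Z n \<tau> = (\<lambda>k. if k < n then X \<tau> k else X \<tau>0 k)" for n \<tau>
  have ZX: "Z d \<tau> = X \<tau>" for \<tau>
  proof
    show "Z d \<tau> k = X \<tau> k" for k
      using X0[of k \<tau>] by (cases "k < d") (simp_all add: Z_def)
  qed
  have "((\<lambda>\<tau>. g (T \<tau>) (Z n \<tau>)) has_real_derivative
      gt (T \<tau>0) (X \<tau>0) * T' + (\<Sum>k<n. gx k (T \<tau>0) (X \<tau>0) * X' k)) (at \<tau>0)" if "n \<le> d" for n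
    using that
  proof (induction n)
    case 0
    have "Z 0 = (\<lambda>\<tau>. X \<tau>0)" by (auto simp: Z_def)
    then show ?case using DERIV_chain2[OF gt T, of "X \<tau>0"] by simp
  next
    case (Suc n)
    then have n: "n < d" by simp
    define \<psi> where "\<psi> \<tau> = g (T \<tau>) (Z (Suc n) \<tau>) - g (T \<tau>) (Z n \<tau>)" for \<tau>
    have upd: "Z (Suc n) \<tau> = (Z n \<tau>)(n := X \<tau> n)" "(Z n \<tau>)(n := X \<tau>0 n) = Z n \<tau>" for \<tau>
      by (auto simp: Z_def fun_eq_iff less_Suc_eq)
    have "\<exists>\<xi>. \<bar>\<xi> - X \<tau>0 n\<bar> \<le> \<bar>X \<tau> n - X \<tau>0 n\<bar> \<and>
        \<psi> \<tau> = (X \<tau> n - X \<tau>0 n) * gx n (T \<tau>) ((Z n \<tau>)(n := \<xi>))" for \<tau>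
    proof -
      have D: "((\<lambda>u. g (T \<tau>) ((Z n \<tau>)(n := u))) has_real_derivative
          gx n (T \<tau>) ((Z n \<tau>)(n := u))) (at u)" for u
        using gx[OF n, of "T \<tau>" "(Z n \<tau>)(n := u)"] by simp
      have \<psi>: "\<psi> \<tau> = g (T \<tau>) ((Z n \<tau>)(n := X \<tau> n)) - g (T \<tau>) ((Z n \<tau>)(n := X \<tau>0 n))"
        by (simp only: \<psi>_def upd)
      consider "X \<tau> n = X \<tau>0 n" | "X \<tau> n < X \<tau>0 n" | "X \<tau>0 n < X \<tau> n" by linarith
      then show ?thesis
      proof cases
        case 1
        then show ?thesis by (intro exI[of _ "X \<tau>0 n"]) (simp add: \<psi>)
      next
        case 2
        from MVT2[OF this D] obtain z where "X \<tau> n < z" "z < X \<tau>0 n"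
          "g (T \<tau>) ((Z n \<tau>)(n := X \<tau>0 n)) - g (T \<tau>) ((Z n \<tau>)(n := X \<tau> n))
            = (X \<tau>0 n - X \<tau> n) * gx n (T \<tau>) ((Z n \<tau>)(n := z))" by blast
        then show ?thesis by (intro exI[of _ z]) (auto simp: \<psi> algebra_simps)
      next
        case 3
        from MVT2[OF this D] obtain z where "X \<tau>0 n < z" "z < X \<tau> n"
          "g (T \<tau>) ((Z n \<tau>)(n := X \<tau> n)) - g (T \<tau>) ((Z n \<tau>)(n := X \<tau>0 n))
            = (X \<tau> n - X \<tau>0 n) * gx n (T \<tau>) ((Z n \<tau>)(n := z))" by blast
        then show ?thesis by (intro exI[of _ z]) (auto simp: \<psi>)
      qed
    qed
    then obtain \<xi> where \<xi>: "\<And>\<tau>. \<bar>\<xi> \<tau> - X \<tau>0 n\<bar> \<le> \<bar>X \<tau> n - X \<tau>0 n\<bar>"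
      "\<And>\<tau>. \<psi> \<tau> = (X \<tau> n - X \<tau>0 n) * gx n (T \<tau>) ((Z n \<tau>)(n := \<xi> \<tau>))" by metis
    have Xlim: "((\<lambda>\<tau>. X \<tau> k) \<longlongrightarrow> X \<tau>0 k) (at \<tau>0)" if "k < d" for k
      using DERIV_isCont[OF X[OF that]] by (simp add: isCont_def)
    have "(\<xi> \<longlongrightarrow> X \<tau>0 n) (at \<tau>0)"
    proof (subst Lim_null, rule Lim_null_comparison)
      show "\<forall>\<^sub>F \<tau> in at \<tau>0. norm (\<xi> \<tau> - X \<tau>0 n) \<le> \<bar>X \<tau> n - X \<tau>0 n\<bar>" using \<xi>(1) by simp
      show "((\<lambda>\<tau>. \<bar>X \<tau> n - X \<tau>0 n\<bar>) \<longlongrightarrow> 0) (at \<tau>0)"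
        using Xlim[OF n] by (subst tendsto_rabs_zero_iff) (simp add: LIM_zero)
    qed
    then have "((\<lambda>\<tau>. ((Z n \<tau>)(n := \<xi> \<tau>)) k) \<longlongrightarrow> X \<tau>0 k) (at \<tau>0)" for k
      using Xlim[of k] n by (cases "k = n"; cases "k < n") (auto simp: Z_def)
    then have lim: "((\<lambda>\<tau>. gx n (T \<tau>) ((Z n \<tau>)(n := \<xi> \<tau>))) \<longlongrightarrow> gx n (T \<tau>0) (X \<tau>0)) (at \<tau>0)"
      using DERIV_isCont[OF T] by (intro continuous_field_tendsto[OF cx[OF n]]) (simp_all add: isCont_def)
    have "\<psi> \<tau>0 = 0" by (simp add: \<psi>_def Z_def)
    \<comment> \<open>The difference quotient of \<open>\<psi>\<close> is that of the coordinate
      \<open>n\<close> times the partial derivative at the intermediate point, and the latter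
      converges by continuity although \<open>\<xi>\<close> is only a choice.\<close>
    have "(\<psi> has_real_derivative X' n * gx n (T \<tau>0) (X \<tau>0)) (at \<tau>0)"
      unfolding has_field_derivative_iff \<open>\<psi> \<tau>0 = 0\<close>
      using tendsto_mult[OF X[OF n, unfolded has_field_derivative_iff] lim]
      by (simp add: \<xi>(2))
    from DERIV_add[OF this Suc.IH] n
    show ?case by (simp add: \<psi>_def algebra_simps)
  qed
  from this[OF order_refl] show ?thesis
    by (simp add: ZX)
qed

section \<open>Fields of class C^r and their composition with smooth curves\<close>

declare C_class.simps [simp del]

lemma C_class_continuous: "C_class d n g \<Longrightarrow> continuous_on UNIV (\<lambda>(t, x). g t x)"
  by (cases n) (simp_all add: C_class.simps)

lemma C_class_SucE:
  assumes "C_class d (Suc n) g"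
  obtains gt gx where
    "\<forall>t x. ((\<lambda>u. g u x) has_real_derivative gt t x) (at t)"
    "\<forall>k<d. \<forall>t x. ((\<lambda>u. g t (x(k := u))) has_real_derivative gx k t x) (at (x k))"
    "C_class d n gt" "\<forall>k<d. C_class d n (gx k)"
proof -
  have "\<exists>gt gx. (\<forall>t x. ((\<lambda>u. g u x) has_real_derivative gt t x) (at t)) \<and>
    (\<forall>k<d. \<forall>t x. ((\<lambda>u. g t (x(k := u))) has_real_derivative gx k t x) (at (x k))) \<and>
    C_class d n gt \<and> (\<forall>k<d. C_class d n (gx k))"
    using assms by (simp only: C_class.simps)
  then show ?thesis by (elim exE conjE) (rule that)
qed

lemma C_class_Suc: "C_class d (Suc n) g \<Longrightarrow> C_class d n g"
proof (induction n arbitrary: g)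
  case (Suc n)
  from Suc.prems obtain gt gx where *:
    "\<forall>t x. ((\<lambda>u. g u x) has_real_derivative gt t x) (at t)"
    "\<forall>k<d. \<forall>t x. ((\<lambda>u. g t (x(k := u))) has_real_derivative gx k t x) (at (x k))"
    "C_class d (Suc n) gt" "\<forall>k<d. C_class d (Suc n) (gx k)"
    by (rule C_class_SucE)
  have "C_class d n gt" "\<forall>k<d. C_class d n (gx k)"
    using *(4) by (auto intro: Suc.IH *(3))
  with * C_class_continuous[OF Suc.prems] show ?case
    unfolding C_class.simps(2)[of d n] by (intro conjI exI[of _ gt] exI[of _ gx])
qed (simp add: C_class.simps)

lemma C_class_mono: "m \<le> n \<Longrightarrow> C_class d n g \<Longrightarrow> C_class d m g"
  by (induction rule: inc_induct) (simp_all only: C_class_Suc)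

text \<open>The chain rule expresses the derivative through compositions of the partial derivatives
  with the same curve, at one class less. The induction therefore has to range over all fields
  \<open>g\<close>.\<close>

lemma smooth_curve_C_class:
  fixes g :: "real \<Rightarrow> vec \<Rightarrow> real"
  assumes "C_class d n g" "smooth_curve n T" "\<And>k. k < d \<Longrightarrow> smooth_curve n (\<lambda>\<tau>. X \<tau> k)"
    and X0: "\<And>k \<tau>. d \<le> k \<Longrightarrow> X \<tau> k = a k"
  shows "smooth_curve n (\<lambda>\<tau>. g (T \<tau>) (X \<tau>))"
  using assms(1-3)
proof (induction n arbitrary: g)
  case 0
  have X: "(\<lambda>\<tau>. X \<tau> k) \<midarrow>\<tau>\<rightarrow> X \<tau> k" for k \<tau>
    using 0(3)[of k] X0 by (cases "k < d") (simp_all add: continuous_on_eq_continuous_at isCont_def)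
  have T: "T \<midarrow>\<tau>\<rightarrow> T \<tau>" for \<tau>
    using 0(2) by (simp add: continuous_on_eq_continuous_at isCont_def)
  have "isCont (\<lambda>\<tau>. g (T \<tau>) (X \<tau>)) \<tau>" for \<tau>
    unfolding isCont_def by (rule continuous_field_tendsto[OF C_class_continuous[OF 0(1)] T X])
  then show ?case by (simp add: continuous_at_imp_continuous_on)
next
  case (Suc n)
  from Suc.prems(1) obtain gt gx where
    gt: "\<forall>t x. ((\<lambda>u. g u x) has_real_derivative gt t x) (at t)" and
    gx: "\<forall>k<d. \<forall>t x. ((\<lambda>u. g t (x(k := u))) has_real_derivative gx k t x) (at (x k))" and
    C: "C_class d n gt" "\<forall>k<d. C_class d n (gx k)" by (rule C_class_SucE)
  from Suc.prems(2) obtain T' where T': "\<And>\<tau>. (T has_real_derivative T' \<tau>) (at \<tau>)" "smooth_curve n T'"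
    by auto
  have "\<forall>k. \<exists>x'. k < d \<longrightarrow> (\<forall>\<tau>. ((\<lambda>\<tau>. X \<tau> k) has_real_derivative x' \<tau>) (at \<tau>)) \<and> smooth_curve n x'"
    using Suc.prems(3) by simp
  from choice[OF this] obtain X' where X': "\<And>k \<tau>. k < d \<Longrightarrow> ((\<lambda>\<tau>. X \<tau> k) has_real_derivative X' k \<tau>) (at \<tau>)"
    "\<And>k. k < d \<Longrightarrow> smooth_curve n (X' k)" by blast
  have "((\<lambda>\<tau>. g (T \<tau>) (X \<tau>)) has_real_derivative
    gt (T \<tau>) (X \<tau>) * T' \<tau> + (\<Sum>k<d. gx k (T \<tau>) (X \<tau>) * X' k \<tau>)) (at \<tau>)" for \<tau>
  proof (rule chain_rule_partials[of g gt d gx])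
    show "continuous_on UNIV (\<lambda>(t, x). gx k t x)" if "k < d" for k
      by (rule C_class_continuous[OF C(2)[rule_format, OF that]])
    show "X \<tau>' k = X \<tau> k" if "d \<le> k" for k \<tau>'
      by (simp only: X0[OF that])
  qed (fact gt[rule_format] T'(1) | rule gx[rule_format] X'(1), assumption)+
  moreover have "smooth_curve n (\<lambda>\<tau>. gt (T \<tau>) (X \<tau>) * T' \<tau> + (\<Sum>k<d. gx k (T \<tau>) (X \<tau>) * X' k \<tau>))"
  proof (intro smooth_curve_add smooth_curve_mult smooth_curve_sum)
    have T: "smooth_curve n T" and X: "\<And>k. k < d \<Longrightarrow> smooth_curve n (\<lambda>\<tau>. X \<tau> k)"
      using Suc.prems smooth_curve_Suc by auto
    show "smooth_curve n (\<lambda>\<tau>. gt (T \<tau>) (X \<tau>))" by (rule Suc.IH[OF C(1) T X])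
    show "smooth_curve n (\<lambda>\<tau>. gx k (T \<tau>) (X \<tau>))" if "k \<in> {..<d}" for k
      by (rule Suc.IH[OF C(2)[rule_format, OF that[simplified]] T X])
    show "smooth_curve n T'" "\<And>k. k \<in> {..<d} \<Longrightarrow> smooth_curve n (X' k)"
      using T'(2) X'(2) by simp_all
  qed
  ultimately show ?case unfolding smooth_curve.simps
    by (intro exI[of _ "\<lambda>\<tau>. gt (T \<tau>) (X \<tau>) * T' \<tau> + (\<Sum>k<d. gx k (T \<tau>) (X \<tau>) * X' k \<tau>)"] conjI allI)
qed

section \<open>Asymptotic estimates\<close>

text \<open>The filter keeps the point 0 and restricts to \<open>S\<close>, so \<open>S\<close> can
  be the whole line for two-sided estimates or an interval starting at 0 for one-sided ones.
  Convexity keeps the segment from 0 to \<open>\<tau>\<close> inside \<open>S\<close>.\<close>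

lemma bigo_mvt:
  fixes R :: "real \<Rightarrow> real"
  assumes S: "convex S" "0 \<in> S"
    and R: "\<And>\<tau>. \<tau> \<in> S \<Longrightarrow> (R has_real_derivative R' \<tau>) (at \<tau> within S)" "R 0 = 0"
    and R': "R' \<in> O[inf (nhds 0) (principal S)](\<lambda>\<tau>. \<tau> ^ n)"
  shows "R \<in> O[inf (nhds 0) (principal S)](\<lambda>\<tau>. \<tau> ^ Suc n)"
proof -
  from R' obtain C where "\<forall>\<^sub>F \<tau> in inf (nhds 0) (principal S). norm (R' \<tau>) \<le> C * norm (\<tau> ^ n)"
    by (elim landau_o.bigE)
  then obtain \<delta> where \<delta>: "\<delta> > 0" "\<And>\<tau>. \<bar>\<tau>\<bar> < \<delta> \<Longrightarrow> \<tau> \<in> S \<Longrightarrow> \<bar>R' \<tau>\<bar> \<le> C * \<bar>\<tau>\<bar> ^ n"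
    by (auto simp: eventually_inf_principal eventually_nhds_metric power_abs)
  have "\<bar>R \<tau>\<bar> \<le> \<bar>C\<bar> * \<bar>\<tau>\<bar> ^ Suc n" if \<tau>: "\<bar>\<tau>\<bar> < \<delta>" "\<tau> \<in> S" for \<tau>
  proof -
    have "norm (R \<tau> - R 0) \<le> \<bar>C\<bar> * \<bar>\<tau>\<bar> ^ n * norm (\<tau> - 0)"
    proof (rule field_differentiable_bound)
      show "convex (S \<inter> {-\<bar>\<tau>\<bar>..\<bar>\<tau>\<bar>})" using S by (intro convex_Int) auto
      show "(R has_real_derivative R' z) (at z within S \<inter> {- \<bar>\<tau>\<bar>..\<bar>\<tau>\<bar>})"
        if "z \<in> S \<inter> {-\<bar>\<tau>\<bar>..\<bar>\<tau>\<bar>}" for z using that by (intro DERIV_subset[OF R(1)]) auto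
      show "norm (R' z) \<le> \<bar>C\<bar> * \<bar>\<tau>\<bar> ^ n" if z: "z \<in> S \<inter> {-\<bar>\<tau>\<bar>..\<bar>\<tau>\<bar>}" for z
      proof -
        have "\<bar>z\<bar> \<le> \<bar>\<tau>\<bar>" using z by auto
        then have "\<bar>R' z\<bar> \<le> C * \<bar>z\<bar> ^ n" using \<delta>(2)[of z] \<tau> z by auto
        also have "\<dots> \<le> \<bar>C\<bar> * \<bar>\<tau>\<bar> ^ n"
          using \<open>\<bar>z\<bar> \<le> \<bar>\<tau>\<bar>\<close> by (intro mult_mono power_mono) auto
        finally show ?thesis by simp
      qed
    qed (use \<tau> S in auto)
    then show ?thesis using R(2) by (simp add: algebra_simps)
  qed
  then have "\<forall>\<^sub>F \<tau> in inf (nhds 0) (principal S). norm (R \<tau>) \<le> \<bar>C\<bar> * norm (\<tau> ^ Suc n)"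
    using \<delta>(1) by (auto simp: eventually_inf_principal eventually_nhds_metric power_abs abs_mult)
  then show ?thesis by (rule bigoI)
qed

lemma bigo_mvt_nhds:
  fixes R :: "real \<Rightarrow> real"
  assumes "\<And>\<tau>. (R has_real_derivative R' \<tau>) (at \<tau>)" "R 0 = 0" "R' \<in> O[nhds 0](\<lambda>\<tau>. \<tau> ^ n)"
  shows "R \<in> O[nhds 0](\<lambda>\<tau>. \<tau> ^ Suc n)"
  using bigo_mvt[of UNIV R R' n] assms by simp

text \<open>The expansion of the derivative is integrated term by term; the constant term is
  \<open>u 0\<close>.\<close>

lemma taylor_bigo:
  assumes "smooth_curve n u"
  shows "\<exists>a. (\<lambda>\<tau>. u \<tau> - (\<Sum>j<n. a j * \<tau> ^ j)) \<in> O[nhds 0](\<lambda>\<tau>. \<tau> ^ n)"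
  using assms
proof (induction n arbitrary: u)
  case 0
  then have "(u \<longlongrightarrow> u 0) (nhds 0)"
    by (simp add: continuous_on_eq_continuous_at isCont_def tendsto_at_iff_tendsto_nhds)
  then have "u \<in> O[nhds 0](\<lambda>_. 1)"
    by (intro bigoI_tendsto[of _ _ "u 0"]) auto
  then show ?case by simp
next
  case (Suc n)
  then obtain u' where u': "\<And>\<tau>. (u has_real_derivative u' \<tau>) (at \<tau>)" "smooth_curve n u'"
    by auto
  from Suc.IH[OF u'(2)] obtain a where
    a: "(\<lambda>\<tau>. u' \<tau> - (\<Sum>j<n. a j * \<tau> ^ j)) \<in> O[nhds 0](\<lambda>\<tau>. \<tau> ^ n)" by blast
  define b where "b j = (case j of 0 \<Rightarrow> u 0 | Suc i \<Rightarrow> a i / real (Suc i))" for j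
  have b: "(\<Sum>j<Suc n. b j * \<tau> ^ j) = u 0 + (\<Sum>i<n. a i / real (Suc i) * \<tau> ^ Suc i)" for \<tau>
    unfolding sum.lessThan_Suc_shift by (simp add: b_def)
  have "((\<lambda>\<tau>. u \<tau> - (\<Sum>j<Suc n. b j * \<tau> ^ j)) has_real_derivative
      u' \<tau> - (\<Sum>j<n. a j * \<tau> ^ j)) (at \<tau>)" for \<tau>
    unfolding b
    by (rule derivative_eq_intros u' refl)+ (simp del: of_nat_Suc add: mult.commute)
  moreover have "b 0 = u 0" by (simp add: b_def)
  ultimately show ?case using bigo_mvt_nhds[OF _ _ a, of "\<lambda>\<tau>. u \<tau> - (\<Sum>j<Suc n. b j * \<tau> ^ j)"]
    by (intro exI[of _ b]) (simp add: sum.lessThan_Suc_shift del: sum.lessThan_Suc)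
qed


section \<open>First and second order estimates for fields at converging arguments\<close>

lemma segment_mvt:
  fixes g :: "real \<Rightarrow> vec \<Rightarrow> real"
  assumes gt: "\<forall>t x. ((\<lambda>u. g u x) has_real_derivative gt t x) (at t)"
    and gx: "\<forall>k<d. \<forall>t x. ((\<lambda>u. g t (x(k := u))) has_real_derivative gx k t x) (at (x k))"
    and cx: "\<forall>k<d. continuous_on UNIV (\<lambda>(t, x). gx k t x)"
    and eq: "\<And>k. d \<le> k \<Longrightarrow> x k = z k"
  shows "\<exists>s. s \<in> {0..1} \<and> g t x - g t z =
    (\<Sum>k<d. gx k t (\<lambda>k. z k + s * (x k - z k)) * (x k - z k))"
proof -
  define \<xi> where "\<xi> s k = z k + s * (x k - z k)" for s k
  have D: "((\<lambda>s. g t (\<xi> s)) has_real_derivative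
      gt t (\<xi> s) * 0 + (\<Sum>k<d. gx k t (\<xi> s) * (x k - z k))) (at s)" for s
  proof (rule chain_rule_partials[of g gt d gx])
    show "((\<lambda>s. \<xi> s k) has_real_derivative x k - z k) (at s)" for k
      unfolding \<xi>_def by (rule derivative_eq_intros refl)+ simp
    show "\<xi> s' k = \<xi> s k" if "d \<le> k" for s' k
      by (simp add: \<xi>_def eq[OF that])
    show "continuous_on UNIV (\<lambda>(t, x). gx k t x)" if "k < d" for k
      by (rule cx[rule_format, OF that])
    show "((\<lambda>u. g t (x(k := u))) has_real_derivative gx k t x) (at (x k))" if "k < d" for k t x
      by (rule gx[rule_format, OF that])
    show "((\<lambda>u. g u x) has_real_derivative gt t x) (at t)" for t x
      by (rule gt[rule_format])
  qed (rule DERIV_const)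
  from MVT2[of 0 1, OF _ D] obtain s where "0 < s" "s < 1"
    "g t (\<xi> 1) - g t (\<xi> 0) = (\<Sum>k<d. gx k t (\<xi> s) * (x k - z k))" by auto
  moreover have "\<xi> 1 = x" "\<xi> 0 = z" by (auto simp: \<xi>_def)
  ultimately show ?thesis unfolding \<xi>_def by (intro exI[of _ s]) auto
qed

lemma segment_tendsto:
  fixes X Z :: "'a \<Rightarrow> real"
  assumes "(X \<longlongrightarrow> x) F" "(Z \<longlongrightarrow> x) F" "\<And>H. s H \<in> {0..1}"
  shows "((\<lambda>H. Z H + s H * (X H - Z H)) \<longlongrightarrow> x) F"
proof -
  have "((\<lambda>H. s H * (X H - Z H)) \<longlongrightarrow> 0) F"
  proof (rule Lim_null_comparison)
    show "\<forall>\<^sub>F H in F. norm (s H * (X H - Z H)) \<le> \<bar>X H - Z H\<bar>"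
      using assms(3) by (intro always_eventually allI) (auto simp: abs_mult intro: mult_left_le_one_le)
    show "((\<lambda>H. \<bar>X H - Z H\<bar>) \<longlongrightarrow> 0) F"
      using tendsto_diff[OF assms(1,2)] by (simp add: tendsto_rabs_zero_iff)
  qed
  from tendsto_add[OF assms(2) this] show ?thesis by simp
qed

text \<open>A Lipschitz estimate without a Lipschitz constant: the intermediate points of the mean
  value theorem tend to \<open>x0\<close>, so the partial derivatives along them converge and are
  bounded.\<close>

lemma field_difference_bigo:
  fixes g :: "real \<Rightarrow> vec \<Rightarrow> real" and X Z :: "'a \<Rightarrow> vec" and w :: "'a \<Rightarrow> real"
  assumes g: "C_class d (Suc 0) g"
    and T: "(T \<longlongrightarrow> t0) F"
    and X: "\<And>k. k < d \<Longrightarrow> ((\<lambda>H. X H k) \<longlongrightarrow> x0 k) F"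
    and Z: "\<And>k. k < d \<Longrightarrow> ((\<lambda>H. Z H k) \<longlongrightarrow> x0 k) F"
    and tail: "\<And>k H. d \<le> k \<Longrightarrow> X H k = x0 k" "\<And>k H. d \<le> k \<Longrightarrow> Z H k = x0 k"
    and diff: "\<And>k. k < d \<Longrightarrow> (\<lambda>H. X H k - Z H k) \<in> O[F](w)"
  shows "(\<lambda>H. g (T H) (X H) - g (T H) (Z H)) \<in> O[F](w)"
proof -
  from g obtain gt gx where
    gt: "\<forall>t x. ((\<lambda>u. g u x) has_real_derivative gt t x) (at t)" and
    gx: "\<forall>k<d. \<forall>t x. ((\<lambda>u. g t (x(k := u))) has_real_derivative gx k t x) (at (x k))" and
    C: "C_class d 0 gt" "\<forall>k<d. C_class d 0 (gx k)" by (rule C_class_SucE)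
  have cx: "\<forall>k<d. continuous_on UNIV (\<lambda>(t, x). gx k t x)"
    using C(2) by (simp only: C_class.simps)
  have "\<forall>H. \<exists>s. s \<in> {0..1} \<and> g (T H) (X H) - g (T H) (Z H) =
    (\<Sum>k<d. gx k (T H) (\<lambda>k. Z H k + s * (X H k - Z H k)) * (X H k - Z H k))"
    by (intro allI segment_mvt[OF gt gx cx]) (simp only: tail)
  from choice[OF this] obtain s where *: "\<forall>H. s H \<in> {0..1} \<and> g (T H) (X H) - g (T H) (Z H) =
    (\<Sum>k<d. gx k (T H) (\<lambda>k. Z H k + s H * (X H k - Z H k)) * (X H k - Z H k))" by (rule exE)
  note s = *[rule_format, THEN conjunct1] and eq = *[rule_format, THEN conjunct2]
  have \<xi>: "((\<lambda>H. Z H k + s H * (X H k - Z H k)) \<longlongrightarrow> x0 k) F" for k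
  proof (cases "k < d")
    case True
    then show ?thesis by (intro segment_tendsto X Z s)
  next
    case False
    then have "d \<le> k" by simp
    then show ?thesis by (simp only: tail) simp
  qed
  have "(\<lambda>H. gx k (T H) (\<lambda>k. Z H k + s H * (X H k - Z H k)) * (X H k - Z H k)) \<in> O[F](w)"
    if "k \<in> {..<d}" for k
  proof -
    have k: "k < d" using that by simp
    have "((\<lambda>H. gx k (T H) (\<lambda>k. Z H k + s H * (X H k - Z H k))) \<longlongrightarrow> gx k t0 x0) F"
      by (rule continuous_field_tendsto[OF cx[rule_format, OF k] T \<xi>])
    then have "(\<lambda>H. gx k (T H) (\<lambda>k. Z H k + s H * (X H k - Z H k))) \<in> O[F](\<lambda>_. 1)"
      by (intro bigoI_tendsto[of _ _ "gx k t0 x0"]) auto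
    from landau_o.big.mult[OF this diff[OF k]] show ?thesis by simp
  qed
  then show ?thesis unfolding eq by (rule big_sum_in_bigo)
qed

text \<open>The mean value theorem gives the Jacobian at an intermediate point instead of at
  \<open>Z\<close>. As the partial derivatives are themselves of class C^1, exchanging one point for
  the other costs a second factor \<open>w\<close>, and second derivatives need not be
  named.\<close>

lemma field_linearization_bigo:
  fixes g :: "real \<Rightarrow> vec \<Rightarrow> real" and X Z :: "'a \<Rightarrow> vec" and w :: "'a \<Rightarrow> real"
  assumes gt: "\<forall>t x. ((\<lambda>u. g u x) has_real_derivative gt t x) (at t)"
    and gx: "\<forall>k<d. \<forall>t x. ((\<lambda>u. g t (x(k := u))) has_real_derivative gx k t x) (at (x k))"
    and C: "\<forall>k<d. C_class d (Suc 0) (gx k)"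
    and T: "(T \<longlongrightarrow> t0) F"
    and X: "\<And>k. k < d \<Longrightarrow> ((\<lambda>H. X H k) \<longlongrightarrow> x0 k) F"
    and Z: "\<And>k. k < d \<Longrightarrow> ((\<lambda>H. Z H k) \<longlongrightarrow> x0 k) F"
    and tail: "\<And>k H. d \<le> k \<Longrightarrow> X H k = x0 k" "\<And>k H. d \<le> k \<Longrightarrow> Z H k = x0 k"
    and diff: "\<And>k. k < d \<Longrightarrow> (\<lambda>H. X H k - Z H k) \<in> O[F](w)"
  shows "(\<lambda>H. g (T H) (X H) - g (T H) (Z H) - (\<Sum>k<d. gx k (T H) (Z H) * (X H k - Z H k)))
    \<in> O[F](\<lambda>H. w H * w H)"
proof -
  have cx: "\<forall>k<d. continuous_on UNIV (\<lambda>(t, x). gx k t x)"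
    by (intro allI impI C_class_continuous[OF C[rule_format]])
  have "\<forall>H. \<exists>s. s \<in> {0..1} \<and> g (T H) (X H) - g (T H) (Z H) =
    (\<Sum>k<d. gx k (T H) (\<lambda>k. Z H k + s * (X H k - Z H k)) * (X H k - Z H k))"
    by (intro allI segment_mvt[OF gt gx cx]) (simp only: tail)
  from choice[OF this] obtain s where *: "\<forall>H. s H \<in> {0..1} \<and> g (T H) (X H) - g (T H) (Z H) =
    (\<Sum>k<d. gx k (T H) (\<lambda>k. Z H k + s H * (X H k - Z H k)) * (X H k - Z H k))" by (rule exE)
  note s = *[rule_format, THEN conjunct1] and eq = *[rule_format, THEN conjunct2]
  have sw: "s \<in> O[F](\<lambda>_. 1)"
    using s by (intro bigoI[of _ 1] always_eventually) auto
  have "(\<lambda>H. (gx k (T H) (\<lambda>k. Z H k + s H * (X H k - Z H k)) - gx k (T H) (Z H)) * (X H k - Z H k))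
      \<in> O[F](\<lambda>H. w H * w H)" if "k \<in> {..<d}" for k
  proof (rule landau_o.big.mult[OF field_difference_bigo[where X = "\<lambda>H k. Z H k + s H * (X H k - Z H k)" and Z = Z
        and ?x0.0 = x0 and ?t0.0 = t0 and g = "gx k" and d = d] diff])
    show "C_class d (Suc 0) (gx k)" using C that by blast
    show "((\<lambda>H. Z H k + s H * (X H k - Z H k)) \<longlongrightarrow> x0 k) F" if "k < d" for k
      using that by (intro segment_tendsto X Z s)
    show "(\<lambda>H. Z H k + s H * (X H k - Z H k) - Z H k) \<in> O[F](w)" if "k < d" for k
      using landau_o.big.mult[OF sw diff[OF that]] by simp
    show "Z H k + s H * (X H k - Z H k) = x0 k" if "d \<le> k" for k H
      by (simp only: tail[OF that]) simp
    show "Z H k = x0 k" if "d \<le> k" for k H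
      by (rule tail(2)[OF that])
  qed (use that in \<open>auto intro: T Z\<close>)
  then have "(\<lambda>H. \<Sum>k<d. (gx k (T H) (\<lambda>k. Z H k + s H * (X H k - Z H k)) - gx k (T H) (Z H))
      * (X H k - Z H k)) \<in> O[F](\<lambda>H. w H * w H)"
    by (rule big_sum_in_bigo)
  then show ?thesis
    unfolding eq by (simp add: sum_subtractf[symmetric] left_diff_distrib)
qed

section \<open>Polynomial approximate solutions\<close>

text \<open>Stages and solutions are arbitrary from index \<open>d\<close> on, while limits in
  \<open>vec\<close> involve all coordinates; zero is the default that reconciles the two.\<close>

definition trunc :: "nat \<Rightarrow> vec \<Rightarrow> vec" where
  "trunc d x = (\<lambda>k. if k < d then x k else 0)"

lemma trunc_apply [simp]: "k < d \<Longrightarrow> trunc d x k = x k" "d \<le> k \<Longrightarrow> trunc d x k = 0"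
  by (simp_all add: trunc_def)

lemma smooth_curve_tendsto: "smooth_curve n u \<Longrightarrow> (u \<longlongrightarrow> u 0) (nhds 0)"
  by (drule smooth_curve_continuous)
    (simp add: continuous_on_eq_continuous_at isCont_def tendsto_at_iff_tendsto_nhds)

lemma bigo_one_tendsto: "(u \<longlongrightarrow> (a :: real)) F \<Longrightarrow> u \<in> O[F](\<lambda>_. 1)"
  by (intro bigoI_tendsto[of _ _ a]) auto

lemma bigo_power_mono:
  assumes "m \<le> n" shows "(\<lambda>H :: real. H ^ n) \<in> O[inf (nhds 0) A](\<lambda>H. H ^ m)"
proof (rule bigoI[of _ 1])
  have "\<forall>\<^sub>F H in nhds 0. norm (H ^ n) \<le> 1 * norm (H ^ m :: real)"
    unfolding eventually_nhds_metric
    by (rule exI[of _ 1]) (use assms in \<open>auto simp: power_abs intro!: power_decreasing\<close>)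
  then show "\<forall>\<^sub>F H in inf (nhds 0) A. norm (H ^ n) \<le> 1 * norm (H ^ m :: real)"
    by (rule filter_leD[rotated]) simp
qed

text \<open>Class four is what a Taylor expansion of the fields along a smooth curve with remainder
  of order four requires.\<close>

locale smooth_problem =
  fixes d :: nat and f :: "('p::finite) split_rhs" and t0 :: real and y0 :: vec
  assumes smooth: "\<And>p. smooth_field d 4 (f p)"
begin

lemma f_trunc:
  assumes "k < d" shows "f p t (trunc d x) k = f p t x k"
proof -
  have "\<forall>l<d. trunc d x l = x l" by simp
  with smooth[of p] assms show ?thesis unfolding smooth_field_def by blast
qed

lemma C_class_f: "k < d \<Longrightarrow> m \<le> 4 \<Longrightarrow> C_class d m (\<lambda>t x. f p t x k)"
  using smooth[of p] C_class_mono unfolding smooth_field_def by blast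

lemma smooth_curve_f:
  assumes "\<And>k m. smooth_curve m (\<lambda>\<tau>. P \<tau> k)" "\<And>k \<tau>. d \<le> k \<Longrightarrow> P \<tau> k = 0" "k < d" "m \<le> 4"
  shows "smooth_curve m (\<lambda>\<tau>. f p (t0 + \<tau>) (P \<tau>) k)"
proof (rule smooth_curve_C_class[of d m "\<lambda>t x. f p t x k", OF C_class_f])
  show "smooth_curve m (\<lambda>\<tau>. t0 + \<tau>)"
    using smooth_curve_affine[of m t0 1] by simp
qed (use assms in auto)

lemma rhs_difference_bigo:
  assumes "(T \<longlongrightarrow> t0) F"
    and X: "\<And>k. k < d \<Longrightarrow> ((\<lambda>H. X H k) \<longlongrightarrow> y0 k) F"
    and Z: "\<And>k. k < d \<Longrightarrow> ((\<lambda>H. Z H k) \<longlongrightarrow> y0 k) F"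
    and diff: "\<And>k. k < d \<Longrightarrow> (\<lambda>H. X H k - Z H k) \<in> O[F](w)"
    and k: "k < d"
  shows "(\<lambda>H. f p (T H) (X H) k - f p (T H) (Z H) k) \<in> O[F](w)"
proof -
  have "(\<lambda>H. f p (T H) (trunc d (X H)) k - f p (T H) (trunc d (Z H)) k) \<in> O[F](w)"
    by (rule field_difference_bigo[where ?x0.0 = "trunc d y0" and ?t0.0 = t0 and d = d
          and g = "\<lambda>t x. f p t x k", OF C_class_f[OF k]])
      (simp_all add: assms)
  then show ?thesis by (simp only: f_trunc[OF k])
qed

text \<open>Picard iteration in the space of polynomial curves. The curve approximates the solution on
  both sides of the initial time, because nodes of the fast method may be negative.\<close>

lemma polynomial_approximate_solution:
  assumes "n \<le> 4"
  shows "\<exists>P P'. (\<forall>k m. smooth_curve m (\<lambda>\<tau>. P \<tau> k)) \<and> P 0 = trunc d y0 \<and>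
    (\<forall>\<tau>. \<forall>k\<ge>d. P \<tau> k = 0) \<and>
    (\<forall>k<d. \<forall>\<tau>. ((\<lambda>\<tau>. P \<tau> k) has_real_derivative P' \<tau> k) (at \<tau>)) \<and>
    (\<forall>k<d. (\<lambda>\<tau>. P' \<tau> k - (\<Sum>p\<in>UNIV. f p (t0 + \<tau>) (P \<tau>) k)) \<in> O[nhds 0](\<lambda>\<tau>. \<tau> ^ n))"
  using assms
proof (induction n)
  case 0
  define P where "P = (\<lambda>\<tau> :: real. trunc d y0)"
  have sm: "smooth_curve m (\<lambda>\<tau>. P \<tau> k)" for k m
    by (simp add: P_def smooth_curve_const)
  have tail: "P \<tau> k = 0" if "d \<le> k" for k \<tau>
    using that by (simp add: P_def)
  have "smooth_curve 4 (\<lambda>\<tau>. 0 - (\<Sum>p\<in>UNIV. f p (t0 + \<tau>) (P \<tau>) k))" if k: "k < d" for k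
    using smooth_curve_add[OF smooth_curve_const[of 4 0] smooth_curve_mult[OF smooth_curve_const[of 4 "-1"]
          smooth_curve_sum[of "UNIV :: 'p set" 4 "\<lambda>p \<tau>. f p (t0 + \<tau>) (P \<tau>) k", OF smooth_curve_f[OF sm tail k]]]]
    by simp
  from bigo_one_tendsto[OF smooth_curve_tendsto[OF this]] show ?case
    using sm tail
    by (intro exI[of _ P] exI[of _ "\<lambda>_ _. 0"]) (simp add: P_def)
next
  case (Suc n)
  then have "n \<le> 4" by simp
  from Suc.IH[OF this] obtain P P' where *: "\<forall>k m. smooth_curve m (\<lambda>\<tau>. P \<tau> k)" and P0: "P 0 = trunc d y0"
    and **: "\<forall>\<tau>. \<forall>k\<ge>d. P \<tau> k = 0"
      "\<forall>k<d. \<forall>\<tau>. ((\<lambda>\<tau>. P \<tau> k) has_real_derivative P' \<tau> k) (at \<tau>)"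
      "\<forall>k<d. (\<lambda>\<tau>. P' \<tau> k - (\<Sum>p\<in>UNIV. f p (t0 + \<tau>) (P \<tau>) k)) \<in> O[nhds 0](\<lambda>\<tau>. \<tau> ^ n)"
    by (elim exE conjE) (rule that)
  note sm = *[rule_format] and tail = **(1)[rule_format] and P' = **(2)[rule_format]
    and defect = **(3)[rule_format]
  define S where "S k \<tau> = (\<Sum>p\<in>UNIV. f p (t0 + \<tau>) (P \<tau>) k)" for k \<tau>
  have "smooth_curve (Suc n) (S k)" if "k < d" for k
    unfolding S_def using Suc.prems that by (intro smooth_curve_sum smooth_curve_f sm tail)
  then have "\<forall>k. \<exists>a. k < d \<longrightarrow>
      (\<lambda>\<tau>. S k \<tau> - (\<Sum>j<Suc n. a j * \<tau> ^ j)) \<in> O[nhds 0](\<lambda>\<tau>. \<tau> ^ Suc n)"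
    using taylor_bigo by blast
  from choice[OF this] obtain a where a: "\<And>k. k < d \<Longrightarrow>
      (\<lambda>\<tau>. S k \<tau> - (\<Sum>j<Suc n. a k j * \<tau> ^ j)) \<in> O[nhds 0](\<lambda>\<tau>. \<tau> ^ Suc n)"
    by blast
  \<comment> \<open>One Picard step in which the field along \<open>P\<close> is replaced by its
    Taylor polynomial before integrating, so that the iterate is again polynomial and hence smooth
    of every class.\<close>
  define Q where "Q \<tau> = (\<lambda>k. if k < d then y0 k + (\<Sum>j<Suc n. a k j * (\<tau> ^ Suc j / real (Suc j))) else 0)"
    for \<tau>
  define Q' where "Q' \<tau> k = (\<Sum>j<Suc n. a k j * \<tau> ^ j)" for \<tau> k
  have smQ: "smooth_curve m (\<lambda>\<tau>. Q \<tau> k)" for k m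
  proof (cases "k < d")
    case True
    have "smooth_curve m (\<lambda>\<tau>. y0 k + (\<Sum>j<Suc n. a k j * ((1 / real (Suc j)) * \<tau> ^ Suc j)))"
      by (intro smooth_curve_add smooth_curve_sum smooth_curve_mult smooth_curve_const smooth_curve_power)
    with True show ?thesis by (simp add: Q_def)
  qed (simp add: Q_def smooth_curve_const)
  have Q': "((\<lambda>\<tau>. Q \<tau> k) has_real_derivative Q' \<tau> k) (at \<tau>)" if "k < d" for k \<tau>
  proof -
    have "((\<lambda>\<tau>. \<tau> ^ Suc j / real (Suc j)) has_real_derivative \<tau> ^ j) (at \<tau>)" for j
      using DERIV_cdivide[OF DERIV_pow[of "Suc j" \<tau>], of "real (Suc j)"] by (simp del: of_nat_Suc)
    then have "((\<lambda>\<tau>. y0 k + (\<Sum>j<Suc n. a k j * (\<tau> ^ Suc j / real (Suc j)))) has_real_derivative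
        0 + (\<Sum>j<Suc n. a k j * \<tau> ^ j)) (at \<tau>)"
      by (intro DERIV_add DERIV_const DERIV_sum DERIV_cmult)
    with that show ?thesis by (simp add: Q_def Q'_def)
  qed
  have Q0: "Q 0 = trunc d y0" by (auto simp: Q_def trunc_def)
  have Q'S: "(\<lambda>\<tau>. Q' \<tau> k - S k \<tau>) \<in> O[nhds 0](\<lambda>\<tau>. \<tau> ^ Suc n)" if "k < d" for k
    using iffD2[OF landau_o.big.uminus_in_iff a[OF that]] by (simp add: Q'_def)
  \<comment> \<open>\<open>Q\<close> and \<open>P\<close> differ by one order more than the defect
    of \<open>P\<close>, so exchanging them inside the field does not spoil the order just
    gained.\<close>
  have QP: "(\<lambda>\<tau>. Q \<tau> k - P \<tau> k) \<in> O[nhds 0](\<lambda>\<tau>. \<tau> ^ Suc n)" if k: "k < d" for k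
  proof (rule bigo_mvt_nhds)
    show "((\<lambda>\<tau>. Q \<tau> k - P \<tau> k) has_real_derivative Q' \<tau> k - P' \<tau> k) (at \<tau>)" for \<tau>
      by (intro DERIV_diff Q' P' k)
    have "(\<lambda>\<tau>. Q' \<tau> k - S k \<tau>) \<in> O[nhds 0](\<lambda>\<tau>. \<tau> ^ n)"
      using landau_o.big_trans[OF Q'S[OF k], of "\<lambda>\<tau>. \<tau> ^ n"] bigo_power_mono[of n "Suc n" top] by simp
    from sum_in_bigo(2)[OF this defect[OF k, folded S_def]]
    show "(\<lambda>\<tau>. Q' \<tau> k - P' \<tau> k) \<in> O[nhds 0](\<lambda>\<tau>. \<tau> ^ n)" by simp
  qed (simp add: Q0 P0)
  have "(\<lambda>\<tau>. Q' \<tau> k - (\<Sum>p\<in>UNIV. f p (t0 + \<tau>) (Q \<tau>) k)) \<in> O[nhds 0](\<lambda>\<tau>. \<tau> ^ Suc n)"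
    if k: "k < d" for k
  proof -
    have "(\<lambda>\<tau>. f p (t0 + \<tau>) (Q \<tau>) k - f p (t0 + \<tau>) (P \<tau>) k) \<in> O[nhds 0](\<lambda>\<tau>. \<tau> ^ Suc n)" for p
    proof (rule rhs_difference_bigo[OF _ _ _ QP k])
      show "((\<lambda>\<tau>. t0 + \<tau>) \<longlongrightarrow> t0) (nhds 0)"
        using smooth_curve_tendsto[OF smooth_curve_affine[of 0 t0 1]] by simp
      show "((\<lambda>\<tau>. Q \<tau> k) \<longlongrightarrow> y0 k) (nhds 0)" "((\<lambda>\<tau>. P \<tau> k) \<longlongrightarrow> y0 k) (nhds 0)" if "k < d" for k
        using smooth_curve_tendsto[OF smQ, of k] smooth_curve_tendsto[OF sm, of k] that
        by (simp_all add: Q0 P0)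
    qed
    then have "(\<lambda>\<tau>. \<Sum>p\<in>UNIV. f p (t0 + \<tau>) (Q \<tau>) k - f p (t0 + \<tau>) (P \<tau>) k)
        \<in> O[nhds 0](\<lambda>\<tau>. \<tau> ^ Suc n)"
      by (rule big_sum_in_bigo)
    from sum_in_bigo(2)[OF Q'S[OF k] this] show ?thesis
      by (simp add: S_def sum_subtractf)
  qed
  moreover have "\<forall>\<tau>. \<forall>k\<ge>d. Q \<tau> k = 0" by (simp add: Q_def)
  ultimately show ?case using smQ Q0 Q' by (intro exI[of _ Q] exI[of _ Q']) simp
qed

text \<open>A bootstrap in place of Gronwall's inequality: an error of size
  \<open>\<tau> ^ j\<close> changes the field by as much, so the derivative of the error has that
  size, and integration gains one power. The gain stops when the defect of order \<open>n\<close>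
  dominates.\<close>

lemma solution_approximation:
  assumes sol: "exact_solution d f t0 y0 h y" and h: "0 < h" and k: "k < d"
    and P0: "P 0 = trunc d y0"
    and P': "\<And>k \<tau>. k < d \<Longrightarrow> ((\<lambda>\<tau>. P \<tau> k) has_real_derivative P' \<tau> k) (at \<tau>)"
    and defect: "\<And>k. k < d \<Longrightarrow>
      (\<lambda>\<tau>. P' \<tau> k - (\<Sum>p\<in>UNIV. f p (t0 + \<tau>) (P \<tau>) k)) \<in> O[nhds 0](\<lambda>\<tau>. \<tau> ^ n)"
  shows "(\<lambda>\<tau>. y (t0 + \<tau>) k - P \<tau> k) \<in> O[at_right 0](\<lambda>\<tau>. \<tau> ^ Suc n)"
proof -
  \<comment> \<open>The solution is known on one side of \<open>t0\<close> only; this filter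
    consists of the neighbourhoods of 0 inside the interval, with 0 included, where the solution
    equals \<open>y0\<close>.\<close>
  define F where "F = inf (nhds 0) (principal {0..h})"
  have y': "((\<lambda>\<tau>. y (t0 + \<tau>) k) has_real_derivative (\<Sum>p\<in>UNIV. f p (t0 + \<tau>) (y (t0 + \<tau>)) k))
      (at \<tau> within {0..h})" if "k < d" "\<tau> \<in> {0..h}" for k \<tau>
  proof -
    have "((\<lambda>u. y u k) has_real_derivative (\<Sum>p\<in>UNIV. f p (t0 + \<tau>) (y (t0 + \<tau>)) k))
      (at (t0 + \<tau>) within {t0..t0 + h})"
      using sol that by (auto simp: exact_solution_def)
    moreover have "(+) t0 ` {0..h} = {t0..t0 + h}" by simp
    ultimately show ?thesis
      using DERIV_at_within_shift[of "\<lambda>u. y u k" _ t0 \<tau> "{0..h}"] by (simp add: add.commute)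
  qed
  have y0: "y t0 k = y0 k" if "k < d" for k
    using sol that by (auto simp: exact_solution_def)
  have e': "((\<lambda>\<tau>. y (t0 + \<tau>) k - P \<tau> k) has_real_derivative
      (\<Sum>p\<in>UNIV. f p (t0 + \<tau>) (y (t0 + \<tau>)) k) - P' \<tau> k) (at \<tau> within {0..h})"
    if "k < d" "\<tau> \<in> {0..h}" for k \<tau>
    by (intro DERIV_diff y' that has_field_derivative_at_within[OF P'])
  have lim: "(u \<longlongrightarrow> u 0) F" if "(u has_real_derivative D) (at 0 within {0..h})" for u :: "real \<Rightarrow> real" and D
  proof -
    have "continuous (at 0 within {0..h}) u" using that by (rule DERIV_continuous)
    then have "(u \<longlongrightarrow> u 0) (at 0 within {0..h})" by (simp add: continuous_within)
    show ?thesis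
      unfolding F_def tendsto_iff eventually_inf_principal
      using \<open>(u \<longlongrightarrow> u 0) (at 0 within {0..h})\<close>
      by (auto simp: tendsto_iff eventually_at_filter elim!: eventually_mono)
  qed
  have ylim: "((\<lambda>\<tau>. y (t0 + \<tau>) k) \<longlongrightarrow> y0 k) F" if "k < d" for k
    using lim[OF y'[OF that, of 0]] h y0[OF that] by simp
  have Plim: "((\<lambda>\<tau>. P \<tau> k) \<longlongrightarrow> y0 k) F" if "k < d" for k
    using lim[OF has_field_derivative_at_within[OF P'[OF that]]] that by (simp add: P0)
  have tlim: "((\<lambda>\<tau>. t0 + \<tau>) \<longlongrightarrow> t0) F"
    using lim[of "\<lambda>\<tau>. t0 + \<tau>" "0 + 1"] by (simp only: DERIV_add DERIV_const DERIV_ident add_0_right)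
  have "\<forall>k<d. (\<lambda>\<tau>. y (t0 + \<tau>) k - P \<tau> k) \<in> O[F](\<lambda>\<tau>. \<tau> ^ j)" if "j \<le> Suc n" for j
    using that
  proof (induction j)
    case 0
    show ?case using tendsto_diff[OF ylim Plim] by (auto intro: bigo_one_tendsto)
  next
    case (Suc j)
    show ?case
    proof (intro allI impI)
      fix k assume k: "k < d"
      have "(\<lambda>\<tau>. f p (t0 + \<tau>) (y (t0 + \<tau>)) k - f p (t0 + \<tau>) (P \<tau>) k) \<in> O[F](\<lambda>\<tau>. \<tau> ^ j)" for p
        using Suc by (intro rhs_difference_bigo tlim ylim Plim k) auto
      then have "(\<lambda>\<tau>. \<Sum>p\<in>UNIV. f p (t0 + \<tau>) (y (t0 + \<tau>)) k - f p (t0 + \<tau>) (P \<tau>) k) \<in> O[F](\<lambda>\<tau>. \<tau> ^ j)"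
        by (rule big_sum_in_bigo)
      moreover have "(\<lambda>\<tau>. P' \<tau> k - (\<Sum>p\<in>UNIV. f p (t0 + \<tau>) (P \<tau>) k)) \<in> O[F](\<lambda>\<tau>. \<tau> ^ j)"
      proof (rule landau_o.big_trans)
        show "(\<lambda>\<tau>. P' \<tau> k - (\<Sum>p\<in>UNIV. f p (t0 + \<tau>) (P \<tau>) k)) \<in> O[F](\<lambda>\<tau>. \<tau> ^ n)"
          by (rule landau_o.big.filter_mono[OF _ defect[OF k]]) (simp add: F_def)
        show "(\<lambda>\<tau>. \<tau> ^ n) \<in> O[F](\<lambda>\<tau>. \<tau> ^ j)"
          unfolding F_def using Suc.prems by (intro bigo_power_mono) simp
      qed
      ultimately have "(\<lambda>\<tau>. (\<Sum>p\<in>UNIV. f p (t0 + \<tau>) (y (t0 + \<tau>)) k - f p (t0 + \<tau>) (P \<tau>) k) -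
          (P' \<tau> k - (\<Sum>p\<in>UNIV. f p (t0 + \<tau>) (P \<tau>) k))) \<in> O[F](\<lambda>\<tau>. \<tau> ^ j)"
        by (rule sum_in_bigo)
      then have "(\<lambda>\<tau>. (\<Sum>p\<in>UNIV. f p (t0 + \<tau>) (y (t0 + \<tau>)) k) - P' \<tau> k) \<in> O[F](\<lambda>\<tau>. \<tau> ^ j)"
        by (simp add: sum_subtractf)
      then show "(\<lambda>\<tau>. y (t0 + \<tau>) k - P \<tau> k) \<in> O[F](\<lambda>\<tau>. \<tau> ^ Suc j)"
        unfolding F_def using h y0[OF k] k
        by (intro bigo_mvt[OF _ _ e'[OF k]]) (auto simp: P0)
    qed
  qed
  with k have "(\<lambda>\<tau>. y (t0 + \<tau>) k - P \<tau> k) \<in> O[F](\<lambda>\<tau>. \<tau> ^ Suc n)" by blast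
  moreover have "at_right 0 \<le> F"
  proof -
    have "\<forall>\<^sub>F \<tau> in at_right 0. \<tau> \<in> {0..h}"
      using eventually_at_right_less[of 0] eventually_at_right_real[OF h] by (auto elim: eventually_elim2)
    then show ?thesis unfolding F_def by (intro inf_greatest) (simp_all add: at_within_def le_principal)
  qed
  ultimately show ?thesis by (rule landau_o.big.filter_mono[rotated])
qed

end

section \<open>Sufficiency of the order conditions\<close>

text \<open>The index set of stages is left abstract, so that it covers \<open>{1..s}\<close> as
  well as the slow and fast stages of the discrete scheme. The node of a stage is common to all
  partitions.\<close>

definition ark_step ::
  "'q set \<Rightarrow> ('p::finite \<Rightarrow> 'q \<Rightarrow> 'q \<Rightarrow> real) \<Rightarrow> ('p \<Rightarrow> 'q \<Rightarrow> real) \<Rightarrow> ('q \<Rightarrow> real) \<Rightarrow> ('p, 'q) step_rel" where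
  "ark_step Q A b c d f t H y0 Y y1 \<longleftrightarrow> (\<forall>k<d.
     (\<forall>q\<in>Q. Y q k = y0 k + H * (\<Sum>p\<in>UNIV. \<Sum>r\<in>Q. A p q r * f p (t + c r * H) (Y r) k)) \<and>
     y1 k = y0 k + H * (\<Sum>p\<in>UNIV. \<Sum>r\<in>Q. b p r * f p (t + c r * H) (Y r) k))"

text \<open>One condition for each rooted tree with at most three vertices, coloured by partitions.
  When all row sums equal the common nodes, a leaf enters through \<open>c\<close> alone and loses
  its colour.\<close>

definition ark_conditions_3 ::
  "'q set \<Rightarrow> ('p \<Rightarrow> 'q \<Rightarrow> 'q \<Rightarrow> real) \<Rightarrow> ('p \<Rightarrow> 'q \<Rightarrow> real) \<Rightarrow> ('q \<Rightarrow> real) \<Rightarrow> bool" where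
  "ark_conditions_3 Q A b c \<longleftrightarrow> (\<forall>p. (\<Sum>q\<in>Q. b p q) = 1) \<and> (\<forall>p. (\<Sum>q\<in>Q. b p q * c q) = 1/2) \<and>
     (\<forall>p. (\<Sum>q\<in>Q. b p q * c q ^ 2) = 1/3) \<and>
     (\<forall>p p'. (\<Sum>q\<in>Q. b p q * (\<Sum>r\<in>Q. A p' q r * c r)) = 1/6)"

definition ark_conditions_4 ::
  "'q set \<Rightarrow> ('p \<Rightarrow> 'q \<Rightarrow> 'q \<Rightarrow> real) \<Rightarrow> ('p \<Rightarrow> 'q \<Rightarrow> real) \<Rightarrow> ('q \<Rightarrow> real) \<Rightarrow> bool" where
  "ark_conditions_4 Q A b c \<longleftrightarrow> ark_conditions_3 Q A b c \<and>
     (\<forall>p. (\<Sum>q\<in>Q. b p q * c q ^ 3) = 1/4) \<and>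
     (\<forall>p p'. (\<Sum>q\<in>Q. b p q * (c q * (\<Sum>r\<in>Q. A p' q r * c r))) = 1/8) \<and>
     (\<forall>p p'. (\<Sum>q\<in>Q. b p q * (\<Sum>r\<in>Q. A p' q r * c r ^ 2)) = 1/12) \<and>
     (\<forall>p p' p''. (\<Sum>q\<in>Q. b p q * (\<Sum>r\<in>Q. A p' q r * (\<Sum>u\<in>Q. A p'' r u * c u))) = 1/24)"

lemma filterlim_scale_at_right: "filterlim (\<lambda>H. c * H) (nhds 0) (at_right (0 :: real))"
  by (rule tendsto_eq_intros refl)+ simp_all

lemma bigo_scale:
  fixes u :: "real \<Rightarrow> real"
  assumes "u \<in> O[nhds 0](\<lambda>\<tau>. \<tau> ^ n)"
  shows "(\<lambda>H. u (c * H)) \<in> O[at_right 0](\<lambda>H. H ^ n)"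
proof -
  have "(\<lambda>H. u (c * H)) \<in> O[at_right 0](\<lambda>H. (c * H) ^ n)"
    by (rule landau_o.big.compose[OF assms filterlim_scale_at_right])
  also have "(\<lambda>H. (c * H) ^ n) \<in> O[at_right 0](\<lambda>H. H ^ n)"
    by (rule bigoI[of _ "\<bar>c\<bar> ^ n"]) (simp add: power_mult_distrib abs_mult power_abs)
  finally show ?thesis .
qed

lemma bigo_power_mono_right: "m \<le> n \<Longrightarrow> (\<lambda>H :: real. H ^ n) \<in> O[at_right 0](\<lambda>H. H ^ m)"
  unfolding at_within_def by (rule bigo_power_mono)

lemma bigo_power_weaken:
  "u \<in> O[at_right 0](\<lambda>H :: real. H ^ n) \<Longrightarrow> m \<le> n \<Longrightarrow> u \<in> O[at_right 0](\<lambda>H. H ^ m :: real)"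
  by (rule landau_o.big_trans[OF _ bigo_power_mono_right])

lemma bigo_power_mult:
  fixes u v :: "real \<Rightarrow> real"
  assumes "u \<in> O[F](\<lambda>H. H ^ m)" "v \<in> O[F](\<lambda>H. H ^ n)"
  shows "(\<lambda>H. u H * v H) \<in> O[F](\<lambda>H. H ^ (m + n))"
  using landau_o.big.mult[OF assms] by (simp add: power_add)

lemma bigo_power_self: "(\<lambda>H. a * H ^ n) \<in> O[F](\<lambda>H. H ^ n :: real)"
  by (cases "a = 0") simp_all

context smooth_problem
begin

section \<open>Expansions along the approximate solution\<close>

lemma taylor_along:
  assumes sm: "\<And>k m. smooth_curve m (\<lambda>\<tau>. P \<tau> k)" and tail: "\<And>k \<tau>. d \<le> k \<Longrightarrow> P \<tau> k = 0"
  shows "\<exists>\<phi>. \<forall>p k. k < d \<longrightarrow>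
    (\<lambda>\<tau>. f p (t0 + \<tau>) (P \<tau>) k - (\<Sum>j<4. \<phi> p k j * \<tau> ^ j)) \<in> O[nhds 0](\<lambda>\<tau>. \<tau> ^ 4)"
proof -
  have "\<forall>p k. \<exists>a. k < d \<longrightarrow> (\<lambda>\<tau>. f p (t0 + \<tau>) (P \<tau>) k - (\<Sum>j<4. a j * \<tau> ^ j)) \<in> O[nhds 0](\<lambda>\<tau>. \<tau> ^ 4)"
  proof (intro allI)
    fix p k
    show "\<exists>a. k < d \<longrightarrow> (\<lambda>\<tau>. f p (t0 + \<tau>) (P \<tau>) k - (\<Sum>j<4. a j * \<tau> ^ j)) \<in> O[nhds 0](\<lambda>\<tau>. \<tau> ^ 4)"
    proof (cases "k < d")
      case True
      have "smooth_curve 4 (\<lambda>\<tau>. f p (t0 + \<tau>) (P \<tau>) k)"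
        by (rule smooth_curve_f) (simp_all add: sm tail True)
      from taylor_bigo[OF this] show ?thesis by blast
    qed simp
  qed
  then have "\<forall>p. \<exists>a. \<forall>k. k < d \<longrightarrow> (\<lambda>\<tau>. f p (t0 + \<tau>) (P \<tau>) k - (\<Sum>j<4. a k j * \<tau> ^ j)) \<in> O[nhds 0](\<lambda>\<tau>. \<tau> ^ 4)"
    by (intro allI choice) blast
  then show ?thesis by (rule choice)
qed

text \<open>The Jacobian multiplies an error of size \<open>H ^ 2\<close>, so its own expansion may
  stop after the linear term. The coefficients are fixed before \<open>X\<close> and
  \<open>c\<close> and therefore serve all stages at once.\<close>

lemma linearization_along:
  assumes sm: "\<And>k m. smooth_curve m (\<lambda>\<tau>. P \<tau> k)" and tail: "\<And>k \<tau>. d \<le> k \<Longrightarrow> P \<tau> k = 0"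
    and P0: "P 0 = trunc d y0" and k: "k < d"
  shows "\<exists>\<psi>. \<forall>X c. (\<forall>l<d. ((\<lambda>H. X H l) \<longlongrightarrow> y0 l) (at_right 0)) \<longrightarrow>
      (\<forall>l<d. (\<lambda>H. X H l - P (c * H) l) \<in> O[at_right 0](\<lambda>H. H ^ 2)) \<longrightarrow>
      (\<lambda>H. f p (t0 + c * H) (X H) k - f p (t0 + c * H) (P (c * H)) k -
         (\<Sum>l<d. (\<psi> l 0 + \<psi> l (1 :: nat) * (c * H)) * (X H l - P (c * H) l))) \<in> O[at_right 0](\<lambda>H. H ^ 4)"
proof -
  have "C_class d (Suc 3) (\<lambda>t x. f p t x k)" using C_class_f[OF k, of 4] by simp
  then obtain gt gx where
    gt: "\<forall>t x. ((\<lambda>u. f p u x k) has_real_derivative gt t x) (at t)" and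
    gx: "\<forall>l<d. \<forall>t x. ((\<lambda>u. f p t (x(l := u)) k) has_real_derivative gx l t x) (at (x l))" and
    C: "C_class d 3 gt" "\<forall>l<d. C_class d 3 (gx l)" by (rule C_class_SucE)
  have J: "smooth_curve 2 (\<lambda>\<tau>. gx l (t0 + \<tau>) (P \<tau>))" if "l < d" for l
  proof (rule smooth_curve_C_class[of d 2 "gx l"])
    show "smooth_curve 2 (\<lambda>\<tau>. t0 + \<tau>)" using smooth_curve_affine[of 2 t0 1] by simp
    show "C_class d 2 (gx l)" by (rule C_class_mono[OF _ C(2)[rule_format, OF that]]) simp
  qed (use sm tail in auto)
  have "\<forall>l. \<exists>a. l < d \<longrightarrow> (\<lambda>\<tau>. gx l (t0 + \<tau>) (P \<tau>) - (\<Sum>j<2. a j * \<tau> ^ j)) \<in> O[nhds 0](\<lambda>\<tau>. \<tau> ^ 2)"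
    using taylor_bigo[OF J] by blast
  from choice[OF this] obtain \<psi> where \<psi>: "\<And>l. l < d \<Longrightarrow>
      (\<lambda>\<tau>. gx l (t0 + \<tau>) (P \<tau>) - (\<Sum>j<2. \<psi> l j * \<tau> ^ j)) \<in> O[nhds 0](\<lambda>\<tau>. \<tau> ^ 2)" by blast
  show ?thesis
  proof (intro exI[of _ \<psi>] allI impI)
    fix X :: "real \<Rightarrow> vec" and c :: real
    assume X: "\<forall>l<d. ((\<lambda>H. X H l) \<longlongrightarrow> y0 l) (at_right 0)"
      and E: "\<forall>l<d. (\<lambda>H. X H l - P (c * H) l) \<in> O[at_right 0](\<lambda>H. H ^ 2)"
    have "(\<lambda>H. f p (t0 + c * H) (trunc d (X H)) k - f p (t0 + c * H) (P (c * H)) k -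
         (\<Sum>l<d. gx l (t0 + c * H) (P (c * H)) * (trunc d (X H) l - P (c * H) l))) \<in> O[at_right 0](\<lambda>H. H ^ 2 * H ^ 2)"
    proof (rule field_linearization_bigo[where g = "\<lambda>t x. f p t x k" and gx = gx and d = d
          and ?x0.0 = "trunc d y0" and ?t0.0 = t0 and gt = gt, OF gt gx])
      show "\<forall>l<d. C_class d (Suc 0) (gx l)"
        using C(2) by (auto intro: C_class_mono[of "Suc 0" 3])
      show "((\<lambda>H. t0 + c * H) \<longlongrightarrow> t0) (at_right 0)"
        using tendsto_add[OF tendsto_const[of t0] filterlim_scale_at_right[of c]] by simp
      show "((\<lambda>H. P (c * H) l) \<longlongrightarrow> trunc d y0 l) (at_right 0)" if "l < d" for l
        using filterlim_compose[OF smooth_curve_tendsto[OF sm, of l] filterlim_scale_at_right] by (simp add: P0)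
    qed (use X E tail in auto)
    then have 1: "(\<lambda>H. f p (t0 + c * H) (X H) k - f p (t0 + c * H) (P (c * H)) k -
         (\<Sum>l<d. gx l (t0 + c * H) (P (c * H)) * (X H l - P (c * H) l))) \<in> O[at_right 0](\<lambda>H. H ^ 4)"
      by (simp add: f_trunc[OF k] power_add[symmetric])
    have "(\<lambda>H. (gx l (t0 + c * H) (P (c * H)) - (\<psi> l 0 + \<psi> l 1 * (c * H))) * (X H l - P (c * H) l))
        \<in> O[at_right 0](\<lambda>H. H ^ (2 + 2))" if "l \<in> {..<d}" for l
    proof (rule bigo_power_mult)
      show "(\<lambda>H. gx l (t0 + c * H) (P (c * H)) - (\<psi> l 0 + \<psi> l 1 * (c * H))) \<in> O[at_right 0](\<lambda>H. H ^ 2)"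
        using bigo_scale[OF \<psi>[of l], of c] that by (simp add: numeral_2_eq_2)
    qed (use E that in auto)
    then have "(\<lambda>H. \<Sum>l<d. (gx l (t0 + c * H) (P (c * H)) - (\<psi> l 0 + \<psi> l 1 * (c * H))) * (X H l - P (c * H) l))
        \<in> O[at_right 0](\<lambda>H. H ^ (2 + 2))" by (rule big_sum_in_bigo)
    then have 2: "(\<lambda>H. \<Sum>l<d. (gx l (t0 + c * H) (P (c * H)) - (\<psi> l 0 + \<psi> l 1 * (c * H))) * (X H l - P (c * H) l))
        \<in> O[at_right 0](\<lambda>H. H ^ 4)" by simp
    have "(\<Sum>l<d. (gx l (t0 + c * H) (P (c * H)) - (\<psi> l 0 + \<psi> l 1 * (c * H))) * (X H l - P (c * H) l)) =
       (\<Sum>l<d. gx l (t0 + c * H) (P (c * H)) * (X H l - P (c * H) l)) -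
       (\<Sum>l<d. (\<psi> l 0 + \<psi> l 1 * (c * H)) * (X H l - P (c * H) l))" for H
      by (simp only: left_diff_distrib sum_subtractf)
    then have "f p (t0 + c * H) (X H) k - f p (t0 + c * H) (P (c * H)) k -
         (\<Sum>l<d. gx l (t0 + c * H) (P (c * H)) * (X H l - P (c * H) l)) +
       (\<Sum>l<d. (gx l (t0 + c * H) (P (c * H)) - (\<psi> l 0 + \<psi> l 1 * (c * H))) * (X H l - P (c * H) l)) =
       f p (t0 + c * H) (X H) k - f p (t0 + c * H) (P (c * H)) k -
         (\<Sum>l<d. (\<psi> l 0 + \<psi> l (1 :: nat) * (c * H)) * (X H l - P (c * H) l))" for H
      by (simp only:)
    with sum_in_bigo(1)[OF 1 2]
    show "(\<lambda>H. f p (t0 + c * H) (X H) k - f p (t0 + c * H) (P (c * H)) k -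
         (\<Sum>l<d. (\<psi> l 0 + \<psi> l (1 :: nat) * (c * H)) * (X H l - P (c * H) l))) \<in> O[at_right 0](\<lambda>H. H ^ 4)"
      by (simp only:)
  qed
qed

text \<open>Inserting \<open>P\<close> into a quadrature leaves, at each power of \<open>H\<close>,
  the difference between a moment of the weights and the integral of a power from 0 to
  \<open>\<gamma>\<close>. Stage \<open>q\<close> is the case \<open>\<gamma> = c q\<close>, the
  result of the step the case \<open>\<gamma> = 1\<close>.\<close>

lemma quadrature_residual:
  fixes Q :: "'q set" and a :: "'p \<Rightarrow> 'q \<Rightarrow> real" and c :: "'q \<Rightarrow> real"
  assumes P0: "P 0 = trunc d y0"
    and P': "\<And>k \<tau>. k < d \<Longrightarrow> ((\<lambda>\<tau>. P \<tau> k) has_real_derivative P' \<tau> k) (at \<tau>)"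
    and defect: "\<And>k. k < d \<Longrightarrow>
      (\<lambda>\<tau>. P' \<tau> k - (\<Sum>p\<in>UNIV. f p (t0 + \<tau>) (P \<tau>) k)) \<in> O[nhds 0](\<lambda>\<tau>. \<tau> ^ 4)"
    and \<phi>: "\<And>p k. k < d \<Longrightarrow>
      (\<lambda>\<tau>. f p (t0 + \<tau>) (P \<tau>) k - (\<Sum>j<4. \<phi> p k j * \<tau> ^ j)) \<in> O[nhds 0](\<lambda>\<tau>. \<tau> ^ 4)"
    and k: "k < d"
  shows "(\<lambda>H. H * (\<Sum>p\<in>UNIV. \<Sum>r\<in>Q. a p r * f p (t0 + c r * H) (P (c r * H)) k) - (P (\<gamma> * H) k - y0 k)
      - (\<Sum>j<4. H ^ Suc j * (\<Sum>p\<in>UNIV. \<phi> p k j * ((\<Sum>r\<in>Q. a p r * c r ^ j) - \<gamma> ^ Suc j / real (Suc j)))))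
    \<in> O[at_right 0](\<lambda>H. H ^ 5)"
proof -
  have "(\<lambda>\<tau>. P \<tau> k - y0 k - (\<Sum>p\<in>UNIV. \<Sum>j<4. \<phi> p k j * (\<tau> ^ Suc j / real (Suc j)))) \<in> O[nhds 0](\<lambda>\<tau>. \<tau> ^ Suc 4)"
  proof (rule bigo_mvt_nhds)
    have "((\<lambda>\<tau>. \<tau> ^ Suc j / real (Suc j)) has_real_derivative \<tau> ^ j) (at \<tau>)" for j \<tau>
      using DERIV_cdivide[OF DERIV_pow[of "Suc j" \<tau>], of "real (Suc j)"] by (simp del: of_nat_Suc)
    then have "((\<lambda>\<tau>. P \<tau> k - y0 k - (\<Sum>p\<in>UNIV. \<Sum>j<4. \<phi> p k j * (\<tau> ^ Suc j / real (Suc j)))) has_real_derivative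
       P' \<tau> k - 0 - (\<Sum>p\<in>UNIV. \<Sum>j<4. \<phi> p k j * \<tau> ^ j)) (at \<tau>)" for \<tau>
      by (intro DERIV_diff DERIV_const DERIV_sum DERIV_cmult P' k)
    then show "((\<lambda>\<tau>. P \<tau> k - y0 k - (\<Sum>p\<in>UNIV. \<Sum>j<4. \<phi> p k j * (\<tau> ^ Suc j / real (Suc j)))) has_real_derivative
       P' \<tau> k - (\<Sum>p\<in>UNIV. \<Sum>j<4. \<phi> p k j * \<tau> ^ j)) (at \<tau>)" for \<tau> by simp
    have "(\<lambda>\<tau>. \<Sum>p\<in>UNIV. f p (t0 + \<tau>) (P \<tau>) k - (\<Sum>j<4. \<phi> p k j * \<tau> ^ j)) \<in> O[nhds 0](\<lambda>\<tau>. \<tau> ^ 4)"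
      by (rule big_sum_in_bigo) (rule \<phi>[OF k])
    from sum_in_bigo(1)[OF defect[OF k] this]
    show "(\<lambda>\<tau>. P' \<tau> k - (\<Sum>p\<in>UNIV. \<Sum>j<4. \<phi> p k j * \<tau> ^ j)) \<in> O[nhds 0](\<lambda>\<tau>. \<tau> ^ 4)"
      by (simp add: sum_subtractf)
  qed (simp add: P0 k)
  from bigo_scale[OF this, of \<gamma>]
  have 1: "(\<lambda>H. P (\<gamma> * H) k - y0 k - (\<Sum>p\<in>UNIV. \<Sum>j<4. \<phi> p k j * ((\<gamma> * H) ^ Suc j / real (Suc j)))) \<in> O[at_right 0](\<lambda>H. H ^ 5)"
    by (simp del: power_Suc of_nat_Suc)
  have "(\<lambda>H. \<Sum>p\<in>UNIV. \<Sum>r\<in>Q. a p r * (f p (t0 + c r * H) (P (c r * H)) k - (\<Sum>j<4. \<phi> p k j * (c r * H) ^ j)))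
     \<in> O[at_right 0](\<lambda>H. H ^ 4)"
  proof (intro big_sum_in_bigo)
    show "(\<lambda>H. a p r * (f p (t0 + c r * H) (P (c r * H)) k - (\<Sum>j<4. \<phi> p k j * (c r * H) ^ j)))
      \<in> O[at_right 0](\<lambda>H. H ^ 4)" for p r
      using bigo_scale[OF \<phi>[OF k], of p "c r"] by simp
  qed
  from landau_o.big.mult_left[OF this, of "\<lambda>H. H"]
  have 2: "(\<lambda>H. H * (\<Sum>p\<in>UNIV. \<Sum>r\<in>Q. a p r * (f p (t0 + c r * H) (P (c r * H)) k - (\<Sum>j<4. \<phi> p k j * (c r * H) ^ j))))
     \<in> O[at_right 0](\<lambda>H. H ^ 5)" by (simp add: power_Suc[symmetric] del: power_Suc)
  have "H * (\<Sum>p\<in>UNIV. \<Sum>r\<in>Q. a p r * (\<Sum>j<4. \<phi> p k j * (c r * H) ^ j)) -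
      (\<Sum>p\<in>UNIV. \<Sum>j<4. \<phi> p k j * ((\<gamma> * H) ^ Suc j / real (Suc j))) =
      (\<Sum>j<4. H ^ Suc j * (\<Sum>p\<in>UNIV. \<phi> p k j * ((\<Sum>r\<in>Q. a p r * c r ^ j) - \<gamma> ^ Suc j / real (Suc j))))" for H
  proof -
    have "(\<Sum>r\<in>Q. a p r * (\<Sum>j<4. \<phi> p k j * (c r * H) ^ j)) = (\<Sum>j<4. H ^ j * (\<phi> p k j * (\<Sum>r\<in>Q. a p r * c r ^ j)))" for p
      unfolding sum_distrib_left by (subst sum.swap) (simp add: power_mult_distrib mult_ac)
    then have "(\<Sum>p\<in>UNIV. \<Sum>r\<in>Q. a p r * (\<Sum>j<4. \<phi> p k j * (c r * H) ^ j)) =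
       (\<Sum>j<4. H ^ j * (\<Sum>p\<in>UNIV. \<phi> p k j * (\<Sum>r\<in>Q. a p r * c r ^ j)))"
      by (simp add: sum_distrib_left sum.swap[of _ "{..<4}" UNIV] del: sum.lessThan_Suc)
    moreover have "(\<Sum>p\<in>UNIV. \<Sum>j<4. \<phi> p k j * ((\<gamma> * H) ^ Suc j / real (Suc j))) =
        (\<Sum>j<4. H ^ Suc j * (\<Sum>p\<in>UNIV. \<phi> p k j * (\<gamma> ^ Suc j / real (Suc j))))"
      unfolding sum_distrib_left by (subst sum.swap) (simp add: power_mult_distrib mult_ac)
    ultimately show ?thesis
      by (simp add: sum_distrib_left[of H] right_diff_distrib sum_subtractf mult.assoc[symmetric])
  qed
  note id = this
  have "H * (\<Sum>p\<in>UNIV. \<Sum>r\<in>Q. a p r * (f p (t0 + c r * H) (P (c r * H)) k - (\<Sum>j<4. \<phi> p k j * (c r * H) ^ j))) =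
     H * (\<Sum>p\<in>UNIV. \<Sum>r\<in>Q. a p r * f p (t0 + c r * H) (P (c r * H)) k) -
     H * (\<Sum>p\<in>UNIV. \<Sum>r\<in>Q. a p r * (\<Sum>j<4. \<phi> p k j * (c r * H) ^ j))" for H
    by (simp only: right_diff_distrib sum_subtractf)
  then have "H * (\<Sum>p\<in>UNIV. \<Sum>r\<in>Q. a p r * (f p (t0 + c r * H) (P (c r * H)) k - (\<Sum>j<4. \<phi> p k j * (c r * H) ^ j))) -
      (P (\<gamma> * H) k - y0 k - (\<Sum>p\<in>UNIV. \<Sum>j<4. \<phi> p k j * ((\<gamma> * H) ^ Suc j / real (Suc j)))) =
      H * (\<Sum>p\<in>UNIV. \<Sum>r\<in>Q. a p r * f p (t0 + c r * H) (P (c r * H)) k) - (P (\<gamma> * H) k - y0 k)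
      - (\<Sum>j<4. H ^ Suc j * (\<Sum>p\<in>UNIV. \<phi> p k j * ((\<Sum>r\<in>Q. a p r * c r ^ j) - \<gamma> ^ Suc j / real (Suc j))))" for H
    using id[of H] by (simp only:)
  with sum_in_bigo(2)[OF 2 1] show ?thesis by (simp only:)
qed

text \<open>Stage errors and field differences are expanded through \<open>H ^ 3\<close> and summed
  with the weights \<open>b\<close>. Every coefficient that arises is a linear combination, with
  unknown Taylor coefficients, of sums that vanish by the order conditions.\<close>

lemma local_error_bigo:
  fixes Q :: "'q set" and A :: "'p \<Rightarrow> 'q \<Rightarrow> 'q \<Rightarrow> real" and b :: "'p \<Rightarrow> 'q \<Rightarrow> real" and c :: "'q \<Rightarrow> real"
    and Y :: "real \<Rightarrow> 'q \<Rightarrow> vec" and y1 :: "real \<Rightarrow> vec"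
  assumes consistent: "\<And>p q. q \<in> Q \<Longrightarrow> (\<Sum>r\<in>Q. A p q r) = c q"
    and conditions: "ark_conditions_4 Q A b c"
    and sol: "exact_solution d f t0 y0 h y" and h: "0 < h"
    and step: "\<forall>\<^sub>F H in at_right 0. ark_step Q A b c d f t0 H y0 (Y H) (y1 H)"
    and Y: "\<And>q k. q \<in> Q \<Longrightarrow> k < d \<Longrightarrow> ((\<lambda>H. Y H q k) \<longlongrightarrow> y0 k) (at_right 0)"
    and k: "k < d"
  shows "(\<lambda>H. y1 H k - y (t0 + H) k) \<in> O[at_right 0](\<lambda>H. H ^ 5)"
proof -
  from polynomial_approximate_solution[OF order_refl] obtain P P' where
    *: "\<forall>k m. smooth_curve m (\<lambda>\<tau>. P \<tau> k)" and P0: "P 0 = trunc d y0"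
    and **: "\<forall>\<tau>. \<forall>k\<ge>d. P \<tau> k = 0"
      "\<forall>k<d. \<forall>\<tau>. ((\<lambda>\<tau>. P \<tau> k) has_real_derivative P' \<tau> k) (at \<tau>)"
      "\<forall>k<d. (\<lambda>\<tau>. P' \<tau> k - (\<Sum>p\<in>UNIV. f p (t0 + \<tau>) (P \<tau>) k)) \<in> O[nhds 0](\<lambda>\<tau>. \<tau> ^ 4)"
    by (elim exE conjE) (rule that)
  note sm = *[rule_format] and tail = **(1)[rule_format] and P' = **(2)[rule_format]
    and defect = **(3)[rule_format]
  from taylor_along[of P, OF sm tail] obtain \<phi> where "\<forall>p k. k < d \<longrightarrow>
      (\<lambda>\<tau>. f p (t0 + \<tau>) (P \<tau>) k - (\<Sum>j<4. \<phi> p k j * \<tau> ^ j)) \<in> O[nhds 0](\<lambda>\<tau>. \<tau> ^ 4)"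
    by (rule exE)
  note \<phi> = this[rule_format]
  have "\<exists>\<psi>. \<forall>p k. k < d \<longrightarrow> (\<forall>X c. (\<forall>l<d. ((\<lambda>H. X H l) \<longlongrightarrow> y0 l) (at_right 0)) \<longrightarrow>
      (\<forall>l<d. (\<lambda>H. X H l - P (c * H) l) \<in> O[at_right 0](\<lambda>H. H ^ 2)) \<longrightarrow>
      (\<lambda>H. f p (t0 + c * H) (X H) k - f p (t0 + c * H) (P (c * H)) k -
         (\<Sum>l<d. (\<psi> p k l 0 + \<psi> p k l (1 :: nat) * (c * H)) * (X H l - P (c * H) l))) \<in> O[at_right 0](\<lambda>H. H ^ 4))"
  proof (rule choice, rule allI, rule choice, rule allI)
    fix p k
    show "\<exists>\<psi>. k < d \<longrightarrow> (\<forall>X c. (\<forall>l<d. ((\<lambda>H. X H l) \<longlongrightarrow> y0 l) (at_right 0)) \<longrightarrow>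
      (\<forall>l<d. (\<lambda>H. X H l - P (c * H) l) \<in> O[at_right 0](\<lambda>H. H ^ 2)) \<longrightarrow>
      (\<lambda>H. f p (t0 + c * H) (X H) k - f p (t0 + c * H) (P (c * H)) k -
         (\<Sum>l<d. (\<psi> l 0 + \<psi> l (1 :: nat) * (c * H)) * (X H l - P (c * H) l))) \<in> O[at_right 0](\<lambda>H. H ^ 4))"
    proof (cases "k < d")
      case True
      from linearization_along[of P, OF sm tail P0 True] show ?thesis by (simp only: True simp_thms)
    qed simp
  qed
  then obtain \<psi> where "\<forall>p k. k < d \<longrightarrow> (\<forall>X c. (\<forall>l<d. ((\<lambda>H. X H l) \<longlongrightarrow> y0 l) (at_right 0)) \<longrightarrow>
      (\<forall>l<d. (\<lambda>H. X H l - P (c * H) l) \<in> O[at_right 0](\<lambda>H. H ^ 2)) \<longrightarrow>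
      (\<lambda>H. f p (t0 + c * H) (X H) k - f p (t0 + c * H) (P (c * H)) k -
         (\<Sum>l<d. (\<psi> p k l 0 + \<psi> p k l (1 :: nat) * (c * H)) * (X H l - P (c * H) l))) \<in> O[at_right 0](\<lambda>H. H ^ 4))"
    by (rule exE)
  note \<psi> = this[rule_format]
  define E where "E q k H = Y H q k - P (c q * H) k" for q k H
  define D where "D p q k H = f p (t0 + c q * H) (Y H q) k - f p (t0 + c q * H) (P (c q * H)) k" for p q k H
  define S where "S a \<gamma> k H = H * (\<Sum>p\<in>UNIV. \<Sum>r\<in>Q. a p r * f p (t0 + c r * H) (P (c r * H)) k) - (P (\<gamma> * H) k - y0 k)"
    for a \<gamma> k H
  \<comment> \<open>\<open>\<kappa>\<close> is the error of the weights on the monomial of degree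
    \<open>j\<close>, and \<open>\<sigma>\<close> is the coefficient of \<open>H ^ Suc j\<close>
    that it causes in the residual \<open>S\<close>.\<close>
  define \<kappa> where "\<kappa> a \<gamma> p j = (\<Sum>r\<in>Q. a p r * c r ^ j) - \<gamma> ^ Suc j / real (Suc j)" for a \<gamma> and p :: 'p and j
  define \<sigma> where "\<sigma> a \<gamma> k j = (\<Sum>p\<in>UNIV. \<phi> p k j * \<kappa> a \<gamma> p j)" for a \<gamma> k j
  define \<sigma>Q where "\<sigma>Q q = \<sigma> (\<lambda>p. A p q) (c q)" for q

  have split: "H * (\<Sum>p\<in>UNIV. \<Sum>r\<in>Q. a p r * f p (t0 + c r * H) (Y H r) k) - (P (\<gamma> * H) k - y0 k) =
      H * (\<Sum>p\<in>UNIV. \<Sum>r\<in>Q. a p r * D p r k H) + S a \<gamma> k H" for a \<gamma> k H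
    by (simp add: D_def S_def right_diff_distrib sum_subtractf)
  have stage: "\<forall>\<^sub>F H in at_right 0. H * (\<Sum>p\<in>UNIV. \<Sum>r\<in>Q. A p q r * D p r k H) + S (\<lambda>p. A p q) (c q) k H = E q k H"
    if "q \<in> Q" "k < d" for q k
    using step
  proof (rule eventually_mono)
    fix H assume "ark_step Q A b c d f t0 H y0 (Y H) (y1 H)"
    with that have "Y H q k = y0 k + H * (\<Sum>p\<in>UNIV. \<Sum>r\<in>Q. A p q r * f p (t0 + c r * H) (Y H r) k)"
      by (auto simp: ark_step_def)
    with split[of H "\<lambda>p. A p q" k "c q"]
    show "H * (\<Sum>p\<in>UNIV. \<Sum>r\<in>Q. A p q r * D p r k H) + S (\<lambda>p. A p q) (c q) k H = E q k H"
      by (simp add: E_def)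
  qed
  have final: "\<forall>\<^sub>F H in at_right 0. H * (\<Sum>p\<in>UNIV. \<Sum>r\<in>Q. b p r * D p r k H) + S b 1 k H = y1 H k - P H k"
    using step
  proof (rule eventually_mono)
    fix H assume "ark_step Q A b c d f t0 H y0 (Y H) (y1 H)"
    with k have "y1 H k = y0 k + H * (\<Sum>p\<in>UNIV. \<Sum>r\<in>Q. b p r * f p (t0 + c r * H) (Y H r) k)"
      by (auto simp: ark_step_def)
    with split[of H b k 1]
    show "H * (\<Sum>p\<in>UNIV. \<Sum>r\<in>Q. b p r * D p r k H) + S b 1 k H = y1 H k - P H k" by simp
  qed
  have combine: "(\<lambda>H. H * (\<Sum>p\<in>UNIV. \<Sum>r\<in>Q. a p r * D p r k H) + S a \<gamma> k H
      - (H * (\<Sum>p\<in>UNIV. \<Sum>r\<in>Q. a p r * \<delta> p r H) + s H)) \<in> O[at_right 0](\<lambda>H. H ^ Suc n)"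
    if "\<And>p r. r \<in> Q \<Longrightarrow> (\<lambda>H. D p r k H - \<delta> p r H) \<in> O[at_right 0](\<lambda>H. H ^ n)"
      and s: "(\<lambda>H. S a \<gamma> k H - s H) \<in> O[at_right 0](\<lambda>H. H ^ Suc n)" for a \<gamma> k \<delta> s n
  proof -
    have "(\<lambda>H. \<Sum>p\<in>UNIV. \<Sum>r\<in>Q. a p r * (D p r k H - \<delta> p r H)) \<in> O[at_right 0](\<lambda>H. H ^ n)"
      using that(1) by (intro big_sum_in_bigo) simp
    from landau_o.big.mult_left[OF this, of "\<lambda>H. H"]
    have "(\<lambda>H. H * (\<Sum>p\<in>UNIV. \<Sum>r\<in>Q. a p r * (D p r k H - \<delta> p r H))) \<in> O[at_right 0](\<lambda>H. H ^ Suc n)"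
      by simp
    from sum_in_bigo(1)[OF this s] show ?thesis
      by (simp add: right_diff_distrib sum_subtractf algebra_simps)
  qed
  \<comment> \<open>The factor \<open>H\<close> in the stage equation turns knowledge of the field
    differences up to \<open>H ^ n\<close> into knowledge of the stage errors up to
    \<open>H ^ Suc n\<close>.\<close>
  have transfer: "(\<lambda>H. E q k H - (H * (\<Sum>p\<in>UNIV. \<Sum>r\<in>Q. A p q r * \<delta> p r H) + s H)) \<in> O[at_right 0](\<lambda>H. H ^ Suc n)"
    if "\<And>p r. r \<in> Q \<Longrightarrow> (\<lambda>H. D p r k H - \<delta> p r H) \<in> O[at_right 0](\<lambda>H. H ^ n)"
      and "(\<lambda>H. S (\<lambda>p. A p q) (c q) k H - s H) \<in> O[at_right 0](\<lambda>H. H ^ Suc n)"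
      and q: "q \<in> Q" and k: "k < d" for q k \<delta> s n
  proof (rule iffD1[OF landau_o.big.in_cong combine[OF that(1,2)]])
    show "\<forall>\<^sub>F H in at_right 0. H * (\<Sum>p\<in>UNIV. \<Sum>r\<in>Q. A p q r * D p r k H) + S (\<lambda>p. A p q) (c q) k H -
        (H * (\<Sum>p\<in>UNIV. \<Sum>r\<in>Q. A p q r * \<delta> p r H) + s H) =
        E q k H - (H * (\<Sum>p\<in>UNIV. \<Sum>r\<in>Q. A p q r * \<delta> p r H) + s H)"
      using stage[OF q k] by (rule eventually_mono) (simp only:)
  qed

  have tlim: "((\<lambda>H. t0 + c q * H) \<longlongrightarrow> t0) (at_right 0)" for q
    using tendsto_add[OF tendsto_const[of t0] filterlim_scale_at_right[of "c q"]] by simp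
  have Plim: "((\<lambda>H. P (c q * H) k) \<longlongrightarrow> y0 k) (at_right 0)" if "k < d" for q k
    using filterlim_compose[OF smooth_curve_tendsto[OF sm, of k] filterlim_scale_at_right[of "c q"]] that
    by (simp add: P0)
  have D_bigo: "(\<lambda>H. D p q k H) \<in> O[at_right 0](w)"
    if E: "\<And>l. l < d \<Longrightarrow> E q l \<in> O[at_right 0](w)" and q: "q \<in> Q" and k: "k < d" for p q k w
    unfolding D_def using E by (intro rhs_difference_bigo tlim Plim Y q k) (auto simp: E_def[abs_def])

  have S4: "(\<lambda>H. S a \<gamma> k H - (\<Sum>j<4. H ^ Suc j * \<sigma> a \<gamma> k j)) \<in> O[at_right 0](\<lambda>H. H ^ 5)" if "k < d" for a \<gamma> k
    using quadrature_residual[OF P0 P' defect \<phi> that, where c = c and Q = Q and a = a and \<gamma> = \<gamma>]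
    unfolding S_def \<sigma>_def \<kappa>_def .
  have \<sigma>0: "\<sigma>Q q k 0 = 0" if "q \<in> Q" for q k
    using consistent[OF that] by (simp add: \<sigma>Q_def \<sigma>_def \<kappa>_def)
  have S: "(\<lambda>H. S (\<lambda>p. A p q) (c q) k H - (\<Sum>j<n. H ^ Suc j * \<sigma>Q q k j)) \<in> O[at_right 0](\<lambda>H. H ^ Suc n)"
    if "k < d" "n \<le> 4" for q k n
  proof -
    have "{..<4} = {..<n} \<union> {n..<4}" using that by auto
    note un = this
    have eq: "(\<Sum>j<4. H ^ Suc j * \<sigma>Q q k j) = (\<Sum>j<n. H ^ Suc j * \<sigma>Q q k j) + (\<Sum>j\<in>{n..<4}. H ^ Suc j * \<sigma>Q q k j)" for H :: real
      using sum.union_disjoint[of "{..<n}" "{n..<4}" "\<lambda>j. H ^ Suc j * \<sigma>Q q k j", folded un]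
      by (simp add: ivl_disj_int del: power_Suc)
    have "(\<lambda>H. \<Sum>j\<in>{n..<4}. \<sigma>Q q k j * H ^ Suc j) \<in> O[at_right 0](\<lambda>H. H ^ Suc n)"
      by (intro big_sum_in_bigo bigo_power_weaken[OF bigo_power_self]) auto
    moreover have "(\<lambda>H. S (\<lambda>p. A p q) (c q) k H - (\<Sum>j<4. H ^ Suc j * \<sigma>Q q k j)) \<in> O[at_right 0](\<lambda>H. H ^ Suc n)"
      unfolding \<sigma>Q_def using that by (intro bigo_power_weaken[OF S4]) auto
    ultimately have "(\<lambda>H. S (\<lambda>p. A p q) (c q) k H - (\<Sum>j<4. H ^ Suc j * \<sigma>Q q k j) + (\<Sum>j\<in>{n..<4}. \<sigma>Q q k j * H ^ Suc j))
       \<in> O[at_right 0](\<lambda>H. H ^ Suc n)" by (rule sum_in_bigo(1)[rotated])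
    then show ?thesis unfolding eq by (simp add: mult.commute)
  qed

  \<comment> \<open>The limit hypothesis gives boundedness only. Each passage through the field and
    the stage equation then gains a power of \<open>H\<close>; the term of first order drops out
    because \<open>\<sigma>0\<close> expresses internal consistency.\<close>
  have E0: "E q l \<in> O[at_right 0](\<lambda>H. H ^ 0)" if "q \<in> Q" "l < d" for q l
    using bigo_one_tendsto[OF tendsto_diff[OF Y[OF that] Plim[OF that(2), of q]]] by (simp add: E_def[abs_def])
  have E1: "E q l \<in> O[at_right 0](\<lambda>H. H ^ 1)" if "q \<in> Q" "l < d" for q l
    using transfer[of l "\<lambda>_ _ _. 0" 0 q "\<lambda>_. 0"] D_bigo[OF E0] S[of l 0 q] that by simp
  have E2: "E q l \<in> O[at_right 0](\<lambda>H. H ^ 2)" if "q \<in> Q" "l < d" for q l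
    using transfer[of l "\<lambda>_ _ _. 0" 1 q "\<lambda>_. 0"] D_bigo[OF E1] S[of l 1 q] \<sigma>0 that by (simp add: numeral_2_eq_2)
  have E3: "(\<lambda>H. E q l H - H ^ 2 * \<sigma>Q q l 1) \<in> O[at_right 0](\<lambda>H. H ^ 3)" if "q \<in> Q" "l < d" for q l
    using transfer[of l "\<lambda>_ _ _. 0" 2 q "\<lambda>H. H ^ 2 * \<sigma>Q q l 1"] D_bigo[OF E2] S[of l 2 q] \<sigma>0 that
    by (simp add: numeral_2_eq_2 numeral_3_eq_3)
  have lin: "(\<lambda>H. D p q k H - (\<Sum>l<d. (\<psi> p k l 0 + \<psi> p k l 1 * (c q * H)) * E q l H)) \<in> O[at_right 0](\<lambda>H. H ^ 4)"
    if "q \<in> Q" "k < d" for p q k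
    unfolding D_def E_def using that Y E2 by (intro \<psi>) (auto simp: E_def[abs_def])
  \<comment> \<open>\<open>\<delta>2\<close> and \<open>\<delta>3\<close> are the coefficients of
    \<open>H ^ 2\<close> and \<open>H ^ 3\<close> in the field differences, and
    \<open>\<epsilon>\<close> is that of \<open>H ^ 3\<close> in the stage errors, whose
    \<open>H ^ 2\<close> coefficient is \<open>\<sigma>Q q l 1\<close>.\<close>
  define \<delta>2 where "\<delta>2 p q k = (\<Sum>l<d. \<psi> p k l 0 * \<sigma>Q q l 1)" for p q k
  define \<epsilon> where "\<epsilon> q k = \<sigma>Q q k 2 + (\<Sum>p\<in>UNIV. \<Sum>r\<in>Q. A p q r * \<delta>2 p r k)" for q k
  define \<delta>3 where "\<delta>3 p q k = (\<Sum>l<d. \<psi> p k l 0 * \<epsilon> q l + \<psi> p k l 1 * (c q * \<sigma>Q q l 1))" for p q k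
  have D3: "(\<lambda>H. D p q k H - H ^ 2 * \<delta>2 p q k) \<in> O[at_right 0](\<lambda>H. H ^ 3)" if "q \<in> Q" "k < d" for p q k
  proof -
    have "(\<lambda>H. \<psi> p k l 0 * (E q l H - H ^ 2 * \<sigma>Q q l 1) + \<psi> p k l 1 * c q * (H ^ 1 * E q l H)) \<in> O[at_right 0](\<lambda>H. H ^ 3)"
      if "l < d" for l
    proof (rule sum_in_bigo(1))
      show "(\<lambda>H. \<psi> p k l 0 * (E q l H - H ^ 2 * \<sigma>Q q l 1)) \<in> O[at_right 0](\<lambda>H. H ^ 3)"
        using E3[OF \<open>q \<in> Q\<close> that] by simp
      have "(\<lambda>H. H ^ 1 * E q l H) \<in> O[at_right 0](\<lambda>H. H ^ (1 + 2))"
        using E2[OF \<open>q \<in> Q\<close> that] by (intro bigo_power_mult) auto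
      then have "(\<lambda>H. H ^ 1 * E q l H) \<in> O[at_right 0](\<lambda>H. H ^ 3)"
        by (simp only: one_plus_numeral semiring_norm)
      then show "(\<lambda>H. \<psi> p k l 1 * c q * (H ^ 1 * E q l H)) \<in> O[at_right 0](\<lambda>H. H ^ 3)" by simp
    qed
    then have "(\<lambda>H. \<Sum>l<d. \<psi> p k l 0 * (E q l H - H ^ 2 * \<sigma>Q q l 1) + \<psi> p k l 1 * c q * (H ^ 1 * E q l H)) \<in> O[at_right 0](\<lambda>H. H ^ 3)"
      by (intro big_sum_in_bigo) simp
    moreover have "(\<lambda>H. D p q k H - (\<Sum>l<d. (\<psi> p k l 0 + \<psi> p k l 1 * (c q * H)) * E q l H)) \<in> O[at_right 0](\<lambda>H. H ^ 3)"
      using that by (intro bigo_power_weaken[OF lin]) auto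
    ultimately have "(\<lambda>H. D p q k H - (\<Sum>l<d. (\<psi> p k l 0 + \<psi> p k l 1 * (c q * H)) * E q l H) +
      (\<Sum>l<d. \<psi> p k l 0 * (E q l H - H ^ 2 * \<sigma>Q q l 1) + \<psi> p k l 1 * c q * (H ^ 1 * E q l H))) \<in> O[at_right 0](\<lambda>H. H ^ 3)"
      by (rule sum_in_bigo(1)[rotated])
    moreover have "D p q k H - (\<Sum>l<d. (\<psi> p k l 0 + \<psi> p k l 1 * (c q * H)) * E q l H) +
      (\<Sum>l<d. \<psi> p k l 0 * (E q l H - H ^ 2 * \<sigma>Q q l 1) + \<psi> p k l 1 * c q * (H ^ 1 * E q l H)) = D p q k H - H ^ 2 * \<delta>2 p q k" for H
      by (simp add: \<delta>2_def algebra_simps sum.distrib sum_subtractf sum_distrib_left)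
    ultimately show ?thesis by (simp only:)
  qed
  have E4: "(\<lambda>H. E q l H - (H ^ 2 * \<sigma>Q q l 1 + H ^ 3 * \<epsilon> q l)) \<in> O[at_right 0](\<lambda>H. H ^ 4)" if "q \<in> Q" "l < d" for q l
  proof -
    have "(\<lambda>H. S (\<lambda>p. A p q) (c q) l H - (H ^ 2 * \<sigma>Q q l 1 + H ^ 3 * \<sigma>Q q l 2)) \<in> O[at_right 0](\<lambda>H. H ^ Suc 3)"
      using S[of l 3 q] \<sigma>0 that by (simp add: numeral_2_eq_2 numeral_3_eq_3 algebra_simps)
    from transfer[of l "\<lambda>p r H. H ^ 2 * \<delta>2 p r l" 3 q, OF D3 this] that
    have "(\<lambda>H. E q l H - (H * (\<Sum>p\<in>UNIV. \<Sum>r\<in>Q. A p q r * (H ^ 2 * \<delta>2 p r l)) + (H ^ 2 * \<sigma>Q q l 1 + H ^ 3 * \<sigma>Q q l 2)))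
       \<in> O[at_right 0](\<lambda>H. H ^ 4)" by simp
    moreover have "H * (\<Sum>p\<in>UNIV. \<Sum>r\<in>Q. A p q r * (H ^ 2 * \<delta>2 p r l)) + (H ^ 2 * \<sigma>Q q l 1 + H ^ 3 * \<sigma>Q q l 2) =
       H ^ 2 * \<sigma>Q q l 1 + H ^ 3 * \<epsilon> q l" for H
      by (simp add: \<epsilon>_def algebra_simps sum_distrib_left power2_eq_square power3_eq_cube)
    ultimately show ?thesis by (simp only:)
  qed
  have D4: "(\<lambda>H. D p q k H - (H ^ 2 * \<delta>2 p q k + H ^ 3 * \<delta>3 p q k)) \<in> O[at_right 0](\<lambda>H. H ^ 4)" if "q \<in> Q" "k < d" for p q k
  proof -
    have "(\<lambda>H. \<psi> p k l 0 * (E q l H - (H ^ 2 * \<sigma>Q q l 1 + H ^ 3 * \<epsilon> q l)) + \<psi> p k l 1 * c q * (H ^ 1 * (E q l H - H ^ 2 * \<sigma>Q q l 1))) \<in> O[at_right 0](\<lambda>H. H ^ 4)"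
      if "l < d" for l
    proof (rule sum_in_bigo(1))
      show "(\<lambda>H. \<psi> p k l 0 * (E q l H - (H ^ 2 * \<sigma>Q q l 1 + H ^ 3 * \<epsilon> q l))) \<in> O[at_right 0](\<lambda>H. H ^ 4)"
        using E4[OF \<open>q \<in> Q\<close> that] by simp
      have "(\<lambda>H. H ^ 1 * (E q l H - H ^ 2 * \<sigma>Q q l 1)) \<in> O[at_right 0](\<lambda>H. H ^ (1 + 3))"
        using E3[OF \<open>q \<in> Q\<close> that] by (intro bigo_power_mult) auto
      then have "(\<lambda>H. H ^ 1 * (E q l H - H ^ 2 * \<sigma>Q q l 1)) \<in> O[at_right 0](\<lambda>H. H ^ 4)"
        by (simp only: one_plus_numeral semiring_norm)
      then show "(\<lambda>H. \<psi> p k l 1 * c q * (H ^ 1 * (E q l H - H ^ 2 * \<sigma>Q q l 1))) \<in> O[at_right 0](\<lambda>H. H ^ 4)" by simp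
    qed
    then have "(\<lambda>H. \<Sum>l<d. \<psi> p k l 0 * (E q l H - (H ^ 2 * \<sigma>Q q l 1 + H ^ 3 * \<epsilon> q l)) + \<psi> p k l 1 * c q * (H ^ 1 * (E q l H - H ^ 2 * \<sigma>Q q l 1))) \<in> O[at_right 0](\<lambda>H. H ^ 4)"
      by (intro big_sum_in_bigo) simp
    with lin[OF that]
    have "(\<lambda>H. D p q k H - (\<Sum>l<d. (\<psi> p k l 0 + \<psi> p k l 1 * (c q * H)) * E q l H) +
      (\<Sum>l<d. \<psi> p k l 0 * (E q l H - (H ^ 2 * \<sigma>Q q l 1 + H ^ 3 * \<epsilon> q l)) + \<psi> p k l 1 * c q * (H ^ 1 * (E q l H - H ^ 2 * \<sigma>Q q l 1)))) \<in> O[at_right 0](\<lambda>H. H ^ 4)"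
      by (rule sum_in_bigo(1))
    moreover have "D p q k H - (\<Sum>l<d. (\<psi> p k l 0 + \<psi> p k l 1 * (c q * H)) * E q l H) +
      (\<Sum>l<d. \<psi> p k l 0 * (E q l H - (H ^ 2 * \<sigma>Q q l 1 + H ^ 3 * \<epsilon> q l)) + \<psi> p k l 1 * c q * (H ^ 1 * (E q l H - H ^ 2 * \<sigma>Q q l 1))) = D p q k H - (H ^ 2 * \<delta>2 p q k + H ^ 3 * \<delta>3 p q k)" for H
      by (simp add: \<delta>2_def \<delta>3_def algebra_simps sum.distrib sum_subtractf sum_distrib_left power2_eq_square power3_eq_cube)
    ultimately show ?thesis by (simp only:)
  qed

  have cond:
    "\<And>p. (\<Sum>q\<in>Q. b p q) = 1" "\<And>p. (\<Sum>q\<in>Q. b p q * c q) = 1/2"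
    "\<And>p. (\<Sum>q\<in>Q. b p q * c q ^ 2) = 1/3" "\<And>p p'. (\<Sum>q\<in>Q. b p q * (\<Sum>r\<in>Q. A p' q r * c r)) = 1/6"
    "\<And>p. (\<Sum>q\<in>Q. b p q * c q ^ 3) = 1/4"
    "\<And>p p'. (\<Sum>q\<in>Q. b p q * (c q * (\<Sum>r\<in>Q. A p' q r * c r))) = 1/8"
    "\<And>p p'. (\<Sum>q\<in>Q. b p q * (\<Sum>r\<in>Q. A p' q r * c r ^ 2)) = 1/12"
    "\<And>p p' p''. (\<Sum>q\<in>Q. b p q * (\<Sum>r\<in>Q. A p' q r * (\<Sum>u\<in>Q. A p'' r u * c u))) = 1/24"
    using conditions unfolding ark_conditions_4_def ark_conditions_3_def by blast+
  have \<kappa>b: "\<kappa> b 1 p j = 0" if "j < 4" for p j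
  proof -
    from that consider "j = 0" | "j = 1" | "j = 2" | "j = 3" by linarith
    then show ?thesis by cases (simp_all add: \<kappa>_def cond)
  qed
  have swap\<sigma>: "(\<Sum>q\<in>Q. w q * \<sigma>Q q k j) = (\<Sum>u\<in>UNIV. \<phi> u k j * (\<Sum>q\<in>Q. w q * \<kappa> (\<lambda>p. A p q) (c q) u j))" for w k j
    unfolding \<sigma>Q_def \<sigma>_def sum_distrib_left by (subst sum.swap) (simp add: mult_ac)
  have \<kappa>sum: "(\<Sum>q\<in>Q. w q * \<kappa> (\<lambda>p. A p q) (c q) u j) =
      (\<Sum>q\<in>Q. w q * (\<Sum>r\<in>Q. A u q r * c r ^ j)) - (\<Sum>q\<in>Q. w q * c q ^ Suc j) / real (Suc j)" for w u j
    by (simp add: \<kappa>_def right_diff_distrib sum_subtractf sum_divide_distrib)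
  have \<kappa>1: "(\<Sum>q\<in>Q. w q * \<kappa> (\<lambda>p. A p q) (c q) u 1) =
      (\<Sum>q\<in>Q. w q * (\<Sum>r\<in>Q. A u q r * c r)) - (\<Sum>q\<in>Q. w q * c q ^ 2) / 2" for w u
    using \<kappa>sum[of w u 1] by (simp only: Suc_1 power_one_right of_nat_numeral)
  have \<kappa>2: "(\<Sum>q\<in>Q. w q * \<kappa> (\<lambda>p. A p q) (c q) u 2) =
      (\<Sum>q\<in>Q. w q * (\<Sum>r\<in>Q. A u q r * c r ^ 2)) - (\<Sum>q\<in>Q. w q * c q ^ 3) / 3" for w u
    using \<kappa>sum[of w u 2] by (simp only: Suc_numeral semiring_norm of_nat_numeral)
  \<comment> \<open>The cancellations rest on 1/6 = (1/3)/2 here, and in the next three facts on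
    1/12 = (1/4)/3, 1/8 = (1/4)/2 and 1/24 = (1/12)/2.\<close>
  have b1: "(\<Sum>q\<in>Q. b p q * \<sigma>Q q l 1) = 0" for p l
    unfolding swap\<sigma> \<kappa>1 by (simp add: cond)
  have b2: "(\<Sum>q\<in>Q. b p q * \<sigma>Q q l 2) = 0" for p l
    unfolding swap\<sigma> \<kappa>2 by (simp add: cond)
  have bc1: "(\<Sum>q\<in>Q. b p q * (c q * \<sigma>Q q l 1)) = 0" for p l
  proof -
    have "c q * c q ^ 2 = c q ^ 3" for q by (simp add: power3_eq_cube power2_eq_square)
    with swap\<sigma>[of "\<lambda>q. b p q * c q" l 1] \<kappa>1[of "\<lambda>q. b p q * c q"] show ?thesis
      by (simp add: mult.assoc cond del: One_nat_def)
  qed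
  have bA1: "(\<Sum>q\<in>Q. b p q * (\<Sum>r\<in>Q. A u q r * \<sigma>Q r l 1)) = 0" for p u l
  proof -
    have "(\<Sum>q\<in>Q. b p q * (\<Sum>r\<in>Q. A u q r * \<sigma>Q r l 1)) =
        (\<Sum>v\<in>UNIV. \<phi> v l 1 * (\<Sum>q\<in>Q. b p q * (\<Sum>r\<in>Q. A u q r * \<kappa> (\<lambda>p. A p r) (c r) v 1)))"
      unfolding swap\<sigma> sum_distrib_left
      by (subst sum.swap) (simp add: mult_ac)
    moreover have "(\<Sum>q\<in>Q. b p q * (\<Sum>r\<in>Q. A u q r * \<kappa> (\<lambda>p. A p r) (c r) v 1)) = 0" for v
    proof -
      have "(\<Sum>q\<in>Q. b p q * (\<Sum>r\<in>Q. A u q r * \<kappa> (\<lambda>p. A p r) (c r) v 1)) =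
         (\<Sum>q\<in>Q. b p q * (\<Sum>r\<in>Q. A u q r * (\<Sum>w\<in>Q. A v r w * c w))) - (\<Sum>q\<in>Q. b p q * (\<Sum>r\<in>Q. A u q r * c r ^ 2)) / 2"
        unfolding \<kappa>1 by (simp add: right_diff_distrib sum_subtractf sum_divide_distrib[symmetric])
      then show ?thesis by (simp add: cond)
    qed
    ultimately show ?thesis by simp
  qed
  have b\<delta>2: "(\<Sum>q\<in>Q. b p q * \<delta>2 u q l) = (\<Sum>m<d. \<psi> u l m 0 * (\<Sum>q\<in>Q. b p q * \<sigma>Q q m 1))" for p u l
    unfolding \<delta>2_def sum_distrib_left by (subst sum.swap) (simp add: mult_ac)
  have b\<epsilon>: "(\<Sum>q\<in>Q. b p q * \<epsilon> q l) = 0" for p l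
  proof -
    have "(\<Sum>r\<in>Q. A u q r * \<delta>2 u r l) = (\<Sum>m<d. \<psi> u l m 0 * (\<Sum>r\<in>Q. A u q r * \<sigma>Q r m 1))" for u q
      unfolding \<delta>2_def sum_distrib_left by (subst sum.swap) (simp add: mult_ac)
    then have "(\<Sum>q\<in>Q. b p q * (\<Sum>u\<in>UNIV. \<Sum>r\<in>Q. A u q r * \<delta>2 u r l)) =
       (\<Sum>q\<in>Q. \<Sum>u\<in>UNIV. \<Sum>m<d. \<psi> u l m 0 * (b p q * (\<Sum>r\<in>Q. A u q r * \<sigma>Q r m 1)))"
      by (simp add: sum_distrib_left mult_ac)
    also have "\<dots> = (\<Sum>u\<in>UNIV. \<Sum>m<d. \<psi> u l m 0 * (\<Sum>q\<in>Q. b p q * (\<Sum>r\<in>Q. A u q r * \<sigma>Q r m 1)))"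
      by (simp only: sum.swap[of _ _ Q] sum_distrib_left[symmetric])
    also have "\<dots> = 0" by (simp only: bA1) simp
    finally show ?thesis using b2[of p l] by (simp add: \<epsilon>_def distrib_left sum.distrib)
  qed
  have b\<delta>3: "(\<Sum>q\<in>Q. b p q * \<delta>3 p q k) = 0" for p
  proof -
    have "(\<Sum>q\<in>Q. b p q * \<delta>3 p q k) = (\<Sum>l<d. \<psi> p k l 0 * (\<Sum>q\<in>Q. b p q * \<epsilon> q l) + \<psi> p k l 1 * (\<Sum>q\<in>Q. b p q * (c q * \<sigma>Q q l 1)))"
      unfolding \<delta>3_def sum_distrib_left sum.distrib[symmetric] by (subst sum.swap) (simp add: algebra_simps)
    then show ?thesis by (simp add: b\<epsilon> bc1[unfolded One_nat_def])
  qed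
  \<comment> \<open>The residual of \<open>b\<close> over the full step vanishes through
    \<open>H ^ 4\<close> by the moment conditions, so it is replaced by 0; the expanded field
    differences are annihilated by \<open>b\<close> afterwards.\<close>
  have "(\<lambda>H. H * (\<Sum>p\<in>UNIV. \<Sum>r\<in>Q. b p r * D p r k H) + S b 1 k H
      - (H * (\<Sum>p\<in>UNIV. \<Sum>r\<in>Q. b p r * (H ^ 2 * \<delta>2 p r k + H ^ 3 * \<delta>3 p r k)) + 0)) \<in> O[at_right 0](\<lambda>H. H ^ Suc 4)"
  proof (rule combine)
    show "(\<lambda>H. S b 1 k H - 0) \<in> O[at_right 0](\<lambda>H. H ^ Suc 4)"
      using S4[OF k, of b 1] by (simp add: \<sigma>_def \<kappa>b)
  qed (rule D4[OF _ k])
  moreover have "(\<Sum>p\<in>UNIV. \<Sum>r\<in>Q. b p r * (H ^ 2 * \<delta>2 p r k + H ^ 3 * \<delta>3 p r k)) = 0" for H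
  proof -
    have "(\<Sum>r\<in>Q. b p r * (H ^ 2 * \<delta>2 p r k + H ^ 3 * \<delta>3 p r k)) =
        H ^ 2 * (\<Sum>r\<in>Q. b p r * \<delta>2 p r k) + H ^ 3 * (\<Sum>r\<in>Q. b p r * \<delta>3 p r k)" for p
      by (simp add: algebra_simps sum.distrib sum_distrib_left)
    then show ?thesis by (simp add: b\<delta>2 b1[unfolded One_nat_def] b\<delta>3)
  qed
  ultimately have "(\<lambda>H. H * (\<Sum>p\<in>UNIV. \<Sum>r\<in>Q. b p r * D p r k H) + S b 1 k H) \<in> O[at_right 0](\<lambda>H. H ^ 5)"
    by simp
  from iffD1[OF landau_o.big.in_cong[OF final] this]
  have "(\<lambda>H. y1 H k - P H k) \<in> O[at_right 0](\<lambda>H. H ^ 5)" .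
  moreover have "(\<lambda>H. y (t0 + H) k - P H k) \<in> O[at_right 0](\<lambda>H. H ^ Suc 4)"
    by (rule solution_approximation[OF sol h k P0 P' defect])
  then have "(\<lambda>H. y (t0 + H) k - P H k) \<in> O[at_right 0](\<lambda>H. H ^ 5)" by simp
  ultimately have "(\<lambda>H. y1 H k - P H k - (y (t0 + H) k - P H k)) \<in> O[at_right 0](\<lambda>H. H ^ 5)"
    by (rule sum_in_bigo(2))
  then show ?thesis by simp
qed

end

lemma ark_has_order_4:
  fixes A :: "'p::finite \<Rightarrow> 'q \<Rightarrow> 'q \<Rightarrow> real"
  assumes "\<And>p q. q \<in> Q \<Longrightarrow> (\<Sum>r\<in>Q. A p q r) = c q" "ark_conditions_4 Q A b c"
  shows "has_order Q (ark_step Q A b c) 4"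
  unfolding has_order_def
proof (intro exI[of _ 4] allI impI)
  fix d and f :: "'p split_rhs" and t0 y0 h y Y y1 k
  assume f: "\<forall>\<sigma>. smooth_field d 4 (f \<sigma>)" and rest: "0 < h" "exact_solution d f t0 y0 h y"
    "\<forall>\<^sub>F H in at_right 0. ark_step Q A b c d f t0 H y0 (Y H) (y1 H)"
    "\<forall>q\<in>Q. \<forall>k<d. ((\<lambda>H. Y H q k) \<longlongrightarrow> y0 k) (at_right 0)" "k < d"
  interpret smooth_problem d f t0 y0 using f by unfold_locales blast
  show "(\<lambda>H. y1 H k - y (t0 + H) k) \<in> O[at_right 0](\<lambda>H. H ^ (4 + 1))"
    using local_error_bigo[OF assms rest(2,1,3) _ rest(5)] rest(4) by simp
qed

section \<open>Necessity of the order conditions\<close>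

lemma continuous_on_coordinate: "continuous_on UNIV (\<lambda>x :: real \<times> vec. snd x i)"
  by (rule continuous_on_product_then_coordinatewise) (rule continuous_on_snd[OF continuous_on_id])

text \<open>The order of a method only promises its estimate for some unknown class, so test fields
  have to lie in every class. Differentiation keeps the form of a monomial, whence the arbitrary
  coefficient and exponent.\<close>

lemma C_class_monomial: "C_class d r (\<lambda>t x. a * t ^ m)"
proof (induction r arbitrary: a m)
  case 0
  show ?case by (auto simp: C_class.simps case_prod_beta intro!: continuous_intros)
next
  case (Suc r)
  have "((\<lambda>u. a * u ^ m) has_real_derivative (a * real m) * t ^ (m - Suc 0)) (at t)" for t
    using DERIV_cmult[OF DERIV_pow[of m t], of a] by (simp add: mult.assoc)
  moreover have "C_class d r (\<lambda>t x. (a * real m) * t ^ (m - Suc 0))" by (rule Suc)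
  moreover have "C_class d r (\<lambda>t x. 0)" using Suc[of 0 0] by simp
  moreover have "continuous_on UNIV (\<lambda>(t, x :: vec). a * t ^ m)"
    by (auto simp: case_prod_beta intro!: continuous_intros)
  ultimately show ?case unfolding C_class.simps
    by (intro conjI exI[of _ "\<lambda>t x. (a * real m) * t ^ (m - Suc 0)"] exI[of _ "\<lambda>k t x. 0"]) simp_all
qed

lemma C_class_monomial_coordinate: "C_class d r (\<lambda>t x. a * t ^ m * x i)"
proof (induction r arbitrary: a m)
  case 0
  show ?case by (auto simp: C_class.simps case_prod_beta intro!: continuous_intros continuous_on_coordinate)
next
  case (Suc r)
  have "((\<lambda>u. a * u ^ m * x i) has_real_derivative (a * real m) * t ^ (m - Suc 0) * x i) (at t)" for t and x :: vec
    using DERIV_cmult_right[OF DERIV_cmult[OF DERIV_pow[of m t], of a], of "x i"] by (simp add: mult.assoc)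
  moreover have "((\<lambda>u. a * t ^ m * (x(k := u)) i) has_real_derivative (if k = i then a else 0) * t ^ m) (at (x k))"
    for t and x :: vec and k
  proof (cases "k = i")
    case True
    have "((\<lambda>u. a * t ^ m * u) has_real_derivative a * t ^ m * 1) (at (x k))"
      by (intro DERIV_cmult DERIV_ident)
    with True show ?thesis by simp
  qed simp
  moreover have "C_class d r (\<lambda>t x. (a * real m) * t ^ (m - Suc 0) * x i)" by (rule Suc)
  moreover have "C_class d r (\<lambda>t x. (if k = i then a else 0) * t ^ m)" for k by (rule C_class_monomial)
  moreover have "continuous_on UNIV (\<lambda>(t, x :: vec). a * t ^ m * x i)"
    by (auto simp: case_prod_beta intro!: continuous_intros continuous_on_coordinate)
  ultimately show ?case unfolding C_class.simps
    by (intro conjI exI[of _ "\<lambda>t x. (a * real m) * t ^ (m - Suc 0) * x i"]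
        exI[of _ "\<lambda>k t x. (if k = i then a else 0) * t ^ m"]) (simp_all only: simp_thms)
qed

lemma sum_partition_delta:
  fixes z :: "'q \<Rightarrow> real"
  shows "(\<Sum>p\<in>(UNIV :: 'p::finite set). \<Sum>q\<in>Q. a p q * (if p = p0 then z q else 0)) = (\<Sum>q\<in>Q. a p0 q * z q)"
proof -
  have "(\<Sum>q\<in>Q. a p q * (if p = p0 then z q else 0)) = (if p = p0 then \<Sum>q\<in>Q. a p q * z q else 0)" for p
    by simp
  then show ?thesis by simp
qed

lemma bigo_power_imp_zero:
  assumes "(\<lambda>H :: real. K * H ^ N) \<in> O[at_right 0](\<lambda>H. H ^ Suc n)" "N \<le> n"
  shows "K = 0"
proof -
  have "(\<lambda>H. K * H ^ N) \<in> O[at_right 0](\<lambda>H. H ^ Suc N)"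
    using assms by (intro bigo_power_weaken[OF assms(1)]) simp
  then obtain C where "\<forall>\<^sub>F H in at_right 0. norm (K * H ^ N) \<le> C * norm (H ^ Suc N :: real)"
    by (elim landau_o.bigE)
  then have "\<forall>\<^sub>F H in at_right 0. \<bar>K\<bar> \<le> C * H"
    using eventually_at_right_less[of 0]
  proof eventually_elim
    case (elim H)
    then have "\<bar>K\<bar> * H ^ N \<le> (C * H) * H ^ N" by (simp add: abs_mult mult_ac)
    with elim(2) show ?case by (simp add: mult_le_cancel_right)
  qed
  moreover have "((\<lambda>H. C * H) \<longlongrightarrow> 0) (at_right 0)" by (rule filterlim_scale_at_right)
  ultimately have "\<bar>K\<bar> \<le> 0" by (intro tendsto_lowerbound[of "\<lambda>H. C * H" 0 "at_right 0"]) simp_all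
  then show ?thesis by simp
qed

text \<open>The three components are integrated one after the other, so the stages are explicit even for
  an implicit method.\<close>

lemma has_order_imp_cascade:
  fixes A :: "'p::finite \<Rightarrow> 'q \<Rightarrow> 'q \<Rightarrow> real" and u0 u1 \<alpha> \<beta> :: real
  assumes ord: "has_order Q (ark_step Q A b c) n"
  shows "(\<lambda>H. H * (\<Sum>q\<in>Q. b p q * ((c q * H) ^ j * (u1 + H * (\<Sum>r\<in>Q. A p' q r * (\<beta> * (c r * H) ^ l *
        (u0 + H * (\<Sum>v\<in>Q. A p'' r v * (\<alpha> * (c v * H) ^ m)))))))) -
      (u1 / real (Suc j) * H ^ Suc j + \<beta> * u0 / real (Suc l) / real (l + j + 2) * H ^ (l + j + 2) +
       \<beta> * \<alpha> / real (Suc m) / real (m + l + 2) / real (m + l + j + 3) * H ^ (m + l + j + 3)))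
    \<in> O[at_right 0](\<lambda>H. H ^ Suc n)"
proof -
  \<comment> \<open>The partition \<open>p''\<close> drives component 0, \<open>p'\<close> feeds
    component 0 into component 1, and \<open>p\<close> feeds component 1 into component 2. The error
    of component 2 thus contains the three nested sums.\<close>
  define f :: "'p split_rhs" where "f s t x k =
    (if k = 0 then if s = p'' then \<alpha> * t ^ m else 0
     else if k = 1 then if s = p' then \<beta> * t ^ l * x 0 else 0
     else if s = p then 1 * t ^ j * x 1 else 0)" for s t x k
  \<comment> \<open>Powers integrated successively from 0; each integration contributes one
    denominator, so that \<open>m = 1\<close> and \<open>l = j = 0\<close> give 2 * 3 * 4 =
    24.\<close>
  define y where "y t k =
    (if k = 0 then u0 + \<alpha> / real (Suc m) * t ^ Suc m
     else if k = 1 then u1 + (\<beta> * u0 / real (Suc l) * t ^ Suc l + \<beta> * \<alpha> / real (Suc m) / real (m + l + 2) * t ^ (m + l + 2))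
     else u1 / real (Suc j) * t ^ Suc j + \<beta> * u0 / real (Suc l) / real (l + j + 2) * t ^ (l + j + 2) +
       \<beta> * \<alpha> / real (Suc m) / real (m + l + 2) / real (m + l + j + 3) * t ^ (m + l + j + 3))" for t :: real and k :: nat
  define y0 where "y0 = y 0"
  define S0 where "S0 a H = u0 + H * (\<Sum>v\<in>Q. a p'' v * (\<alpha> * (c v * H) ^ m))" for a :: "'p \<Rightarrow> 'q \<Rightarrow> real" and H
  define S1 where "S1 a H = u1 + H * (\<Sum>r\<in>Q. a p' r * (\<beta> * (c r * H) ^ l * S0 (\<lambda>p. A p r) H))" for a :: "'p \<Rightarrow> 'q \<Rightarrow> real" and H
  define S2 where "S2 a H = H * (\<Sum>q\<in>Q. a p q * (1 * (c q * H) ^ j * S1 (\<lambda>p. A p q) H))" for a :: "'p \<Rightarrow> 'q \<Rightarrow> real" and H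
  \<comment> \<open>The update with generic weights \<open>a\<close>: row \<open>q\<close> of
    \<open>A\<close> gives the stage \<open>q\<close>, and \<open>b\<close> gives the result of the
    step.\<close>
  define R where "R a H k = (if k = 0 then S0 a H else if k = 1 then S1 a H else S2 a H)" for a :: "'p \<Rightarrow> 'q \<Rightarrow> real" and H and k :: nat
  define Y where "Y H q = R (\<lambda>p. A p q) H" for H q
  define y1 where "y1 = R b"
  have smooth: "smooth_field 3 r (f s)" for r s
  proof -
    have "C_class 3 r (\<lambda>t x. f s t x k)" for k
    proof -
      have "(\<lambda>t x. f s t x k) = (\<lambda>t x. (if s = p'' then \<alpha> else 0) * t ^ m)" if "k = 0"
        using that by (auto simp: f_def)
      moreover have "(\<lambda>t x. f s t x k) = (\<lambda>t x. (if s = p' then \<beta> else 0) * t ^ l * x 0)" if "k = 1"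
        using that by (auto simp: f_def)
      moreover have "(\<lambda>t x. f s t x k) = (\<lambda>t x. (if s = p then 1 else 0) * t ^ j * x 1)" if "k \<noteq> 0" "k \<noteq> 1"
        using that by (auto simp: f_def)
      ultimately show ?thesis
        by (cases "k = 0"; cases "k = 1") (simp_all only: C_class_monomial C_class_monomial_coordinate simp_thms)
    qed
    then show ?thesis unfolding smooth_field_def by (auto simp: f_def)
  qed
  have fsum: "(\<Sum>s\<in>UNIV. f s t x k) =
    (if k = 0 then \<alpha> * t ^ m else if k = 1 then \<beta> * t ^ l * x 0 else t ^ j * x 1)" for t x k
    by (simp add: f_def)
  have pow: "((\<lambda>t. e / real (Suc N) * t ^ Suc N) has_real_derivative e * t ^ N) (at t)" for e t :: real and N
    using DERIV_cmult[OF DERIV_pow[of "Suc N" t], of "e / real (Suc N)"] by (simp del: of_nat_Suc power_Suc)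
  have pow2: "((\<lambda>t. e / real (N + 2) * t ^ (N + 2)) has_real_derivative e * t ^ Suc N) (at t)" for e t :: real and N
    using pow[of e "Suc N" t] by (simp del: of_nat_Suc power_Suc)
  have pow3: "((\<lambda>t. e / real (N + 3) * t ^ (N + 3)) has_real_derivative e * t ^ (N + 2)) (at t)" for e t :: real and N
    using pow[of e "N + 2" t] by (simp add: eval_nat_numeral del: of_nat_Suc power_Suc)
  have "((\<lambda>u. y u k) has_real_derivative (\<Sum>s\<in>UNIV. f s t (y t) k)) (at t)" if "k < 3" for t k
  proof -
    from that consider "k = 0" | "k = 1" | "k = 2" by linarith
    then show ?thesis
    proof cases
      case 1
      have "((\<lambda>u. u0 + \<alpha> / real (Suc m) * u ^ Suc m) has_real_derivative 0 + \<alpha> * t ^ m) (at t)"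
        by (intro DERIV_add DERIV_const pow)
      with 1 show ?thesis unfolding fsum by (simp add: y_def)
    next
      case 2
      have "((\<lambda>u. u1 + (\<beta> * u0 / real (Suc l) * u ^ Suc l + \<beta> * \<alpha> / real (Suc m) / real (m + l + 2) * u ^ (m + l + 2)))
        has_real_derivative 0 + (\<beta> * u0 * t ^ l + \<beta> * \<alpha> / real (Suc m) * t ^ Suc (m + l))) (at t)"
        by (intro DERIV_add DERIV_const pow pow2)
      moreover have "0 + (\<beta> * u0 * t ^ l + \<beta> * \<alpha> / real (Suc m) * t ^ Suc (m + l)) = \<beta> * t ^ l * (u0 + \<alpha> / real (Suc m) * t ^ Suc m)"
        by (simp add: algebra_simps power_add del: of_nat_Suc)
      ultimately show ?thesis using 2 unfolding fsum by (simp add: y_def del: of_nat_Suc power_Suc)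
    next
      case 3
      have "((\<lambda>u. u1 / real (Suc j) * u ^ Suc j + \<beta> * u0 / real (Suc l) / real (l + j + 2) * u ^ (l + j + 2) +
         \<beta> * \<alpha> / real (Suc m) / real (m + l + 2) / real (m + l + j + 3) * u ^ (m + l + j + 3))
        has_real_derivative u1 * t ^ j + \<beta> * u0 / real (Suc l) * t ^ Suc (l + j) +
         \<beta> * \<alpha> / real (Suc m) / real (m + l + 2) * t ^ (m + l + j + 2)) (at t)"
        by (intro DERIV_add pow pow2 pow3)
      moreover have "u1 * t ^ j + \<beta> * u0 / real (Suc l) * t ^ Suc (l + j) + \<beta> * \<alpha> / real (Suc m) / real (m + l + 2) * t ^ (m + l + j + 2)
        = t ^ j * (u1 + (\<beta> * u0 / real (Suc l) * t ^ Suc l + \<beta> * \<alpha> / real (Suc m) / real (m + l + 2) * t ^ (m + l + 2)))"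
        by (simp add: algebra_simps power_add del: of_nat_Suc of_nat_add)
      ultimately show ?thesis using 3 unfolding fsum by (simp add: y_def del: of_nat_Suc power_Suc of_nat_add)
    qed
  qed
  then have sol: "exact_solution 3 f 0 y0 1 y"
    unfolding exact_solution_def y0_def by (auto intro: has_field_derivative_at_within)
  have stage: "R a H k = y0 k + H * (\<Sum>s\<in>UNIV. \<Sum>r\<in>Q. a s r * f s (0 + c r * H) (Y H r) k)" if "k < 3" for a H k
  proof -
    from that consider "k = 0" | "k = 1" | "k = 2" by linarith
    then show ?thesis
      by cases (simp_all add: f_def R_def Y_def y0_def y_def S0_def S1_def S2_def sum_partition_delta)
  qed
  have step: "\<forall>\<^sub>F H in at_right 0. ark_step Q A b c 3 f 0 H y0 (Y H) (y1 H)"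
    unfolding ark_step_def using stage by (auto simp: Y_def y1_def)
  have H0: "((\<lambda>H. H) \<longlongrightarrow> (0 :: real)) (at_right 0)" by (rule tendsto_ident_at)
  have l0: "(S0 a \<longlongrightarrow> u0) (at_right 0)" for a
    unfolding S0_def by (rule tendsto_eq_intros H0 refl)+ simp
  have l1: "(S1 a \<longlongrightarrow> u1) (at_right 0)" for a
    unfolding S1_def by (rule tendsto_eq_intros H0 l0 refl)+ simp
  have l2: "(S2 a \<longlongrightarrow> 0) (at_right 0)" for a
    unfolding S2_def by (rule tendsto_eq_intros H0 l1 refl)+ simp
  have lim: "((\<lambda>H. Y H q k) \<longlongrightarrow> y0 k) (at_right 0)" for q k
    using l0 l1 l2 by (simp add: Y_def R_def y0_def y_def zero_power)
  from ord obtain r where r: "\<And>d (f :: 'p split_rhs) t0 y0 h y Y y1.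
        (\<forall>\<sigma>. smooth_field d r (f \<sigma>)) \<Longrightarrow> 0 < h \<Longrightarrow> exact_solution d f t0 y0 h y \<Longrightarrow>
        (\<forall>\<^sub>F H in at_right 0. ark_step Q A b c d f t0 H y0 (Y H) (y1 H)) \<Longrightarrow>
        (\<forall>q\<in>Q. \<forall>k<d. ((\<lambda>H. Y H q k) \<longlongrightarrow> y0 k) (at_right 0)) \<Longrightarrow>
        (\<forall>k<d. (\<lambda>H. y1 H k - y (t0 + H) k) \<in> O[at_right 0](\<lambda>H. H ^ (n + 1)))"
    unfolding has_order_def by blast
  have "\<forall>k<3. (\<lambda>H. y1 H k - y (0 + H) k) \<in> O[at_right 0](\<lambda>H. H ^ (n + 1))"
    using smooth lim by (intro r[OF _ _ sol step]) auto
  then have "(\<lambda>H. y1 H 2 - y (0 + H) 2) \<in> O[at_right 0](\<lambda>H. H ^ Suc n)" by simp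
  then show ?thesis
    by (simp add: y1_def R_def y_def S0_def S1_def S2_def del: power_Suc of_nat_Suc of_nat_add)
qed

section \<open>Order conditions read off from the cascade\<close>

lemma has_order_imp_quadrature:
  fixes A :: "'p::finite \<Rightarrow> 'q \<Rightarrow> 'q \<Rightarrow> real"
  assumes ord: "has_order Q (ark_step Q A b c) n" and "j < n"
  shows "(\<Sum>q\<in>Q. b p q * c q ^ j) = 1 / real (Suc j)"
proof -
  \<comment> \<open>With \<open>\<beta> = 0\<close> the middle component stays at its initial value
    1, and only the outer quadrature is tested.\<close>
  have "(\<lambda>H. ((\<Sum>q\<in>Q. b p q * c q ^ j) - 1 / real (Suc j)) * H ^ Suc j) \<in> O[at_right 0](\<lambda>H. H ^ Suc n)"
    using has_order_imp_cascade[OF ord, where p = p and j = j and ?u1.0 = 1 and \<beta> = 0]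
    by (simp add: power_mult_distrib sum_distrib_left sum_distrib_right left_diff_distrib right_diff_distrib mult_ac del: of_nat_Suc)
  from bigo_power_imp_zero[OF this] \<open>j < n\<close> show ?thesis by simp
qed

lemma has_order_imp_two_level:
  fixes A :: "'p::finite \<Rightarrow> 'q \<Rightarrow> 'q \<Rightarrow> real"
  assumes ord: "has_order Q (ark_step Q A b c) n" and "l + j + 2 \<le> n"
  shows "(\<Sum>q\<in>Q. b p q * (c q ^ j * (\<Sum>r\<in>Q. A p' q r * c r ^ l))) = 1 / real (Suc l) / real (l + j + 2)"
proof -
  \<comment> \<open>With \<open>\<alpha> = 0\<close> the innermost component stays at 1, and with
    the middle one starting at 0 exactly two nested quadratures remain.\<close>
  have "(\<lambda>H. ((\<Sum>q\<in>Q. b p q * (c q ^ j * (\<Sum>r\<in>Q. A p' q r * c r ^ l))) - 1 / real (Suc l) / real (l + j + 2)) * H ^ (l + j + 2))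
    \<in> O[at_right 0](\<lambda>H. H ^ Suc n)"
    using has_order_imp_cascade[OF ord, where p = p and p' = p' and j = j and l = l and ?u1.0 = 0 and ?u0.0 = 1 and \<beta> = 1 and \<alpha> = 0]
    by (simp add: power_mult_distrib power_add power2_eq_square sum_distrib_left sum_distrib_right left_diff_distrib right_diff_distrib mult_ac
        del: of_nat_Suc of_nat_add)
  from bigo_power_imp_zero[OF this assms(2)] show ?thesis by simp
qed

lemma has_order_imp_three_level:
  fixes A :: "'p::finite \<Rightarrow> 'q \<Rightarrow> 'q \<Rightarrow> real"
  assumes ord: "has_order Q (ark_step Q A b c) n" and "m + l + j + 3 \<le> n"
  shows "(\<Sum>q\<in>Q. b p q * (c q ^ j * (\<Sum>r\<in>Q. A p' q r * (c r ^ l * (\<Sum>v\<in>Q. A p'' r v * c v ^ m))))) =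
    1 / real (Suc m) / real (m + l + 2) / real (m + l + j + 3)"
proof -
  \<comment> \<open>All components start at 0, so the only power of \<open>H\<close> left comes from
    the threefold nesting.\<close>
  have "(\<lambda>H. ((\<Sum>q\<in>Q. b p q * (c q ^ j * (\<Sum>r\<in>Q. A p' q r * (c r ^ l * (\<Sum>v\<in>Q. A p'' r v * c v ^ m))))) -
      1 / real (Suc m) / real (m + l + 2) / real (m + l + j + 3)) * H ^ (m + l + j + 3)) \<in> O[at_right 0](\<lambda>H. H ^ Suc n)"
    using has_order_imp_cascade[OF ord, where p = p and p' = p' and p'' = p'' and j = j and l = l and m = m
        and ?u1.0 = 0 and ?u0.0 = 0 and \<beta> = 1 and \<alpha> = 1]
    by (simp add: power_mult_distrib power_add power2_eq_square power3_eq_cube sum_distrib_left sum_distrib_right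
        left_diff_distrib right_diff_distrib mult_ac del: of_nat_Suc of_nat_add)
  from bigo_power_imp_zero[OF this assms(2)] show ?thesis by simp
qed

lemma has_order_3_imp_conditions:
  fixes A :: "'p::finite \<Rightarrow> 'q \<Rightarrow> 'q \<Rightarrow> real"
  assumes "has_order Q (ark_step Q A b c) 3"
  shows "ark_conditions_3 Q A b c"
  using has_order_imp_quadrature[OF assms, of 0] has_order_imp_quadrature[OF assms, of 1]
    has_order_imp_quadrature[OF assms, of 2] has_order_imp_two_level[OF assms, of 1 0]
  by (simp add: ark_conditions_3_def)

lemma has_order_4_imp_conditions:
  fixes A :: "'p::finite \<Rightarrow> 'q \<Rightarrow> 'q \<Rightarrow> real"
  assumes "has_order Q (ark_step Q A b c) 4"
  shows "ark_conditions_4 Q A b c"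
  using has_order_imp_quadrature[OF assms, of 0] has_order_imp_quadrature[OF assms, of 1]
    has_order_imp_quadrature[OF assms, of 2] has_order_imp_quadrature[OF assms, of 3]
    has_order_imp_two_level[OF assms, of 1 0] has_order_imp_two_level[OF assms, of 1 1]
    has_order_imp_two_level[OF assms, of 2 0] has_order_imp_three_level[OF assms, of 1 0 0]
  by (simp add: ark_conditions_4_def ark_conditions_3_def)

theorem ark_has_order_4_iff:
  fixes A :: "'p::finite \<Rightarrow> 'q \<Rightarrow> 'q \<Rightarrow> real"
  assumes "\<And>p q. q \<in> Q \<Longrightarrow> (\<Sum>r\<in>Q. A p q r) = c q"
  shows "has_order Q (ark_step Q A b c) 4 \<longleftrightarrow> ark_conditions_4 Q A b c"
  using has_order_4_imp_conditions[of Q A b c] ark_has_order_4[of Q A c b, OF assms] by blast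

section \<open>The fully discrete scheme as an additive Runge--Kutta method\<close>

lemma rk_step_eq_ark_step: "rk_step s A b c = ark_step {1..s} (\<lambda>_. A) (\<lambda>_. b) c"
  by (intro ext) (auto simp: rk_step_def ark_step_def UNIV_unit)

lemma UNIV_slow: "(UNIV :: slow set) = {Impl, Expl}"
  using slow.exhaust by auto

lemma sum_UNIV_slow: "(\<Sum>\<sigma>\<in>(UNIV :: slow set). g \<sigma>) = g Impl + (g Expl :: real)"
  by (simp add: UNIV_slow)

lemma UNIV_part: "(UNIV :: part set) = insert Fast (range Slow)"
proof -
  have "x \<in> insert Fast (range Slow)" for x by (cases x) auto
  then show ?thesis by blast
qed

lemma sum_UNIV_part: "(\<Sum>p\<in>(UNIV :: part set). g p) = (\<Sum>\<sigma>\<in>UNIV. g (Slow \<sigma>)) + (g Fast :: real)"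
proof -
  have "inj Slow" by (auto intro: injI)
  then show ?thesis
    unfolding UNIV_part by (subst sum.insert) (auto simp: sum.reindex)
qed

lemma all_part: "(\<forall>p. P p) \<longleftrightarrow> (\<forall>\<sigma>. P (Slow \<sigma>)) \<and> P Fast"
  by (metis part.exhaust)

lemma imex_ark_step_eq_ark_step:
  assumes "1 \<le> s"
  shows "imex_ark_step s A c = ark_step {1..s} A (\<lambda>\<sigma>. A \<sigma> s) c"
proof (intro ext)
  fix d t H and f :: "slow split_rhs" and Y :: "nat \<Rightarrow> vec" and y0 y1 :: vec
  have "y0 k + H * (\<Sum>\<sigma>\<in>UNIV. \<Sum>j=1..s. A \<sigma> i j * f \<sigma> (t + c j * H) (Y j) k) =
    y0 k + H * (\<Sum>j=1..s. A Impl i j * f Impl (t + c j * H) (Y j) k)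
      + H * (\<Sum>j=1..s. A Expl i j * f Expl (t + c j * H) (Y j) k)" for i k
    by (simp add: sum_UNIV_slow distrib_left)
  with assms show "imex_ark_step s A c d f t H y0 Y y1 = ark_step {1..s} A (\<lambda>\<sigma>. A \<sigma> s) c d f t H y0 Y y1"
    unfolding imex_ark_step_def ark_step_def by auto
qed

section \<open>Sums over all stages and the matrices L, Delta C and E\<close>

lemma sum_mri_stages:
  "(\<Sum>r\<in>mri_stages s sF. g r) =
    (\<Sum>j=1..s. g (SlowStage j)) + (\<Sum>i=2..s. \<Sum>l=1..sF. g (FastStage i l) :: real)"
proof -
  have F: "{FastStage i p | i p. i \<in> {2..s} \<and> p \<in> {1..sF}} = (\<lambda>(i, p). FastStage i p) ` ({2..s} \<times> {1..sF})"
    by auto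
  have "(\<Sum>r\<in>mri_stages s sF. g r) = (\<Sum>r\<in>SlowStage ` {1..s}. g r) +
      (\<Sum>r\<in>(\<lambda>(i, p). FastStage i p) ` ({2..s} \<times> {1..sF}). g r)"
    unfolding mri_stages_def F by (rule sum.union_disjoint) auto
  also have "(\<Sum>r\<in>SlowStage ` {1..s}. g r) = (\<Sum>j=1..s. g (SlowStage j))"
    by (subst sum.reindex) (auto intro: inj_onI)
  also have "(\<Sum>r\<in>(\<lambda>(i, p). FastStage i p) ` ({2..s} \<times> {1..sF}). g r) = (\<Sum>i=2..s. \<Sum>l=1..sF. g (FastStage i l))"
    by (subst sum.reindex) (auto intro: inj_onI simp: sum.cartesian_product case_prod_beta)
  finally show ?thesis .
qed

lemma mat_vec_L:
  assumes "i \<in> {2..s}" shows "mat_vec s L_mat x i = x (i - 1)"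
proof -
  have "mat_vec s L_mat x i = (\<Sum>j=1..s. if j = i - 1 then x j else 0)"
    unfolding mat_vec_def using assms by (intro sum.cong) (auto simp: L_mat_def)
  also have "\<dots> = x (i - 1)"
    using assms by (subst sum.delta) auto
  finally show ?thesis .
qed

lemma mat_mul_L: "i \<in> {2..s} \<Longrightarrow> mat_mul s L_mat A i j = A (i - 1) j"
  using mat_vec_L[of i s "\<lambda>k. A k j"] by (simp add: mat_vec_def mat_mul_def)

lemma mat_vec_coupling_mat:
  assumes "i \<in> {2..s}"
  shows "mat_vec s (coupling_mat s kmax G w z \<sigma>) x i =
    w * mat_vec s (base_A s kmax G \<sigma>) x (i - 1) + (\<Sum>k=0..kmax. z k * mat_vec s (G \<sigma> k) x i)"
proof -
  have "(\<Sum>j=1..s. (\<Sum>k=0..kmax. z k * G \<sigma> k i j) * x j) = (\<Sum>k=0..kmax. z k * mat_vec s (G \<sigma> k) x i)"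
    unfolding mat_vec_def sum_distrib_left sum_distrib_right by (subst sum.swap) (simp add: mult.assoc)
  then show ?thesis
    by (simp add: mat_vec_def coupling_mat_def mat_mul_L[OF assms] distrib_right sum.distrib sum_distrib_left mult.assoc)
qed

lemma mat_vec_DeltaC:
  assumes "i \<le> s" shows "mat_vec s (DeltaC_mat c) x i = (\<Sum>j=1..i. increments c j * x j)"
proof -
  have "(\<Sum>j=1..i. increments c j * x j) = (\<Sum>j\<in>{1..i}. DeltaC_mat c i j * x j)" by (simp add: DeltaC_mat_def)
  also have "\<dots> = (\<Sum>j=1..s. DeltaC_mat c i j * x j)"
    using assms by (intro sum.mono_neutral_left) (auto simp: DeltaC_mat_def)
  finally show ?thesis by (simp add: mat_vec_def)
qed

lemma base_A_row:
  assumes "i \<le> s" shows "base_A s kmax G \<sigma> i j = (\<Sum>k=1..i. mean_coeff kmax (G \<sigma>) k j)"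
proof -
  have "(\<Sum>k=1..i. mean_coeff kmax (G \<sigma>) k j) = (\<Sum>k\<in>{1..i}. E_mat i k * mean_coeff kmax (G \<sigma>) k j)"
    by (simp add: E_mat_def)
  also have "\<dots> = (\<Sum>k=1..s. E_mat i k * mean_coeff kmax (G \<sigma>) k j)"
    using assms by (intro sum.mono_neutral_left) (auto simp: E_mat_def)
  finally show ?thesis by (simp add: base_A_def mat_mul_def)
qed

lemma base_A_diff:
  assumes "i \<in> {2..s}"
  shows "base_A s kmax G \<sigma> i j = base_A s kmax G \<sigma> (i - 1) j + mean_coeff kmax (G \<sigma>) i j"
proof -
  obtain n where "i = Suc n" "1 \<le> n" using assms by (cases i) auto
  with assms show ?thesis by (simp add: base_A_row)
qed

text \<open>Every stage receives increments from all partitions, but slow right-hand sides are evaluated only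
  at slow stages and fast ones only at fast stages; hence the zero blocks.\<close>

fun mri_A :: "nat \<Rightarrow> nat \<Rightarrow> vec \<Rightarrow> slow_coeffs \<Rightarrow> nat \<Rightarrow> matr \<Rightarrow> vec \<Rightarrow> vec \<Rightarrow> part \<Rightarrow> stage \<Rightarrow> stage \<Rightarrow> real" where
  "mri_A s kmax c G sF AF bF cF (Slow \<sigma>) (SlowStage i) (SlowStage j) = base_A s kmax G \<sigma> i j"
| "mri_A s kmax c G sF AF bF cF (Slow \<sigma>) (FastStage i p) (SlowStage j) =
     base_A s kmax G \<sigma> (i - 1) j + (\<Sum>l=1..sF. AF p l * coeff_poly kmax (G \<sigma>) i j (cF l))"
| "mri_A s kmax c G sF AF bF cF (Slow \<sigma>) q (FastStage i l) = 0"
| "mri_A s kmax c G sF AF bF cF Fast q (SlowStage j) = 0"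
| "mri_A s kmax c G sF AF bF cF Fast (SlowStage i) (FastStage i' l) =
     (if i' \<le> i then increments c i' * bF l else 0)"
| "mri_A s kmax c G sF AF bF cF Fast (FastStage i p) (FastStage i' l) =
     (if i' < i then increments c i' * bF l else if i' = i then increments c i * AF p l else 0)"

fun mri_c :: "vec \<Rightarrow> vec \<Rightarrow> stage \<Rightarrow> real" where
  "mri_c c cF (SlowStage i) = c i"
| "mri_c c cF (FastStage i p) = c (i - 1) + cF p * increments c i"

locale mri_method =
  fixes s kmax sF :: nat and c :: vec and G :: slow_coeffs and AF :: matr and bF cF :: vec
  assumes data: "mri_gark_data s kmax c G"
    and fast_consistent: "\<And>p. p \<in> {1..sF} \<Longrightarrow> mat_vec sF AF ones p = cF p"
    and fast_conditions: "ark_conditions_4 {1..sF} (\<lambda>_ :: unit. AF) (\<lambda>_. bF) cF"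
    and fast_quadrature: "\<And>k. k \<le> kmax \<Longrightarrow> dot sF bF (had_pow cF k) = 1 / (real k + 1)"
    and base_consistent: "base_internally_consistent s kmax c G"
    and consistent: "mri_internally_consistent s kmax c G"
begin

abbreviation "\<Delta>c \<equiv> increments c"
abbreviation "A \<equiv> base_A s kmax G"
abbreviation "b \<equiv> base_b s kmax G"
abbreviation "Q \<equiv> mri_stages s sF"
abbreviation "MA \<equiv> mri_A s kmax c G sF AF bF cF"
abbreviation "Mb \<equiv> \<lambda>p. MA p (SlowStage s)"
abbreviation "Mc \<equiv> mri_c c cF"

lemma s_ge_1: "1 \<le> s" and c_1: "c 1 = 0"
  using data by (auto simp: mri_gark_data_def)

lemma increment_1: "\<Delta>c (Suc 0) = 0" by (simp add: increments_def)

lemma c_pred: "i \<in> {2..s} \<Longrightarrow> c i = c (i - 1) + \<Delta>c i"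
  by (auto simp: increments_def)

lemma base_A_first_row: "j \<in> {1..s} \<Longrightarrow> A \<sigma> (Suc 0) j = 0"
  using data s_ge_1 by (auto simp: base_A_row mean_coeff_def mri_gark_data_def)

lemma sum_from_2: "(\<Sum>i=2..s. \<Delta>c i * g i) = (\<Sum>i=1..s. \<Delta>c i * g i)"
proof -
  have "{1..s} = insert 1 {2..s}" using s_ge_1 by auto
  then show ?thesis by (simp add: increment_1)
qed

text \<open>The elementary weight of a tree is obtained by nesting these actions along its inner
  vertices and evaluating at the last slow stage.\<close>

definition act :: "part \<Rightarrow> (stage \<Rightarrow> real) \<Rightarrow> stage \<Rightarrow> real" where
  "act p x q = (\<Sum>r\<in>Q. MA p q r * x r)"

definition fast_mean :: "(stage \<Rightarrow> real) \<Rightarrow> nat \<Rightarrow> real" where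
  "fast_mean x i = (\<Sum>m=1..sF. bF m * x (FastStage i m))"

text \<open>A slow stage is reached through completed fast steps only, each with the weights
  \<open>bF\<close> scaled by the length of its slow interval.\<close>

lemma act_fast_slow:
  assumes "i \<le> s"
  shows "act Fast x (SlowStage i) = (\<Sum>i'=2..i. \<Delta>c i' * fast_mean x i')"
proof -
  have "act Fast x (SlowStage i) = (\<Sum>i'\<in>{2..s}. if i' \<le> i then \<Delta>c i' * fast_mean x i' else 0)"
    unfolding act_def sum_mri_stages fast_mean_def by (auto simp: sum_distrib_left mult.assoc intro!: sum.cong)
  also have "\<dots> = (\<Sum>i'\<in>{2..i}. if i' \<le> i then \<Delta>c i' * fast_mean x i' else 0)"
    using assms by (intro sum.mono_neutral_right) auto
  finally show ?thesis by simp
qed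

text \<open>A fast stage adds to the preceding slow stage the unfinished step described by its row
  of \<open>AF\<close>.\<close>

lemma act_fast_fast:
  assumes i: "i \<in> {2..s}"
  shows "act Fast x (FastStage i m) = act Fast x (SlowStage (i - 1)) + \<Delta>c i * (\<Sum>l=1..sF. AF m l * x (FastStage i l))"
proof -
  have "act Fast x (FastStage i m) = (\<Sum>i'\<in>{2..s}. if i' < i then \<Delta>c i' * fast_mean x i'
      else if i' = i then \<Delta>c i * (\<Sum>l=1..sF. AF m l * x (FastStage i l)) else 0)"
    unfolding act_def sum_mri_stages fast_mean_def by (auto simp: sum_distrib_left mult.assoc intro!: sum.cong)
  also have "\<dots> = (\<Sum>i'\<in>insert i {2..i - 1}. if i' < i then \<Delta>c i' * fast_mean x i'
      else if i' = i then \<Delta>c i * (\<Sum>l=1..sF. AF m l * x (FastStage i l)) else 0)"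
    using i by (intro sum.mono_neutral_right) auto
  also have "\<dots> = (\<Sum>i'=2..i - 1. \<Delta>c i' * fast_mean x i') + \<Delta>c i * (\<Sum>l=1..sF. AF m l * x (FastStage i l))"
    using i by (subst sum.insert) (auto intro!: sum.cong)
  finally show ?thesis using i by (subst act_fast_slow) auto
qed

text \<open>Every slow stage starts from its predecessor; unrolling this recursion down to
  \<open>y0\<close> sums the increments. Averaging the coefficient polynomials with
  \<open>bF\<close> replaces \<open>cF ^ k\<close> by 1/(k+1), by the quadrature assumption, so the
  accumulated slow rows are those of the base method. The weights are the last slow row.\<close>

lemma mri_step_eq_ark_step: "mri_step s kmax c G sF AF bF cF = ark_step Q MA Mb Mc"
proof (intro ext)
  fix d t H and f :: "part split_rhs" and y0 y1 :: vec and Y :: "stage \<Rightarrow> vec"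
  define fS where "fS \<sigma> j = f (Slow \<sigma>) (t + c j * H) (Y (SlowStage j))" for \<sigma> j
  define fF where "fF i l = f Fast (t + c (i - 1) * H + cF l * \<Delta>c i * H) (Y (FastStage i l))" for i l
  define rhs where "rhs i l k = \<Delta>c i * fF i l k
      + (\<Sum>j=1..i. coeff_poly kmax (G Impl) i j (cF l) * fS Impl j k)
      + (\<Sum>j=1..i - 1. coeff_poly kmax (G Expl) i j (cF l) * fS Expl j k)" for i l k
  \<comment> \<open>The increment from \<open>y0\<close> to slow stage \<open>i\<close>, without the
    factor \<open>H\<close>.\<close>
  define Z where "Z i k = (\<Sum>\<sigma>\<in>UNIV. \<Sum>j=1..s. A \<sigma> i j * fS \<sigma> j k) + (\<Sum>i'=2..i. \<Delta>c i' * (\<Sum>l=1..sF. bF l * fF i' l k))" for i k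
  \<comment> \<open>The triangular shapes of the two coefficient families extend both slow sums to
    all stages, so that the slow partitions can be treated uniformly.\<close>
  have rhs: "rhs i l k = \<Delta>c i * fF i l k + (\<Sum>\<sigma>\<in>UNIV. \<Sum>j=1..s. coeff_poly kmax (G \<sigma>) i j (cF l) * fS \<sigma> j k)"
    if i: "i \<in> {2..s}" for i l k
  proof -
    have "coeff_poly kmax (G Impl) i j (cF l) = 0" if "j \<in> {1..s} - {1..i}" for j
      using that i data by (auto simp: coeff_poly_def mri_gark_data_def intro!: sum.neutral)
    then have "(\<Sum>j=1..i. coeff_poly kmax (G Impl) i j (cF l) * fS Impl j k) = (\<Sum>j=1..s. coeff_poly kmax (G Impl) i j (cF l) * fS Impl j k)"
      using i by (intro sum.mono_neutral_left) auto
    moreover have "coeff_poly kmax (G Expl) i j (cF l) = 0" if "j \<in> {1..s} - {1..i - 1}" for j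
      using that i data by (auto simp: coeff_poly_def mri_gark_data_def intro!: sum.neutral)
    then have "(\<Sum>j=1..i - 1. coeff_poly kmax (G Expl) i j (cF l) * fS Expl j k) = (\<Sum>j=1..s. coeff_poly kmax (G Expl) i j (cF l) * fS Expl j k)"
      using i by (intro sum.mono_neutral_left) auto
    ultimately show ?thesis by (simp add: rhs_def sum_UNIV_slow)
  qed
  have rhs_sum: "(\<Sum>l=1..sF. w l * rhs i l k) = \<Delta>c i * (\<Sum>l=1..sF. w l * fF i l k) +
      (\<Sum>\<sigma>\<in>UNIV. \<Sum>j=1..s. (\<Sum>l=1..sF. w l * coeff_poly kmax (G \<sigma>) i j (cF l)) * fS \<sigma> j k)"
    if "i \<in> {2..s}" for w i k
  proof -
    have "(\<Sum>l=1..sF. w l * (\<Sum>j=1..s. coeff_poly kmax (G \<sigma>) i j (cF l) * fS \<sigma> j k)) =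
      (\<Sum>j=1..s. (\<Sum>l=1..sF. w l * coeff_poly kmax (G \<sigma>) i j (cF l)) * fS \<sigma> j k)" for \<sigma>
      unfolding sum_distrib_left sum_distrib_right by (subst sum.swap) (simp add: mult.assoc)
    then show ?thesis
      by (simp add: rhs[OF that] sum_UNIV_slow distrib_left sum.distrib sum_distrib_left mult_ac)
  qed
  have mean: "(\<Sum>l=1..sF. bF l * coeff_poly kmax (G \<sigma>) i j (cF l)) = mean_coeff kmax (G \<sigma>) i j" for \<sigma> i j
  proof -
    have "(\<Sum>l=1..sF. bF l * coeff_poly kmax (G \<sigma>) i j (cF l)) = (\<Sum>k=0..kmax. G \<sigma> k i j * dot sF bF (had_pow cF k))"
      unfolding coeff_poly_def dot_def had_pow_def sum_distrib_left by (subst sum.swap) (simp add: mult_ac)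
    also have "\<dots> = mean_coeff kmax (G \<sigma>) i j"
      unfolding mean_coeff_def by (intro sum.cong refl) (simp add: fast_quadrature)
    finally show ?thesis .
  qed
  have Z1: "Z 1 k = 0" for k
    using base_A_first_row by (simp add: Z_def)
  have Z_Suc: "Z i k = Z (i - 1) k + (\<Sum>l=1..sF. bF l * rhs i l k)" if i: "i \<in> {2..s}" for i k
  proof -
    have "{2..i} = insert i {2..i - 1}" using i by auto
    then have "(\<Sum>i'=2..i. \<Delta>c i' * (\<Sum>l=1..sF. bF l * fF i' l k)) =
      (\<Sum>i'=2..i - 1. \<Delta>c i' * (\<Sum>l=1..sF. bF l * fF i' l k)) + \<Delta>c i * (\<Sum>l=1..sF. bF l * fF i l k)"
      using i by (subst \<open>{2..i} = _\<close>, subst sum.insert) auto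
    then show ?thesis
      unfolding rhs_sum[OF i] mean Z_def
      by (simp add: base_A_diff[OF i] distrib_right sum.distrib)
  qed
  have ark: "(\<Sum>p\<in>UNIV. \<Sum>r\<in>Q. MA p q r * f p (t + Mc r * H) (Y r) k) =
     (\<Sum>\<sigma>\<in>UNIV. \<Sum>j=1..s. MA (Slow \<sigma>) q (SlowStage j) * fS \<sigma> j k) +
     act Fast (\<lambda>r. f Fast (t + Mc r * H) (Y r) k) q" for q k
    by (simp add: sum_UNIV_part sum_mri_stages fS_def act_def)
  have slow: "(\<Sum>p\<in>UNIV. \<Sum>r\<in>Q. MA p (SlowStage i) r * f p (t + Mc r * H) (Y r) k) = Z i k" if "i \<in> {1..s}" for i k
    using that by (subst ark, subst act_fast_slow) (auto simp: Z_def fast_mean_def fF_def distrib_right add.assoc)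
  have fast: "(\<Sum>p\<in>UNIV. \<Sum>r\<in>Q. MA p (FastStage i m) r * f p (t + Mc r * H) (Y r) k) =
      Z (i - 1) k + (\<Sum>l=1..sF. AF m l * rhs i l k)" if i: "i \<in> {2..s}" for i m k
  proof -
    have "act Fast x (SlowStage (i - 1)) = (\<Sum>i'=2..i - 1. \<Delta>c i' * fast_mean x i')" for x
      using i by (intro act_fast_slow) auto
    then show ?thesis
      unfolding ark act_fast_fast[OF i] Z_def rhs_sum[OF i]
      by (simp add: distrib_right sum.distrib fast_mean_def fF_def add.assoc)
  qed
  have mem: "(\<forall>q\<in>Q. P q) \<longleftrightarrow> (\<forall>i\<in>{1..s}. P (SlowStage i)) \<and> (\<forall>i\<in>{2..s}. \<forall>p\<in>{1..sF}. P (FastStage i p))" for P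
    unfolding mri_stages_def by blast
  have "mri_step s kmax c G sF AF bF cF d f t H y0 Y y1 \<longleftrightarrow> (\<forall>k<d. Y (SlowStage 1) k = y0 k \<and>
      (\<forall>i\<in>{2..s}. (\<forall>p\<in>{1..sF}. Y (FastStage i p) k = Y (SlowStage (i - 1)) k + H * (\<Sum>l=1..sF. AF p l * rhs i l k)) \<and>
         Y (SlowStage i) k = Y (SlowStage (i - 1)) k + H * (\<Sum>l=1..sF. bF l * rhs i l k)) \<and>
      y1 k = Y (SlowStage s) k)"
    unfolding mri_step_def Let_def rhs_def fS_def fF_def ..
  also have "\<dots> \<longleftrightarrow> (\<forall>k<d. ((\<forall>i\<in>{1..s}. Y (SlowStage i) k = y0 k + H * Z i k) \<and>
      (\<forall>i\<in>{2..s}. \<forall>p\<in>{1..sF}. Y (FastStage i p) k = y0 k + H * (Z (i - 1) k + (\<Sum>l=1..sF. AF p l * rhs i l k)))) \<and>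
      y1 k = y0 k + H * Z s k)"
  proof (intro all_cong iffI)
    fix k
    assume *: "Y (SlowStage 1) k = y0 k \<and>
      (\<forall>i\<in>{2..s}. (\<forall>p\<in>{1..sF}. Y (FastStage i p) k = Y (SlowStage (i - 1)) k + H * (\<Sum>l=1..sF. AF p l * rhs i l k)) \<and>
         Y (SlowStage i) k = Y (SlowStage (i - 1)) k + H * (\<Sum>l=1..sF. bF l * rhs i l k)) \<and>
      y1 k = Y (SlowStage s) k"
    have Y: "Y (SlowStage i) k = y0 k + H * Z i k" if "1 \<le> i" "i \<le> s" for i
      using that
    proof (induction i rule: dec_induct)
      case base
      then show ?case using * Z1 by simp
    next
      case (step n)
      then have "Suc n \<in> {2..s}" by simp
      with step * Z_Suc[OF this] show ?case by (simp add: distrib_left)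
    qed
    show "((\<forall>i\<in>{1..s}. Y (SlowStage i) k = y0 k + H * Z i k) \<and>
      (\<forall>i\<in>{2..s}. \<forall>p\<in>{1..sF}. Y (FastStage i p) k = y0 k + H * (Z (i - 1) k + (\<Sum>l=1..sF. AF p l * rhs i l k)))) \<and>
      y1 k = y0 k + H * Z s k"
      using * Y s_ge_1 by (auto simp: distrib_left)
  next
    fix k
    assume *: "((\<forall>i\<in>{1..s}. Y (SlowStage i) k = y0 k + H * Z i k) \<and>
      (\<forall>i\<in>{2..s}. \<forall>p\<in>{1..sF}. Y (FastStage i p) k = y0 k + H * (Z (i - 1) k + (\<Sum>l=1..sF. AF p l * rhs i l k)))) \<and>
      y1 k = y0 k + H * Z s k"
    then have Y: "Y (SlowStage i) k = y0 k + H * Z i k" if "1 \<le> i" "i \<le> s" for i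
      using that by auto
    show "Y (SlowStage 1) k = y0 k \<and>
      (\<forall>i\<in>{2..s}. (\<forall>p\<in>{1..sF}. Y (FastStage i p) k = Y (SlowStage (i - 1)) k + H * (\<Sum>l=1..sF. AF p l * rhs i l k)) \<and>
         Y (SlowStage i) k = Y (SlowStage (i - 1)) k + H * (\<Sum>l=1..sF. bF l * rhs i l k)) \<and>
      y1 k = Y (SlowStage s) k"
      using * Y s_ge_1 Z1 Z_Suc by (auto simp: distrib_left)
  qed
  also have "\<dots> \<longleftrightarrow> ark_step Q MA Mb Mc d f t H y0 Y y1"
    unfolding ark_step_def mem using slow fast s_ge_1 by simp
  finally show "mri_step s kmax c G sF AF bF cF d f t H y0 Y y1 = ark_step Q MA Mb Mc d f t H y0 Y y1" .
qed

end

section \<open>The order conditions of the fully discrete scheme\<close>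

lemma sum_telescope:
  fixes g h :: "nat \<Rightarrow> real"
  assumes "1 \<le> n" "\<And>i. i \<in> {2..n} \<Longrightarrow> h i = g i - g (i - 1)"
  shows "(\<Sum>i=2..n. h i) = g n - g 1"
  using assms
proof (induction n rule: dec_induct)
  case (step n)
  then have "{2..Suc n} = insert (Suc n) {2..n}" by auto
  with step show ?case by simp
qed simp

lemma mat_vec_cong: "(\<And>j. j \<in> {1..s} \<Longrightarrow> x j = y j) \<Longrightarrow> mat_vec s A x i = mat_vec s A y i"
  unfolding mat_vec_def by (intro sum.cong) auto

lemma mat_vec_divide: "mat_vec s A (\<lambda>j. x j / a) i = mat_vec s A x i / a"
  by (simp add: mat_vec_def sum_divide_distrib)

context mri_method
begin

lemma act_slow_slow: "act (Slow \<sigma>) x (SlowStage i) = mat_vec s (A \<sigma>) (\<lambda>j. x (SlowStage j)) i"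
  by (simp add: act_def sum_mri_stages mat_vec_def)

text \<open>The numbers zeta, beta and xi are the sums of these moments with the weights bF, bF x cF
  and the transpose of AF applied to bF.\<close>

definition fast_moment :: "nat \<Rightarrow> nat \<Rightarrow> real" where
  "fast_moment k m = mat_vec sF AF (had_pow cF k) m"

lemma act_slow_fast:
  "act (Slow \<sigma>) x (FastStage i m) = mat_vec s (A \<sigma>) (\<lambda>j. x (SlowStage j)) (i - 1)
    + (\<Sum>k=0..kmax. fast_moment k m * mat_vec s (G \<sigma> k) (\<lambda>j. x (SlowStage j)) i)"
proof -
  have "(\<Sum>l=1..sF. AF m l * coeff_poly kmax (G \<sigma>) i j (cF l)) = (\<Sum>k=0..kmax. fast_moment k m * G \<sigma> k i j)" for j
    unfolding coeff_poly_def fast_moment_def mat_vec_def had_pow_def sum_distrib_left sum_distrib_right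
    by (subst sum.swap) (simp add: mult_ac)
  then have "act (Slow \<sigma>) x (FastStage i m) = mat_vec s (A \<sigma>) (\<lambda>j. x (SlowStage j)) (i - 1)
    + (\<Sum>j=1..s. (\<Sum>k=0..kmax. fast_moment k m * G \<sigma> k i j) * x (SlowStage j))"
    by (simp add: act_def sum_mri_stages mat_vec_def distrib_right sum.distrib)
  also have "(\<Sum>j=1..s. (\<Sum>k=0..kmax. fast_moment k m * G \<sigma> k i j) * x (SlowStage j)) =
      (\<Sum>k=0..kmax. fast_moment k m * mat_vec s (G \<sigma> k) (\<lambda>j. x (SlowStage j)) i)"
    unfolding mat_vec_def sum_distrib_left sum_distrib_right by (subst sum.swap) (simp add: mult_ac)
  finally show ?thesis .
qed

section \<open>Elementary weights of the fast method and purely fast conditions\<close>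

definition a1 :: "nat \<Rightarrow> real" where "a1 m = (\<Sum>l=1..sF. AF m l * cF l)"
definition a2 :: "nat \<Rightarrow> real" where "a2 m = (\<Sum>l=1..sF. AF m l * cF l ^ 2)"
definition a11 :: "nat \<Rightarrow> real" where "a11 m = (\<Sum>l=1..sF. AF m l * a1 l)"

lemma fast_weights:
  "(\<Sum>m=1..sF. bF m) = 1" "(\<Sum>m=1..sF. bF m * cF m) = 1/2" "(\<Sum>m=1..sF. bF m * cF m ^ 2) = 1/3"
  "(\<Sum>m=1..sF. bF m * cF m ^ 3) = 1/4" "(\<Sum>m=1..sF. bF m * a1 m) = 1/6"
  "(\<Sum>m=1..sF. bF m * (cF m * a1 m)) = 1/8" "(\<Sum>m=1..sF. bF m * a2 m) = 1/12"
  "(\<Sum>m=1..sF. bF m * a11 m) = 1/24"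
  using fast_conditions unfolding ark_conditions_4_def ark_conditions_3_def a1_def a2_def a11_def by blast+

lemma AF_row_sum: "m \<in> {1..sF} \<Longrightarrow> (\<Sum>l=1..sF. AF m l) = cF m"
  using fast_consistent[of m] by (simp add: mat_vec_def ones_def)

text \<open>The eight functions belong to the rooted trees with at most four vertices, and order
  four of the fast method prescribes their means. The purely fast stage functions averaged below are
  combinations of them on each slow interval.\<close>

lemma fast_mean_polynomial:
  assumes "\<And>m. m \<in> {1..sF} \<Longrightarrow> x (FastStage i m) = e0 + e1 * cF m + e2 * cF m ^ 2 + e3 * cF m ^ 3
    + e4 * a1 m + e5 * (cF m * a1 m) + e6 * a2 m + e7 * a11 m"
  shows "fast_mean x i = e0 + e1 / 2 + e2 / 3 + e3 / 4 + e4 / 6 + e5 / 8 + e6 / 12 + e7 / 24"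
proof -
  have "fast_mean x i = (\<Sum>m=1..sF. e0 * bF m + e1 * (bF m * cF m) + e2 * (bF m * cF m ^ 2) + e3 * (bF m * cF m ^ 3)
    + e4 * (bF m * a1 m) + e5 * (bF m * (cF m * a1 m)) + e6 * (bF m * a2 m) + e7 * (bF m * a11 m))"
    unfolding fast_mean_def by (intro sum.cong) (simp_all add: assms algebra_simps)
  also have "\<dots> = e0 * 1 + e1 * (1/2) + e2 * (1/3) + e3 * (1/4) + e4 * (1/6) + e5 * (1/8) + e6 * (1/12) + e7 * (1/24)"
    by (simp only: sum.distrib sum_distrib_left[symmetric] fast_weights)
  finally show ?thesis by simp
qed

lemma AF_polynomial:
  assumes "m \<in> {1..sF}" "\<And>l. l \<in> {1..sF} \<Longrightarrow> x (FastStage i l) = e0 + e1 * cF l + e2 * cF l ^ 2 + e4 * a1 l"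
  shows "(\<Sum>l=1..sF. AF m l * x (FastStage i l)) = e0 * cF m + e1 * a1 m + e2 * a2 m + e4 * a11 m"
proof -
  have "(\<Sum>l=1..sF. AF m l * x (FastStage i l)) = (\<Sum>l=1..sF. e0 * AF m l + e1 * (AF m l * cF l)
      + e2 * (AF m l * cF l ^ 2) + e4 * (AF m l * a1 l))"
    by (intro sum.cong) (simp_all add: assms algebra_simps)
  then show ?thesis
    by (simp only: sum.distrib sum_distrib_left[symmetric] AF_row_sum[OF assms(1)] a1_def[symmetric] a2_def[symmetric] a11_def[symmetric])
qed

text \<open>On each slow interval the fast method reproduces the exact integral, a difference of
  powers of consecutive slow nodes. The lower end contributes nothing because \<open>c 1 = 0\<close>
  and \<open>0 < n\<close>.\<close>

lemma act_fast_slow_telescope: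
  assumes "\<And>i. i \<in> {2..s} \<Longrightarrow> fast_mean x i = e i" "\<And>i. i \<in> {2..s} \<Longrightarrow> \<Delta>c i * e i = (c i ^ n - c (i - 1) ^ n) / w"
    and "0 < n" "i \<in> {1..s}"
  shows "act Fast x (SlowStage i) = c i ^ n / w"
proof -
  have "act Fast x (SlowStage i) = (\<Sum>i'=2..i. \<Delta>c i' * fast_mean x i')"
    using assms(4) by (intro act_fast_slow) simp
  also have "\<dots> = c i ^ n / w - c 1 ^ n / w"
    using assms by (intro sum_telescope) (auto simp: diff_divide_distrib)
  finally show ?thesis using c_1 assms(3) by simp
qed

lemma act_fast_one: "i \<in> {1..s} \<Longrightarrow> act Fast (\<lambda>_. 1) (SlowStage i) = c i"
  using act_fast_slow_telescope[of "\<lambda>_. 1" "\<lambda>_. 1" 1 1 i] fast_weights(1)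
  by (simp add: fast_mean_def c_pred)

lemma act_fast_c:
  assumes "i \<in> {1..s}" shows "act Fast Mc (SlowStage i) = c i ^ 2 / 2"
proof (rule act_fast_slow_telescope)
  show "fast_mean Mc i = c (i - 1) + \<Delta>c i / 2" for i
    using fast_mean_polynomial[of Mc i "c (i - 1)" "\<Delta>c i" 0 0 0 0 0 0] by (simp add: mult.commute)
qed (use assms in \<open>simp_all add: c_pred field_simps power2_eq_square\<close>)

lemma act_fast_c2:
  assumes "i \<in> {1..s}" shows "act Fast (\<lambda>r. Mc r ^ 2) (SlowStage i) = c i ^ 3 / 3"
proof (rule act_fast_slow_telescope)
  show "fast_mean (\<lambda>r. Mc r ^ 2) i = c (i - 1) ^ 2 + 2 * c (i - 1) * \<Delta>c i / 2 + \<Delta>c i ^ 2 / 3" for i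
    using fast_mean_polynomial[of "\<lambda>r. Mc r ^ 2" i "c (i - 1) ^ 2" "2 * c (i - 1) * \<Delta>c i" "\<Delta>c i ^ 2" 0 0 0 0 0]
    by (simp add: power2_eq_square algebra_simps)
qed (use assms in \<open>simp_all add: c_pred field_simps power2_eq_square power3_eq_cube\<close>)

lemma act_fast_c3:
  assumes "i \<in> {1..s}" shows "act Fast (\<lambda>r. Mc r ^ 3) (SlowStage i) = c i ^ 4 / 4"
proof (rule act_fast_slow_telescope)
  show "fast_mean (\<lambda>r. Mc r ^ 3) i = c (i - 1) ^ 3 + 3 * c (i - 1) ^ 2 * \<Delta>c i / 2 + 3 * c (i - 1) * \<Delta>c i ^ 2 / 3 + \<Delta>c i ^ 3 / 4" for i
    using fast_mean_polynomial[of "\<lambda>r. Mc r ^ 3" i "c (i - 1) ^ 3" "3 * c (i - 1) ^ 2 * \<Delta>c i" "3 * c (i - 1) * \<Delta>c i ^ 2" "\<Delta>c i ^ 3" 0 0 0 0]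
    by (simp add: power2_eq_square power3_eq_cube algebra_simps)
qed (use assms in \<open>simp_all add: c_pred field_simps power2_eq_square power3_eq_cube power4_eq_xxxx\<close>)

lemma act_fast_c_fast:
  assumes "i \<in> {2..s}" "m \<in> {1..sF}"
  shows "act Fast Mc (FastStage i m) = c (i - 1) ^ 2 / 2 + \<Delta>c i * c (i - 1) * cF m + \<Delta>c i ^ 2 * a1 m"
proof -
  have "(\<Sum>l=1..sF. AF m l * Mc (FastStage i l)) = c (i - 1) * cF m + \<Delta>c i * a1 m"
    using AF_polynomial[of m Mc i "c (i - 1)" "\<Delta>c i" 0 0] assms(2) by (simp add: mult.commute)
  moreover have "act Fast Mc (SlowStage (i - 1)) = c (i - 1) ^ 2 / 2"
    using assms(1) by (intro act_fast_c) auto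
  ultimately show ?thesis
    unfolding act_fast_fast[OF assms(1)] by (simp only:) (simp add: power2_eq_square algebra_simps)
qed

lemma act_fast_c2_fast:
  assumes "i \<in> {2..s}" "m \<in> {1..sF}"
  shows "act Fast (\<lambda>r. Mc r ^ 2) (FastStage i m) = c (i - 1) ^ 3 / 3 + \<Delta>c i * c (i - 1) ^ 2 * cF m
    + 2 * c (i - 1) * \<Delta>c i ^ 2 * a1 m + \<Delta>c i ^ 3 * a2 m"
proof -
  have "(\<Sum>l=1..sF. AF m l * Mc (FastStage i l) ^ 2) = c (i - 1) ^ 2 * cF m + 2 * c (i - 1) * \<Delta>c i * a1 m + \<Delta>c i ^ 2 * a2 m"
    using AF_polynomial[of m "\<lambda>r. Mc r ^ 2" i "c (i - 1) ^ 2" "2 * c (i - 1) * \<Delta>c i" "\<Delta>c i ^ 2" 0] assms(2)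
    by (simp add: power2_eq_square algebra_simps)
  moreover have "act Fast (\<lambda>r. Mc r ^ 2) (SlowStage (i - 1)) = c (i - 1) ^ 3 / 3"
    using assms(1) by (intro act_fast_c2) auto
  ultimately show ?thesis
    unfolding act_fast_fast[OF assms(1)] by (simp only:) (simp add: power2_eq_square power3_eq_cube algebra_simps)
qed

lemma act_fast_fast_c:
  assumes "i \<in> {1..s}" shows "act Fast (act Fast Mc) (SlowStage i) = c i ^ 3 / 6"
proof (rule act_fast_slow_telescope)
  show "fast_mean (act Fast Mc) i = c (i - 1) ^ 2 / 2 + \<Delta>c i * c (i - 1) / 2 + \<Delta>c i ^ 2 / 6" if "i \<in> {2..s}" for i
    using fast_mean_polynomial[of "act Fast Mc" i "c (i - 1) ^ 2 / 2" "\<Delta>c i * c (i - 1)" 0 0 "\<Delta>c i ^ 2" 0 0 0] act_fast_c_fast[OF that] by simp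
qed (use assms in \<open>simp_all add: c_pred field_simps power2_eq_square power3_eq_cube\<close>)

lemma act_fast_c_fast_c:
  assumes "i \<in> {1..s}" shows "act Fast (\<lambda>r. Mc r * act Fast Mc r) (SlowStage i) = c i ^ 4 / 8"
proof (rule act_fast_slow_telescope)
  fix i assume i: "i \<in> {2..s}"
  let ?u = "c (i - 1)" and ?d = "\<Delta>c i"
  \<comment> \<open>The product of \<open>?u + ?d * cF m\<close> with the expansion of the inner
    action; the zero terms complete the list of eight functions.\<close>
  have "Mc (FastStage i m) * act Fast Mc (FastStage i m) = ?u ^ 3 / 2 + 3 / 2 * ?u ^ 2 * ?d * cF m + ?u * ?d ^ 2 * cF m ^ 2
      + 0 * cF m ^ 3 + ?u * ?d ^ 2 * a1 m + ?d ^ 3 * (cF m * a1 m) + 0 * a2 m + 0 * a11 m" if "m \<in> {1..sF}" for m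
    by (simp add: act_fast_c_fast[OF i that] field_simps power2_eq_square power3_eq_cube)
  from fast_mean_polynomial[of "\<lambda>r. Mc r * act Fast Mc r", OF this]
  show "fast_mean (\<lambda>r. Mc r * act Fast Mc r) i = ?u ^ 3 / 2 + (3 / 2 * ?u ^ 2 * ?d) / 2 + (?u * ?d ^ 2) / 3 + (?u * ?d ^ 2) / 6 + ?d ^ 3 / 8"
    by simp
qed (use assms in \<open>simp_all add: c_pred field_simps power2_eq_square power3_eq_cube power4_eq_xxxx\<close>)

lemma act_fast_fast_c2:
  assumes "i \<in> {1..s}" shows "act Fast (act Fast (\<lambda>r. Mc r ^ 2)) (SlowStage i) = c i ^ 4 / 12"
proof (rule act_fast_slow_telescope)
  fix i assume i: "i \<in> {2..s}"
  let ?u = "c (i - 1)" and ?d = "\<Delta>c i"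
  show "fast_mean (act Fast (\<lambda>r. Mc r ^ 2)) i = ?u ^ 3 / 3 + (?d * ?u ^ 2) / 2 + (2 * ?u * ?d ^ 2) / 6 + ?d ^ 3 / 12"
    using fast_mean_polynomial[of "act Fast (\<lambda>r. Mc r ^ 2)" i "?u ^ 3 / 3" "?d * ?u ^ 2" 0 0 "2 * ?u * ?d ^ 2" 0 "?d ^ 3" 0]
      act_fast_c2_fast[OF i] by simp
qed (use assms in \<open>simp_all add: c_pred field_simps power2_eq_square power3_eq_cube power4_eq_xxxx\<close>)

lemma act_fast_fast_fast_c:
  assumes "i \<in> {1..s}" shows "act Fast (act Fast (act Fast Mc)) (SlowStage i) = c i ^ 4 / 24"
proof (rule act_fast_slow_telescope)
  fix i assume i: "i \<in> {2..s}"
  let ?u = "c (i - 1)" and ?d = "\<Delta>c i"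
  have "(\<Sum>l=1..sF. AF m l * act Fast Mc (FastStage i l)) = ?u ^ 2 / 2 * cF m + ?d * ?u * a1 m + ?d ^ 2 * a11 m"
    if "m \<in> {1..sF}" for m
    using AF_polynomial[of m "act Fast Mc" i "?u ^ 2 / 2" "?d * ?u" 0 "?d ^ 2"] act_fast_c_fast[OF i] that by simp
  moreover have "act Fast (act Fast Mc) (SlowStage (i - 1)) = ?u ^ 3 / 6"
    using i by (intro act_fast_fast_c) auto
  ultimately have "act Fast (act Fast Mc) (FastStage i m) = ?u ^ 3 / 6 + ?d * ?u ^ 2 / 2 * cF m + ?d ^ 2 * ?u * a1 m + ?d ^ 3 * a11 m"
    if "m \<in> {1..sF}" for m
    unfolding act_fast_fast[OF i] using that
    by (simp only:) (simp add: power2_eq_square power3_eq_cube algebra_simps)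
  then show "fast_mean (act Fast (act Fast Mc)) i = ?u ^ 3 / 6 + (?d * ?u ^ 2 / 2) / 2 + (?d ^ 2 * ?u) / 6 + ?d ^ 3 / 24"
    using fast_mean_polynomial[of "act Fast (act Fast Mc)" i "?u ^ 3 / 6" "?d * ?u ^ 2 / 2" 0 0 "?d ^ 2 * ?u" 0 0 "?d ^ 3"] by simp
qed (use assms in \<open>simp_all add: c_pred field_simps power2_eq_square power3_eq_cube power4_eq_xxxx\<close>)

section \<open>Averages of slow actions over fast stages and the coupling matrices\<close>

abbreviation "A\<zeta> \<equiv> coupling_mat s kmax G 1 (zeta sF AF bF cF)"
abbreviation "A\<beta> \<equiv> coupling_mat s kmax G (1/2) (beta sF AF bF cF)"
abbreviation "A\<xi> \<equiv> coupling_mat s kmax G (1/2) (xi sF AF bF cF)"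

text \<open>A slow action at a fast stage consists of a part fixed at the start of the interval,
  which an average multiplies by the sum of its weights, and a part linear in the moments. The three
  weightings turn these into the two summands of the coupling matrices.\<close>

lemma fast_mean_slow:
  assumes i: "i \<in> {2..s}"
  shows "fast_mean (act (Slow \<sigma>) x) i = mat_vec s (A\<zeta> \<sigma>) (\<lambda>j. x (SlowStage j)) i" (is ?zeta)
    and "(\<Sum>m=1..sF. bF m * (cF m * act (Slow \<sigma>) x (FastStage i m))) = mat_vec s (A\<beta> \<sigma>) (\<lambda>j. x (SlowStage j)) i" (is ?beta)
    and "(\<Sum>m=1..sF. bF m * (\<Sum>l=1..sF. AF m l * act (Slow \<sigma>) x (FastStage i l))) = mat_vec s (A\<xi> \<sigma>) (\<lambda>j. x (SlowStage j)) i" (is ?xi)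
proof -
  let ?y = "\<lambda>j. x (SlowStage j)"
  have gen: "(\<Sum>m=1..sF. w m * act (Slow \<sigma>) x (FastStage i m)) = (\<Sum>m=1..sF. w m) * mat_vec s (A \<sigma>) ?y (i - 1)
     + (\<Sum>k=0..kmax. (\<Sum>m=1..sF. w m * fast_moment k m) * mat_vec s (G \<sigma> k) ?y i)" for w
  proof -
    have "(\<Sum>m=1..sF. w m * (\<Sum>k=0..kmax. fast_moment k m * mat_vec s (G \<sigma> k) ?y i)) =
      (\<Sum>k=0..kmax. (\<Sum>m=1..sF. w m * fast_moment k m) * mat_vec s (G \<sigma> k) ?y i)"
      unfolding sum_distrib_left sum_distrib_right by (subst sum.swap) (simp add: mult_ac)
    then show ?thesis
      unfolding act_slow_fast by (simp add: distrib_left sum.distrib sum_distrib_right)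
  qed
  show ?zeta
    unfolding fast_mean_def gen mat_vec_coupling_mat[OF i] fast_weights zeta_def dot_def fast_moment_def by simp
  show ?beta
    using gen[of "\<lambda>m. bF m * cF m"]
    unfolding mat_vec_coupling_mat[OF i] fast_weights beta_def dot_def fast_moment_def had_def by (simp add: mult.assoc)
  \<comment> \<open>The third average is a single one with the column sums of \<open>AF\<close>
    weighted by \<open>bF\<close>. Since the rows of \<open>AF\<close> sum to \<open>cF\<close>,
    these weights sum to 1/2.\<close>
  have "(\<Sum>m=1..sF. bF m * (\<Sum>l=1..sF. AF m l * act (Slow \<sigma>) x (FastStage i l))) =
     (\<Sum>l=1..sF. (\<Sum>m=1..sF. bF m * AF m l) * act (Slow \<sigma>) x (FastStage i l))"
    unfolding sum_distrib_left sum_distrib_right by (subst sum.swap) (simp add: mult_ac)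
  moreover have swap: "(\<Sum>l=1..sF. (\<Sum>m=1..sF. bF m * AF m l) * z l) = (\<Sum>m=1..sF. bF m * (\<Sum>l=1..sF. AF m l * z l))" for z
    unfolding sum_distrib_left sum_distrib_right by (subst sum.swap) (simp add: mult_ac)
  have "(\<Sum>m=1..sF. bF m * (\<Sum>l=1..sF. AF m l * 1)) = (\<Sum>m=1..sF. bF m * cF m)"
    by (intro sum.cong) (simp_all only: mult_1_right AF_row_sum)
  then have "(\<Sum>l=1..sF. \<Sum>m=1..sF. bF m * AF m l) = 1/2"
    using swap[of "\<lambda>_. 1"] by (simp only: fast_weights mult_1_right)
  moreover have "(\<Sum>l=1..sF. (\<Sum>m=1..sF. bF m * AF m l) * fast_moment k l) = xi sF AF bF cF k" for k
    unfolding swap xi_def dot_def fast_moment_def mat_vec_def ..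
  ultimately show ?xi
    using gen[of "\<lambda>l. \<Sum>m=1..sF. bF m * AF m l"] unfolding mat_vec_coupling_mat[OF i] by simp
qed

lemma sum_increments_eq_dot:
  assumes "\<And>i. i \<in> {2..s} \<Longrightarrow> g i = h i"
  shows "(\<Sum>i=2..s. \<Delta>c i * g i) = dot s \<Delta>c h"
proof -
  have "(\<Sum>i=2..s. \<Delta>c i * g i) = (\<Sum>i=2..s. \<Delta>c i * h i)"
    using assms by (intro sum.cong) auto
  also have "\<dots> = (\<Sum>i=1..s. \<Delta>c i * h i)" by (rule sum_from_2)
  finally show ?thesis by (simp add: dot_def)
qed

lemma act_fast_slow_partition:
  "act Fast (act (Slow \<sigma>) x) (SlowStage s) = dot s \<Delta>c (mat_vec s (A\<zeta> \<sigma>) (\<lambda>j. x (SlowStage j)))"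
  unfolding act_fast_slow[OF order_refl] by (rule sum_increments_eq_dot) (rule fast_mean_slow)

text \<open>The node of a fast stage splits into the start of its interval, which gives the factor
  Lc and a zeta average, and the rest \<open>cF m * \<Delta>c i\<close>, which gives a second
  increment and a beta average.\<close>

lemma act_fast_c_slow_partition:
  "act Fast (\<lambda>r. Mc r * act (Slow \<sigma>) Mc r) (SlowStage s) =
    dot s (had \<Delta>c (mat_vec s L_mat c)) (mat_vec s (A\<zeta> \<sigma>) c) + dot s (had_pow \<Delta>c 2) (mat_vec s (A\<beta> \<sigma>) c)"
proof -
  have "fast_mean (\<lambda>r. Mc r * act (Slow \<sigma>) Mc r) i =
      mat_vec s L_mat c i * mat_vec s (A\<zeta> \<sigma>) c i + \<Delta>c i * mat_vec s (A\<beta> \<sigma>) c i" if i: "i \<in> {2..s}" for i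
  proof -
    have "fast_mean (\<lambda>r. Mc r * act (Slow \<sigma>) Mc r) i = c (i - 1) * fast_mean (act (Slow \<sigma>) Mc) i +
        \<Delta>c i * (\<Sum>m=1..sF. bF m * (cF m * act (Slow \<sigma>) Mc (FastStage i m)))"
      unfolding fast_mean_def sum_distrib_left sum.distrib[symmetric] by (intro sum.cong) (simp_all add: algebra_simps)
    then show ?thesis by (simp only: fast_mean_slow[OF i] mat_vec_L[OF i] mri_c.simps)
  qed
  from sum_increments_eq_dot[OF this] show ?thesis
    unfolding act_fast_slow[OF order_refl]
    by (simp add: dot_def had_def had_pow_def power2_eq_square distrib_left sum.distrib mult.assoc)
qed

text \<open>The inner fast action splits at the start of the current interval: the completed
  intervals produce L Delta C acting on zeta averages, the unfinished one a second increment and a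
  xi average.\<close>

lemma act_fast_fast_slow_partition:
  "act Fast (act Fast (act (Slow \<sigma>) Mc)) (SlowStage s) =
    dot s (had_pow \<Delta>c 2) (mat_vec s (A\<xi> \<sigma>) c)
      + dot s \<Delta>c (mat_vec s L_mat (mat_vec s (DeltaC_mat c) (mat_vec s (A\<zeta> \<sigma>) c)))"
proof -
  have "fast_mean (act Fast (act (Slow \<sigma>) Mc)) i = \<Delta>c i * mat_vec s (A\<xi> \<sigma>) c i +
      mat_vec s L_mat (mat_vec s (DeltaC_mat c) (mat_vec s (A\<zeta> \<sigma>) c)) i" if i: "i \<in> {2..s}" for i
  proof -
    have "fast_mean (act Fast (act (Slow \<sigma>) Mc)) i = act Fast (act (Slow \<sigma>) Mc) (SlowStage (i - 1)) * (\<Sum>m=1..sF. bF m) +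
        \<Delta>c i * (\<Sum>m=1..sF. bF m * (\<Sum>l=1..sF. AF m l * act (Slow \<sigma>) Mc (FastStage i l)))"
      unfolding fast_mean_def act_fast_fast[OF i] sum_distrib_left sum.distrib[symmetric]
      by (intro sum.cong) (simp_all add: algebra_simps sum_distrib_left)
    moreover have "act Fast (act (Slow \<sigma>) Mc) (SlowStage (i - 1)) = mat_vec s (DeltaC_mat c) (mat_vec s (A\<zeta> \<sigma>) c) (i - 1)"
    proof -
      have "act Fast (act (Slow \<sigma>) Mc) (SlowStage (i - 1)) = (\<Sum>i'=2..i - 1. \<Delta>c i' * fast_mean (act (Slow \<sigma>) Mc) i')"
        using i by (intro act_fast_slow) auto
      also have "\<dots> = (\<Sum>i'=2..i - 1. \<Delta>c i' * mat_vec s (A\<zeta> \<sigma>) c i')"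
        using i by (intro sum.cong) (auto simp: fast_mean_slow)
      also have "\<dots> = (\<Sum>i'=1..i - 1. \<Delta>c i' * mat_vec s (A\<zeta> \<sigma>) c i')"
      proof -
        have "{1..i - 1} = insert 1 {2..i - 1}" using i by auto
        then show ?thesis by (simp add: increment_1)
      qed
      finally show ?thesis using i by (subst mat_vec_DeltaC) auto
    qed
    ultimately show ?thesis unfolding fast_weights fast_mean_slow(3)[OF i] by (simp add: mat_vec_L[OF i])
  qed
  from sum_increments_eq_dot[OF this] show ?thesis
    unfolding act_fast_slow[OF order_refl]
    by (simp add: dot_def had_pow_def power2_eq_square distrib_left sum.distrib mult.assoc)
qed

text \<open>After exchanging the sums, the interval \<open>i\<close> is felt by every slow stage
  \<open>j \<ge> i\<close>. Its weight is the sum of the corresponding entries of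
  \<open>b \<sigma>\<close>, which is entry \<open>i\<close> of D b.\<close>

lemma act_slow_fast_slow_partition:
  "act (Slow \<sigma>) (act Fast (act (Slow \<nu>) Mc)) (SlowStage s) =
    dot s (had \<Delta>c (mat_vec s D_mat (b \<sigma>))) (mat_vec s (A\<zeta> \<nu>) c)"
proof -
  let ?v = "mat_vec s (A\<zeta> \<nu>) c"
  have "act Fast (act (Slow \<nu>) Mc) (SlowStage j) = (\<Sum>i=1..s. if i \<le> j then \<Delta>c i * ?v i else 0)" if j: "j \<in> {1..s}" for j
  proof -
    have "act Fast (act (Slow \<nu>) Mc) (SlowStage j) = (\<Sum>i=2..j. \<Delta>c i * fast_mean (act (Slow \<nu>) Mc) i)"
      using j by (intro act_fast_slow) auto
    also have "\<dots> = (\<Sum>i=2..j. \<Delta>c i * ?v i)"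
      using j by (intro sum.cong) (auto simp: fast_mean_slow)
    also have "\<dots> = (\<Sum>i=1..j. \<Delta>c i * ?v i)"
    proof -
      have "{1..j} = insert 1 {2..j}" using j by auto
      then show ?thesis by (simp add: increment_1)
    qed
    also have "\<dots> = (\<Sum>i\<in>{1..j}. if i \<le> j then \<Delta>c i * ?v i else 0)" by simp
    also have "\<dots> = (\<Sum>i=1..s. if i \<le> j then \<Delta>c i * ?v i else 0)"
      using j by (intro sum.mono_neutral_left) auto
    finally show ?thesis .
  qed
  then have "act (Slow \<sigma>) (act Fast (act (Slow \<nu>) Mc)) (SlowStage s) =
      (\<Sum>j=1..s. A \<sigma> s j * (\<Sum>i=1..s. if i \<le> j then \<Delta>c i * ?v i else 0))"
    unfolding act_slow_slow mat_vec_def[of s "A \<sigma>"] by (intro sum.cong) auto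
  also have "\<dots> = (\<Sum>i=1..s. \<Delta>c i * ?v i * (\<Sum>j=1..s. if i \<le> j then A \<sigma> s j else 0))"
    unfolding sum_distrib_left by (subst sum.swap) (auto intro!: sum.cong)
  also have "\<dots> = (\<Sum>i=1..s. \<Delta>c i * mat_vec s D_mat (b \<sigma>) i * ?v i)"
    by (intro sum.cong refl) (simp add: mat_vec_def D_mat_def base_b_def if_distrib[of "\<lambda>z. z * _"] cong: if_cong)
  finally show ?thesis by (simp add: dot_def had_def)
qed

text \<open>This is what gives each stage a single node. At slow stages it is the row sum condition
  of the base method, at fast stages that of the coefficient matrices; the fast partition follows
  from the row sums of \<open>AF\<close>.\<close>

lemma act_one:
  assumes "q \<in> Q" shows "act p (\<lambda>_. 1) q = Mc q"
proof -
  have slow: "mat_vec s (A \<sigma>) (\<lambda>_. 1) i = c i" if "i \<in> {1..s}" for \<sigma> i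
    using base_consistent that by (simp add: base_internally_consistent_def ones_def)
  have G: "(\<Sum>k=0..kmax. fast_moment k m * mat_vec s (G \<sigma> k) (\<lambda>_. 1) i) = cF m * \<Delta>c i"
    if "i \<in> {2..s}" "m \<in> {1..sF}" for \<sigma> i m
  proof -
    \<comment> \<open>Only \<open>k = 0\<close> contributes, since the higher coefficient matrices
      have zero row sums; \<open>fast_moment 0 m\<close> is the row sum \<open>cF m\<close>.\<close>
    have "(\<Sum>k=0..kmax. fast_moment k m * mat_vec s (G \<sigma> k) (\<lambda>_. 1) i) = (\<Sum>k\<in>{0}. fast_moment k m * mat_vec s (G \<sigma> k) (\<lambda>_. 1) i)"
      using consistent that by (intro sum.mono_neutral_right) (auto simp: mri_internally_consistent_def ones_def)
    also have "\<dots> = cF m * \<Delta>c i"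
      using consistent that AF_row_sum[OF that(2)]
      by (auto simp: mri_internally_consistent_def ones_def fast_moment_def had_pow_def mat_vec_def)
    finally show ?thesis .
  qed
  show ?thesis
  proof (cases q)
    case (SlowStage i)
    with assms have "i \<in> {1..s}" by (auto simp: mri_stages_def)
    with SlowStage show ?thesis by (cases p) (simp_all add: act_slow_slow slow act_fast_one)
  next
    case (FastStage i m)
    with assms have i: "i \<in> {2..s}" and m: "m \<in> {1..sF}" by (auto simp: mri_stages_def)
    then have "i - 1 \<in> {1..s}" by auto
    show ?thesis
    proof (cases p)
      case (Slow \<sigma>)
      with FastStage show ?thesis by (simp only: act_slow_fast slow[OF \<open>i - 1 \<in> {1..s}\<close>] G[OF i m] mri_c.simps)
    next
      case Fast
      with FastStage show ?thesis
        by (simp only: act_fast_fast[OF i] act_fast_one[OF \<open>i - 1 \<in> {1..s}\<close>] mult_1_right AF_row_sum[OF m] mri_c.simps mult.commute[of "\<Delta>c i"])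
    qed
  qed
qed

section \<open>Comparison of the conditions of the scheme and of its base method\<close>

lemma mri_has_order_4_iff:
  "mri_has_order s kmax c G sF AF bF cF 4 \<longleftrightarrow> ark_conditions_4 Q MA Mb Mc"
  unfolding mri_has_order_def mri_step_eq_ark_step
  using act_one by (intro ark_has_order_4_iff) (simp add: act_def)

lemma base_has_order_eq:
  "base_has_order s kmax c G n \<longleftrightarrow> has_order {1..s} (ark_step {1..s} A (\<lambda>\<sigma>. A \<sigma> s) c) n"
  unfolding base_has_order_def imex_ark_step_eq_ark_step[OF s_ge_1] ..

lemma base_has_order_4_iff:
  "base_has_order s kmax c G 4 \<longleftrightarrow> ark_conditions_4 {1..s} A (\<lambda>\<sigma>. A \<sigma> s) c"
  unfolding base_has_order_eq
  using base_consistent by (intro ark_has_order_4_iff) (simp add: base_internally_consistent_def mat_vec_def ones_def)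

lemma base_conditions_3_iff:
  "ark_conditions_3 {1..s} A (\<lambda>\<sigma>. A \<sigma> s) c \<longleftrightarrow>
    (\<forall>\<sigma>. mat_vec s (A \<sigma>) ones s = 1) \<and> (\<forall>\<sigma>. mat_vec s (A \<sigma>) c s = 1/2) \<and>
    (\<forall>\<sigma>. mat_vec s (A \<sigma>) (\<lambda>j. c j ^ 2) s = 1/3) \<and>
    (\<forall>\<sigma> \<nu>. mat_vec s (A \<sigma>) (mat_vec s (A \<nu>) c) s = 1/6)"
  unfolding ark_conditions_3_def mat_vec_def ones_def mult_1_right ..

lemma base_conditions_4_iff:
  "ark_conditions_4 {1..s} A (\<lambda>\<sigma>. A \<sigma> s) c \<longleftrightarrow> ark_conditions_3 {1..s} A (\<lambda>\<sigma>. A \<sigma> s) c \<and>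
    (\<forall>\<sigma>. mat_vec s (A \<sigma>) (\<lambda>j. c j ^ 3) s = 1/4) \<and>
    (\<forall>\<sigma> \<nu>. mat_vec s (A \<sigma>) (\<lambda>j. c j * mat_vec s (A \<nu>) c j) s = 1/8) \<and>
    (\<forall>\<sigma> \<nu>. mat_vec s (A \<sigma>) (mat_vec s (A \<nu>) (\<lambda>j. c j ^ 2)) s = 1/12) \<and>
    (\<forall>\<sigma> \<nu> \<rho>. mat_vec s (A \<sigma>) (mat_vec s (A \<nu>) (mat_vec s (A \<rho>) c)) s = 1/24)"
  unfolding ark_conditions_4_def mat_vec_def ..

text \<open>As the weights are the last slow row, every outer sum is itself an action evaluated at
  \<open>SlowStage s\<close>.\<close>

lemma mri_conditions_4_iff:
  "ark_conditions_4 Q MA Mb Mc \<longleftrightarrow>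
    (\<forall>p. act p (\<lambda>_. 1) (SlowStage s) = 1) \<and> (\<forall>p. act p Mc (SlowStage s) = 1/2) \<and>
    (\<forall>p. act p (\<lambda>r. Mc r ^ 2) (SlowStage s) = 1/3) \<and>
    (\<forall>p p'. act p (act p' Mc) (SlowStage s) = 1/6) \<and>
    (\<forall>p. act p (\<lambda>r. Mc r ^ 3) (SlowStage s) = 1/4) \<and>
    (\<forall>p p'. act p (\<lambda>r. Mc r * act p' Mc r) (SlowStage s) = 1/8) \<and>
    (\<forall>p p'. act p (act p' (\<lambda>r. Mc r ^ 2)) (SlowStage s) = 1/12) \<and>
    (\<forall>p p' p''. act p (act p' (act p'' Mc)) (SlowStage s) = 1/24)"
  unfolding ark_conditions_4_def ark_conditions_3_def act_def mult_1_right by (simp only: conj_assoc)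

text \<open>Purely fast conditions become powers of \<open>c s\<close>, which is 1. A fast action on
  powers of the nodes below a slow one only raises the power, so it repeats a base condition up to a
  factor. Among conditions with a fast root, fast-slow is the third-order hypothesis and
  fast-slow-fast is half of the coupling condition with 1/12; the others are coupling conditions in
  their own right, as is slow-fast-slow.\<close>

lemma mri_conditions_4_iff_coupling:
  assumes base: "ark_conditions_3 {1..s} A (\<lambda>\<sigma>. A \<sigma> s) c"
    and third: "\<And>\<sigma>. dot s \<Delta>c (mat_vec s (A\<zeta> \<sigma>) c) = 1/6"
  shows "ark_conditions_4 Q MA Mb Mc \<longleftrightarrow> ark_conditions_4 {1..s} A (\<lambda>\<sigma>. A \<sigma> s) c \<and>
    (\<forall>\<sigma> \<nu>.
       dot s (had \<Delta>c (mat_vec s L_mat c)) (mat_vec s (A\<zeta> \<sigma>) c)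
         + dot s (had_pow \<Delta>c 2) (mat_vec s (A\<beta> \<sigma>) c) = 1/8 \<and>
       dot s \<Delta>c (mat_vec s (A\<zeta> \<sigma>) (had_pow c 2)) = 1/12 \<and>
       dot s (had \<Delta>c (mat_vec s D_mat (b \<sigma>))) (mat_vec s (A\<zeta> \<nu>) c) = 1/24 \<and>
       dot s (had_pow \<Delta>c 2) (mat_vec s (A\<xi> \<sigma>) c)
         + dot s \<Delta>c (mat_vec s L_mat (mat_vec s (DeltaC_mat c) (mat_vec s (A\<zeta> \<sigma>) c))) = 1/24 \<and>
       dot s \<Delta>c (mat_vec s (A\<zeta> \<sigma>) (mat_vec s (A \<nu>) c)) = 1/24)"
proof -
  note base3 = base[unfolded base_conditions_3_iff]
  have s: "s \<in> {1..s}" using s_ge_1 by simp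
  \<comment> \<open>The last row of the base matrix is the weight vector: its sum is
    \<open>c s\<close> by consistency and 1 by the order of the base method.\<close>
  have "mat_vec s (A Impl) ones s = c s"
    using base_consistent s by (simp add: base_internally_consistent_def)
  with base3 have cs: "c s = 1" by simp
  have slow_one: "mat_vec s M (\<lambda>_. 1) s = mat_vec s M ones s" for M by (simp add: ones_def)
  have fast: "mat_vec s M (\<lambda>j. act Fast Mc (SlowStage j)) i = mat_vec s M (\<lambda>j. c j ^ 2) i / 2"
    "mat_vec s M (\<lambda>j. c j * act Fast Mc (SlowStage j)) i = mat_vec s M (\<lambda>j. c j ^ 3) i / 2"
    "mat_vec s M (\<lambda>j. act Fast (\<lambda>r. Mc r ^ 2) (SlowStage j)) i = mat_vec s M (\<lambda>j. c j ^ 3) i / 3"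
    "mat_vec s M (\<lambda>j. act Fast (act Fast Mc) (SlowStage j)) i = mat_vec s M (\<lambda>j. c j ^ 3) i / 6" for M i
    unfolding mat_vec_divide[symmetric]
    by (rule mat_vec_cong,
        simp add: act_fast_c act_fast_c2 act_fast_fast_c; simp add: power2_eq_square power3_eq_cube)+
  have fast': "mat_vec s M (\<lambda>j. act Fast Mc (SlowStage j)) = (\<lambda>i. mat_vec s M (\<lambda>j. c j ^ 2) i / 2)" for M
    using fast(1) by blast
  have dot_div: "dot s \<Delta>c (\<lambda>i. x i / 2) = dot s \<Delta>c x / 2" for x
    by (simp add: dot_def sum_divide_distrib)
  have slow: "act (Slow \<sigma>) (\<lambda>_. 1) (SlowStage s) = mat_vec s (A \<sigma>) ones s"
    "act (Slow \<sigma>) Mc (SlowStage s) = mat_vec s (A \<sigma>) c s"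
    "act (Slow \<sigma>) (\<lambda>r. Mc r ^ 2) (SlowStage s) = mat_vec s (A \<sigma>) (\<lambda>j. c j ^ 2) s"
    "act (Slow \<sigma>) (\<lambda>r. Mc r ^ 3) (SlowStage s) = mat_vec s (A \<sigma>) (\<lambda>j. c j ^ 3) s"
    "act (Slow \<sigma>) (act (Slow \<nu>) Mc) (SlowStage s) = mat_vec s (A \<sigma>) (mat_vec s (A \<nu>) c) s"
    "act (Slow \<sigma>) (act Fast Mc) (SlowStage s) = mat_vec s (A \<sigma>) (\<lambda>j. c j ^ 2) s / 2"
    "act (Slow \<sigma>) (\<lambda>r. Mc r * act (Slow \<nu>) Mc r) (SlowStage s) = mat_vec s (A \<sigma>) (\<lambda>j. c j * mat_vec s (A \<nu>) c j) s"
    "act (Slow \<sigma>) (\<lambda>r. Mc r * act Fast Mc r) (SlowStage s) = mat_vec s (A \<sigma>) (\<lambda>j. c j ^ 3) s / 2"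
    "act (Slow \<sigma>) (act (Slow \<nu>) (\<lambda>r. Mc r ^ 2)) (SlowStage s) = mat_vec s (A \<sigma>) (mat_vec s (A \<nu>) (\<lambda>j. c j ^ 2)) s"
    "act (Slow \<sigma>) (act Fast (\<lambda>r. Mc r ^ 2)) (SlowStage s) = mat_vec s (A \<sigma>) (\<lambda>j. c j ^ 3) s / 3"
    "act (Slow \<sigma>) (act (Slow \<nu>) (act (Slow \<rho>) Mc)) (SlowStage s) = mat_vec s (A \<sigma>) (mat_vec s (A \<nu>) (mat_vec s (A \<rho>) c)) s"
    "act (Slow \<sigma>) (act (Slow \<nu>) (act Fast Mc)) (SlowStage s) = mat_vec s (A \<sigma>) (mat_vec s (A \<nu>) (\<lambda>j. c j ^ 2)) s / 2"
    "act (Slow \<sigma>) (act Fast (act Fast Mc)) (SlowStage s) = mat_vec s (A \<sigma>) (\<lambda>j. c j ^ 3) s / 6" for \<sigma> \<nu> \<rho>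
    unfolding act_slow_slow mri_c.simps fast fast' slow_one mat_vec_divide by (rule refl)+
  have fast_root: "act Fast (act (Slow \<sigma>) Mc) (SlowStage s) = dot s \<Delta>c (mat_vec s (A\<zeta> \<sigma>) c)"
    "act Fast (act (Slow \<sigma>) (\<lambda>r. Mc r ^ 2)) (SlowStage s) = dot s \<Delta>c (mat_vec s (A\<zeta> \<sigma>) (had_pow c 2))"
    "act Fast (act (Slow \<sigma>) (act (Slow \<nu>) Mc)) (SlowStage s) = dot s \<Delta>c (mat_vec s (A\<zeta> \<sigma>) (mat_vec s (A \<nu>) c))"
    "act Fast (act (Slow \<sigma>) (act Fast Mc)) (SlowStage s) = dot s \<Delta>c (mat_vec s (A\<zeta> \<sigma>) (had_pow c 2)) / 2" for \<sigma> \<nu>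
    unfolding act_fast_slow_partition act_slow_slow mri_c.simps fast' dot_div had_pow_def by (rule refl)+
  show ?thesis
    unfolding mri_conditions_4_iff base_conditions_4_iff all_part slow fast_root
      act_fast_c_slow_partition act_fast_fast_slow_partition act_slow_fast_slow_partition
      act_fast_one[OF s] act_fast_c[OF s] act_fast_c2[OF s] act_fast_c3[OF s] act_fast_fast_c[OF s]
      act_fast_c_fast_c[OF s] act_fast_fast_c2[OF s] act_fast_fast_fast_c[OF s] cs
    using base base3 third by (auto simp: mult.commute)
qed

end

theorem theorem2p4:
  fixes s kmax sF :: nat
    and c :: vec and \<Gamma> \<Omega> :: "nat \<Rightarrow> matr"
    and AF :: matr and bF cF :: vec
  defines "G \<equiv> slow_coeffs_of \<Gamma> \<Omega>"
  defines "\<Delta>c \<equiv> increments c"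
  defines "A \<equiv> base_A s kmax G" and "b \<equiv> base_b s kmax G"
  defines "A\<zeta> \<equiv> coupling_mat s kmax G 1 (zeta sF AF bF cF)"
  defines "A\<beta> \<equiv> coupling_mat s kmax G (1/2) (beta sF AF bF cF)"
  defines "A\<xi> \<equiv> coupling_mat s kmax G (1/2) (xi sF AF bF cF)"
  assumes data: "mri_gark_data s kmax c G"
    and fast_consistent: "\<And>p. p \<in> {1..sF} \<Longrightarrow> mat_vec sF AF ones p = cF p"
    and fast_order: "rk_has_order sF AF bF cF 4"
    and fast_quadrature: "\<And>k. k \<le> kmax \<Longrightarrow> dot sF bF (had_pow cF k) = 1 / (real k + 1)"
    and base_consistent: "base_internally_consistent s kmax c G"
    and consistent: "mri_internally_consistent s kmax c G"
    and base_order: "base_has_order s kmax c G 3"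
    and third_order_coupling: "\<And>\<sigma>. dot s \<Delta>c (mat_vec s (A\<zeta> \<sigma>) c) = 1/6"
  shows "mri_has_order s kmax c G sF AF bF cF 4 \<longleftrightarrow>
    base_has_order s kmax c G 4 \<and>
    (\<forall>\<sigma> \<nu>.
       dot s (had \<Delta>c (mat_vec s L_mat c)) (mat_vec s (A\<zeta> \<sigma>) c)
         + dot s (had_pow \<Delta>c 2) (mat_vec s (A\<beta> \<sigma>) c) = 1/8 \<and>
       dot s \<Delta>c (mat_vec s (A\<zeta> \<sigma>) (had_pow c 2)) = 1/12 \<and>
       dot s (had \<Delta>c (mat_vec s D_mat (b \<sigma>))) (mat_vec s (A\<zeta> \<nu>) c) = 1/24 \<and>
       dot s (had_pow \<Delta>c 2) (mat_vec s (A\<xi> \<sigma>) c)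
         + dot s \<Delta>c (mat_vec s L_mat (mat_vec s (DeltaC_mat c) (mat_vec s (A\<zeta> \<sigma>) c))) = 1/24 \<and>
       dot s \<Delta>c (mat_vec s (A\<zeta> \<sigma>) (mat_vec s (A \<nu>) c)) = 1/24)"
proof -
  \<comment> \<open>The order of the fast method, like the third order of the base method below, is
    used through the algebraic conditions that the cascade problems extract from it.\<close>
  have "ark_conditions_4 {1..sF} (\<lambda>_ :: unit. AF) (\<lambda>_. bF) cF"
    using fast_order unfolding rk_has_order_def rk_step_eq_ark_step by (rule has_order_4_imp_conditions)
  then interpret mri_method s kmax sF c G AF bF cF
    using data fast_consistent fast_quadrature base_consistent consistent by unfold_locales
  have "ark_conditions_3 {1..s} (base_A s kmax G) (\<lambda>\<sigma>. base_A s kmax G \<sigma> s) c"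
    using base_order unfolding base_has_order_eq by (rule has_order_3_imp_conditions)
  then show ?thesis
    unfolding mri_has_order_4_iff base_has_order_4_iff A_def b_def A\<zeta>_def A\<beta>_def A\<xi>_def \<Delta>c_def
    by (rule mri_conditions_4_iff_coupling) (rule third_order_coupling[unfolded \<Delta>c_def A\<zeta>_def])
qed

end
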